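(* Let $p_0\in(0,1)$ and $\varepsilon>0$ be constants and let $p=p(n)$ satisfy $0<p\le p_0$ and $p\ge \dfrac{(\log n)^{2/3+\varepsilon}}{n^{1/6}}$. Let $A$ be the adjacency matrix of the Erdős–Rényi random graph $G(n,p)$, let $\alpha=(n-1)p-1$, let $H$ be the non-backtracking spectrum operator for $A$, and let $H_0$ be its partial derandomization. Then, with probability $1-o(1)$ as $n\to\infty$, each eigenvalue of $\frac1{\sqrt\alpha}H$ is within distance $$R=40\sqrt{\frac{\log n}{np^2}}$$ of an eigenvalue of $\frac1{\sqrt\alpha}H_0$.
   Context: $G(n,p)$ is the random graph on $n$ vertices in which each edge $ij$, $i<j$, is present independently with probability $p$, with no loops; $A$ is its $n\times n$ adjacency matrix and $D$ is the diagonal degree matrix, $D_{ii}=\sum_{j=1}^n A_{ij}$. With $I$ the $n\times n$ identity, $$H=\begin{pmatrix} A & I-D\\ I & 0\end{pmatrix},\qquad H_0=\begin{pmatrix} A & I-\mathbb E(D)\\ I & 0\end{pmatrix}=\begin{pmatrix} A & -\alpha I\\ I & 0\end{pmatrix},$$ both $2n\times 2n$. $H$ is called the non-backtracking spectrum operator for $A$. (Under the hypotheses $\alpha>0$ for all large $n$.) Distance is the usual distance in $\mathbb C$. $o(1)$ denotes a quantity tending to $0$ as $n\to\infty$. *)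

theory Defs
  imports "HOL-Probability.Probability" "Jordan_Normal_Form.Char_Poly"
begin

type_synonym edge_config = "nat \<times> nat \<Rightarrow> bool"

definition vertex_pairs :: "nat \<Rightarrow> (nat \<times> nat) set" where
  "vertex_pairs n = {(i, j). i < j \<and> j < n}"

text \<open>
  The random graph G(n,p) on the vertices 0, ..., n - 1: independent Bernoulli variables indexed
  by the pairs i < j; outside these pairs a configuration is constantly \<open>False\<close>.
\<close>

definition gnp :: "nat \<Rightarrow> real \<Rightarrow> edge_config pmf" where
  "gnp n p = Pi_pmf (vertex_pairs n) False (\<lambda>_. bernoulli_pmf p)"

definition adj_mat :: "nat \<Rightarrow> edge_config \<Rightarrow> real mat" where
  "adj_mat n E = Matrix.mat n n
     (\<lambda>(i, j). if i < j then of_bool (E (i, j)) else if j < i then of_bool (E (j, i)) else 0)"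

definition deg_mat :: "nat \<Rightarrow> edge_config \<Rightarrow> real mat" where
  "deg_mat n E = Matrix.mat n n
     (\<lambda>(i, j). if i = j then \<Sum>k<n. adj_mat n E $$ (i, k) else 0)"

definition exp_deg_mat :: "nat \<Rightarrow> real \<Rightarrow> real mat" where
  "exp_deg_mat n p = Matrix.mat n n
     (\<lambda>ij. measure_pmf.expectation (gnp n p) (\<lambda>E. deg_mat n E $$ ij))"

definition nb_mat :: "nat \<Rightarrow> edge_config \<Rightarrow> real mat" where
  "nb_mat n E = four_block_mat (adj_mat n E) (1\<^sub>m n - deg_mat n E) (1\<^sub>m n) (0\<^sub>m n n)"

definition nb_mat0 :: "nat \<Rightarrow> real \<Rightarrow> edge_config \<Rightarrow> real mat" where
  "nb_mat0 n p E = four_block_mat (adj_mat n E) (1\<^sub>m n - exp_deg_mat n p) (1\<^sub>m n) (0\<^sub>m n n)"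

definition alpha :: "nat \<Rightarrow> real \<Rightarrow> real" where
  "alpha n p = (real n - 1) * p - 1"

definition scaled_eigenvalue :: "nat \<Rightarrow> real \<Rightarrow> real mat \<Rightarrow> complex \<Rightarrow> bool" where
  "scaled_eigenvalue n p M z \<longleftrightarrow>
     eigenvalue (map_mat complex_of_real ((1 / sqrt (alpha n p)) \<cdot>\<^sub>m M)) z"

lemma finite_vertex_pairs [simp]: "finite (vertex_pairs n)"
  by (rule finite_subset[of _ "{..<n} \<times> {..<n}"]) (auto simp: vertex_pairs_def)

lemma expectation_gnp_edge:
  assumes "0 \<le> p" "p \<le> 1" "e \<in> vertex_pairs n"
  shows "measure_pmf.expectation (gnp n p) (\<lambda>E. of_bool (E e) :: real) = p"
proof -
  have "measure_pmf.expectation (gnp n p) (\<lambda>E. of_bool (E e) :: real)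
      = measure_pmf.expectation (map_pmf (\<lambda>E. E e) (gnp n p)) of_bool"
    by simp
  also have "map_pmf (\<lambda>E. E e) (gnp n p) = bernoulli_pmf p"
    using assms by (simp add: gnp_def Pi_pmf_component)
  finally show ?thesis using assms by simp
qed

lemma exp_deg_mat_eq:
  assumes "0 \<le> p" "p \<le> 1"
  shows "exp_deg_mat n p = ((real n - 1) * p) \<cdot>\<^sub>m 1\<^sub>m n"
proof (rule eq_matI)
  fix i j assume "i < dim_row (((real n - 1) * p) \<cdot>\<^sub>m 1\<^sub>m n)"
    "j < dim_col (((real n - 1) * p) \<cdot>\<^sub>m 1\<^sub>m n)"
  then have ij: "i < n" "j < n" by auto
  have adj: "measure_pmf.expectation (gnp n p) (\<lambda>E. adj_mat n E $$ (i, k))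
      = (if k = i then 0 else p)" if "k < n" for k
    using expectation_gnp_edge[OF assms, of "(i, k)" n]
      expectation_gnp_edge[OF assms, of "(k, i)" n] that ij
    by (cases i k rule: linorder_cases) (auto simp: adj_mat_def vertex_pairs_def)
  have fin: "finite (set_pmf (gnp n p))"
    unfolding gnp_def
    by (rule finite_subset[OF set_Pi_pmf_subset']) (auto intro!: finite_PiE_dflt)
  have "measure_pmf.expectation (gnp n p) (\<lambda>E. \<Sum>k<n. adj_mat n E $$ (i, k))
      = (\<Sum>k<n. measure_pmf.expectation (gnp n p) (\<lambda>E. adj_mat n E $$ (i, k)))"
    by (intro Bochner_Integration.integral_sum integrable_measure_pmf_finite fin)
  also have "\<dots> = (\<Sum>k<n. if k = i then 0 else p)"
    by (intro sum.cong) (auto simp: adj)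
  also have "\<dots> = (\<Sum>k<n. p) - (\<Sum>k<n. if k = i then p else 0)"
    by (subst sum_subtractf[symmetric]) (auto intro!: sum.cong)
  also have "\<dots> = (real n - 1) * p" using ij by (simp add: algebra_simps)
  finally show "exp_deg_mat n p $$ (i, j) = (((real n - 1) * p) \<cdot>\<^sub>m 1\<^sub>m n) $$ (i, j)"
    using ij by (auto simp: exp_deg_mat_def deg_mat_def)
qed (auto simp: exp_deg_mat_def)

lemma nb_mat0_eq:
  assumes "0 \<le> p" "p \<le> 1"
  shows "nb_mat0 n p E =
    four_block_mat (adj_mat n E) ((- alpha n p) \<cdot>\<^sub>m 1\<^sub>m n) (1\<^sub>m n) (0\<^sub>m n n)"
proof -
  have "1\<^sub>m n - exp_deg_mat n p = (- alpha n p) \<cdot>\<^sub>m 1\<^sub>m n"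
    unfolding exp_deg_mat_eq[OF assms]
    by (rule eq_matI) (auto simp: alpha_def algebra_simps)
  then show ?thesis by (simp add: nb_mat0_def)
qed

end

(*
  A scaled eigenvalue z of H satisfies a quadratic eigenvalue equation for A whose constant term
  involves the degrees; replacing them by their mean costs d = O(sqrt(n p log n)) by a Chernoff
  bound. As A is symmetric, z^2 - l z + 1 = O(d / alpha) for some scaled eigenvalue l of A. The roots
  of z^2 - l z + 1 are eigenvalues of H_0, and they are at distance |l^2 - 4|^(1/2) from each other,
  so it suffices that l^2 stays away from 4 by p. The entries of A have variance p (1 - p), so all
  but one of its eigenvalues are essentially at most 2 sqrt(n p (1 - p)), whereas alpha is about n p:
  this gives the gap, provided that the norm of A - E A is controlled up to a factor 1 + O(p).

  This is achieved with moments of order log n / p. A closed walk contributes to the expected trace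
  only if it uses each edge at least twice, and it is dominated by a weight depending only on its set
  of edges. Removing the first edge yields a recursion for the total weight of all walks which is the
  Catalan recursion up to errors; it is solved by bounding a partial sum of the generating function.
*)
theory Submission
  imports Defs "Jordan_Normal_Form.Schur_Decomposition" "HOL-Real_Asymp.Real_Asymp"
begin

section \<open>Weighted walks\<close>

text \<open>\<open>H\<close> is not normal in general, so a norm bound on \<open>H - H_0\<close>
  says little about eigenvalues; the detour through the symmetric \<open>A\<close> avoids this, at
  the price of a square root singularity of the roots at \<open>l = 2\<close> and
  \<open>l = -2\<close>. The scaled bulk of the spectrum of \<open>A\<close> ends near
  \<open>2 * sqrt (1 - p)\<close>, so only the factor \<open>1 - p\<close> of the variance keeps it
  away from there. This is spent as follows: the moments are controlled up to \<open>\<rho>\<close>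
  with square \<open>4 n p (1 - p) (1 + p / 4)\<close>, the norm up to \<open>\<theta>\<close> with
  square \<open>4 n p (1 - p) (1 + p / 2)\<close>, and
  \<open>(1 - p) (1 + p / 2) \<le> 1 - p / 2\<close> leaves a gap of order \<open>p\<close>.

  The trace exceeds the \<open>K\<close>-th power of the norm by a factor of up to \<open>n\<close>,
  which Markov's inequality must absorb in \<open>(\<rho> / \<theta>) ^ K\<close>. As
  \<open>\<rho> / \<theta>\<close> is below 1 only by a multiple of \<open>p\<close>, this forces
  \<open>K\<close> of order \<open>log n / p\<close>. For walks of this length the relative errors
  in the recursion, the largest of order \<open>K / sqrt (n p)\<close>, have to stay below
  \<open>p\<close>; \<open>p \<ge> n powr (-1/6)\<close> leaves room for that.\<close>

fun edges_of :: "'a list \<Rightarrow> 'a set multiset" where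
  "edges_of (a # b # vs) = add_mset {a, b} (edges_of (b # vs))"
| "edges_of _ = {#}"

lemma edges_of_glue_Cons: "edges_of (u @ v # w) = edges_of (u @ [v]) + edges_of (v # w)"
proof (induction u)
  case (Cons a u)
  then show ?case by (cases u) auto
qed auto

lemma edges_of_append:
  assumes "u \<noteq> []" "v \<noteq> []"
  shows "edges_of (u @ v) = add_mset {last u, hd v} (edges_of u + edges_of v)"
proof -
  obtain u' a where u: "u = u' @ [a]" using assms(1) by (metis append_butlast_last_id)
  obtain b v' where v: "v = b # v'" using assms(2) by (cases v) auto
  have "edges_of (u @ v) = edges_of (u' @ a # b # v')" by (simp add: u v)
  also have "\<dots> = edges_of (u' @ [a]) + edges_of (a # b # v')" by (rule edges_of_glue_Cons)
  finally show ?thesis by (simp add: u v)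
qed

lemma edges_of_glue:
  assumes "u \<noteq> []" "v \<noteq> []" "last u = hd v"
  shows "edges_of (u @ tl v) = edges_of u + edges_of v"
proof -
  obtain u' a where u: "u = u' @ [a]" using assms(1) by (metis append_butlast_last_id)
  obtain v' where v: "v = a # v'" using assms u by (cases v) auto
  show ?thesis using edges_of_glue_Cons[of u' a v'] by (simp add: u v)
qed

lemma edges_of_rev: "edges_of (rev vs) = edges_of vs"
proof (induction vs rule: edges_of.induct)
  case (1 a b vs)
  have "edges_of (rev (a # b # vs)) = edges_of (rev vs @ [b]) + edges_of [b, a]"
    using edges_of_glue_Cons[of "rev vs" b "[a]"] by simp
  then show ?case using 1 by (simp add: insert_commute)
qed auto

lemma edges_of_subset: "e \<in># edges_of vs \<Longrightarrow> e \<subseteq> set vs \<and> e \<noteq> {}"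
  by (induction vs rule: edges_of.induct) auto

text \<open>Cutting at the first traversal keeps \<open>e\<close> out of \<open>u\<close>, so the
  multiplicity of \<open>e\<close> in the rest of the walk can be read off from \<open>v\<close>
  alone.\<close>

lemma edges_of_split_first:
  assumes "e \<in># edges_of ws"
  obtains u v where "ws = u @ v" "u \<noteq> []" "v \<noteq> []" "{last u, hd v} = e" "e \<notin># edges_of u"
    "edges_of ws = add_mset e (edges_of u + edges_of v)"
proof -
  have "\<exists>u v. ws = u @ v \<and> u \<noteq> [] \<and> v \<noteq> [] \<and> {last u, hd v} = e \<and> e \<notin># edges_of u"
    using assms
  proof (induction ws rule: edges_of.induct)
    case (1 a b vs)
    show ?case
    proof (cases "e = {a, b}")
      case True
      then show ?thesis by (intro exI[of _ "[a]"] exI[of _ "b # vs"]) auto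
    next
      case False
      with 1 obtain u v where uv: "b # vs = u @ v" "u \<noteq> []" "v \<noteq> []" "{last u, hd v} = e"
        "e \<notin># edges_of u" by auto
      then obtain u' where u': "u = b # u'" by (cases u) auto
      show ?thesis
        using uv u' False by (intro exI[of _ "a # u"] exI[of _ v]) auto
    qed
  qed auto
  then show ?thesis using that edges_of_append by metis
qed

text \<open>
  Dominates the moments of independent centred variables bounded by 1 with variance \<open>c\<close>,
  the multiplicity of \<open>e\<close> in \<open>M\<close> being the exponent of the variable \<open>e\<close>.
\<close>
definition wt :: "real \<Rightarrow> 'e multiset \<Rightarrow> real" where
  "wt c M = (\<Prod>e\<in>set_mset M. if count M e = 1 then 0 else c)"

lemma wt_nonneg: "0 \<le> c \<Longrightarrow> 0 \<le> wt c M"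
  unfolding wt_def by (intro prod_nonneg) auto

lemma wt_empty [simp]: "wt c {#} = 1"
  by (simp add: wt_def)

lemma wt_eq_0: "count M e = 1 \<Longrightarrow> wt c M = 0"
  unfolding wt_def by (rule prod_zero) (auto simp: count_eq_zero_iff intro!: bexI[of _ e] simp flip: count_greater_zero_iff)

lemma wt_disjoint:
  assumes "set_mset M \<inter> set_mset N = {}"
  shows "wt c (M + N) = wt c M * wt c N"
proof -
  have "wt c (M + N) = (\<Prod>e\<in>set_mset M. if count (M + N) e = 1 then 0 else c)
      * (\<Prod>e\<in>set_mset N. if count (M + N) e = 1 then 0 else c)"
    unfolding wt_def set_mset_union using assms by (intro prod.union_disjoint) auto
  also have "(\<Prod>e\<in>set_mset M. if count (M + N) e = 1 then 0 else c) = wt c M"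
    unfolding wt_def using assms by (intro prod.cong) (auto simp: not_in_iff disjoint_iff)
  also have "(\<Prod>e\<in>set_mset N. if count (M + N) e = 1 then 0 else c) = wt c N"
  proof -
    have "count M e = 0" if "e \<in># N" for e
      using assms that by (auto simp flip: not_in_iff)
    then show ?thesis unfolding wt_def by (intro prod.cong) auto
  qed
  finally show ?thesis .
qed

lemma wt_replicate: "2 \<le> k \<Longrightarrow> wt c (replicate_mset k e) = c"
  by (simp add: wt_def)

lemma wt_add_replicate:
  assumes "e \<notin># M" "2 \<le> k"
  shows "wt c (replicate_mset k e + M) = c * wt c M"
  using assms by (subst wt_disjoint) (auto simp: wt_replicate split: if_splits)

lemma wt_add_twice:
  assumes "2 \<le> count M e"
  shows "wt c (M + {#e, e#}) = wt c M"
proof -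
  have "e \<in># M" using assms by (intro count_inI) simp
  then show ?thesis unfolding wt_def
    by (intro prod.cong) (use assms in auto)
qed

definition walks :: "nat \<Rightarrow> nat \<Rightarrow> nat list set" where
  "walks n k = {vs. length vs = Suc k \<and> set vs \<subseteq> {..<n}}"

text \<open>The end points are free although only closed walks occur in a trace: removing three
  traversals of an edge can turn a closed walk into an open one, so closed walks alone would not
  give a closed recursion.\<close>

definition walk_sum :: "real \<Rightarrow> nat \<Rightarrow> nat \<Rightarrow> real" where
  "walk_sum c n k = (\<Sum>vs\<in>walks n k. wt c (edges_of vs))"

lemma finite_walks [simp]: "finite (walks n k)"
proof -
  have "walks n k = {vs. set vs \<subseteq> {..<n} \<and> length vs = Suc k}" by (auto simp: walks_def)
  then show ?thesis by (simp add: finite_lists_length_eq)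
qed

lemma walk_sum_nonneg: "0 \<le> c \<Longrightarrow> 0 \<le> walk_sum c n k"
  unfolding walk_sum_def by (intro sum_nonneg wt_nonneg)

text \<open>The two walks have a joint weight: an edge used once by each has multiplicity 2 and does
  not make the weight vanish. This is what prevents a plain product of two \<open>walk_sum\<close>
  terms.\<close>

definition pair_sum :: "real \<Rightarrow> nat \<Rightarrow> nat \<Rightarrow> nat \<Rightarrow> real" where
  "pair_sum c n a b = (\<Sum>(u, v)\<in>{u \<in> walks n a. hd u = last u} \<times> walks n b.
      wt c (edges_of u + edges_of v))"

lemma pair_sum_nonneg: "0 \<le> c \<Longrightarrow> 0 \<le> pair_sum c n a b"
  unfolding pair_sum_def by (intro sum_nonneg) (auto intro: wt_nonneg)

text \<open>
  A closed walk which shares a vertex with a walk can be spliced into it there, and the two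
  walks are recovered from the result and the two positions of the vertex.
\<close>
lemma pair_sum_le:
  assumes "0 \<le> c"
  shows "pair_sum c n a b
    \<le> walk_sum c n a * walk_sum c n b + real ((a + 1) * (b + 1)) * walk_sum c n (a + b)"
proof -
  define S where "S = {u \<in> walks n a. hd u = last u} \<times> walks n b"
  define f where "f = (\<lambda>(u :: nat list, v :: nat list). wt c (edges_of u + edges_of v) :: real)"
  \<comment> \<open>The split is by common edges, since edge-disjointness already makes the weight
    multiplicative. In the other case a common edge supplies the common vertex for the
    splicing.\<close>
  define D where "D = {(u, v). set_mset (edges_of u) \<inter> set_mset (edges_of v) = ({} :: nat set set)}"
  have fin: "finite S" by (simp add: S_def)
  have nn: "0 \<le> f z" for z using assms by (auto simp: f_def wt_nonneg split: prod.split)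
  have "sum f S = sum f (S \<inter> D) + sum f (S - D)"
    using fin by (metis sum.Int_Diff)
  moreover have "sum f (S \<inter> D) \<le> walk_sum c n a * walk_sum c n b"
  proof -
    have "sum f (S \<inter> D) = (\<Sum>(u, v)\<in>S \<inter> D. wt c (edges_of u) * wt c (edges_of v))"
      by (intro sum.cong) (auto simp: f_def D_def wt_disjoint)
    also have "\<dots> \<le> (\<Sum>(u, v)\<in>walks n a \<times> walks n b. wt c (edges_of u) * wt c (edges_of v))"
      using assms by (intro sum_mono2) (auto simp: S_def wt_nonneg)
    also have "\<dots> = walk_sum c n a * walk_sum c n b"
      by (simp add: walk_sum_def sum_product sum.cartesian_product)
    finally show ?thesis .
  qed
  moreover have "sum f (S - D) \<le> real ((a + 1) * (b + 1)) * walk_sum c n (a + b)"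
  proof -
    define T where "T = ({..a} \<times> {..b}) \<times> walks n (a + b)"
    define g where "g = (\<lambda>(st :: nat \<times> nat, m :: nat list). wt c (edges_of m))"
    \<comment> \<open>The decoder: the \<open>a + 1\<close> vertices from position \<open>t\<close>
      on form the rotated closed walk, which is rotated back by \<open>s\<close>; closing the hole
      leaves the other walk.\<close>
    define h where "h = (\<lambda>((s, t), m :: nat list). let r = take (a + 1) (drop t m) in
       (drop (a - s) r @ drop 1 (take (a + 1 - s) r), take t m @ drop (t + a) m))"
    have "sum f (S - D) \<le> sum g T"
    proof (rule sum_le_included)
      show "\<forall>x\<in>S - D. \<exists>y\<in>T. h y = x \<and> f x \<le> g y"
      proof
        fix z assume z: "z \<in> S - D"
        then obtain u v where uv: "z = (u, v)" "u \<in> walks n a" "hd u = last u" "v \<in> walks n b"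
          "set_mset (edges_of u) \<inter> set_mset (edges_of v) \<noteq> {}"
          by (auto simp: S_def D_def)
        then obtain e where "e \<in># edges_of u" "e \<in># edges_of v" by blast
        then obtain w where w: "w \<in> set u" "w \<in> set v"
          using edges_of_subset[of e u] edges_of_subset[of e v] by blast
        obtain u1 u2 where u: "u = u1 @ w # u2" using w(1) by (meson split_list)
        obtain v1 v2 where v: "v = v1 @ w # v2" using w(2) by (meson split_list)
        have a: "a = length u1 + length u2" and b: "b = length v1 + length v2"
          using uv by (auto simp: walks_def u v)
        \<comment> \<open>This is \<open>u\<close> rotated to begin and end at \<open>w\<close>;
          \<open>tl\<close> removes the base point that would otherwise occur twice.\<close>
        define r where "r = w # u2 @ tl (u1 @ [w])"
        define m where "m = v1 @ r @ v2"
        have closed: "hd (u1 @ [w]) = last (w # u2)" using uv(3) by (cases u1) (auto simp: u)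
        have er: "edges_of r = edges_of u"
          using edges_of_glue[of "w # u2" "u1 @ [w]"] closed edges_of_glue_Cons[of u1 w u2]
          by (simp add: r_def u add.commute)
        have lr: "r = butlast r @ [w]"
          using closed by (cases u1) (auto simp: r_def butlast_append)
        have em: "edges_of m = edges_of u + edges_of v"
        proof -
          have r': "r = w # tl r" by (simp add: r_def)
          have "edges_of m = edges_of (v1 @ w # (tl r @ v2))"
            using r' by (metis append_Cons m_def)
          also have "\<dots> = edges_of (v1 @ [w]) + edges_of (w # (tl r @ v2))"
            by (rule edges_of_glue_Cons)
          also have "w # (tl r @ v2) = butlast r @ w # v2"
            using r' lr by (metis append.assoc append_Cons append_Nil)
          also have "edges_of \<dots> = edges_of r + edges_of (w # v2)"
            using edges_of_glue_Cons[of "butlast r" w v2] lr by simp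
          finally show ?thesis using edges_of_glue_Cons[of v1 w v2] er
            by (simp add: v add_ac)
        qed
        have len: "length r = a + 1" by (simp add: r_def a)
        have "m \<in> walks n (a + b)"
          using uv by (cases u1) (auto simp: walks_def m_def r_def a b u v)
        then have T: "((length u1, length v1), m) \<in> T" by (simp add: T_def a b)
        have tr: "take (a + 1) (drop (length v1) m) = r" using len by (simp add: m_def)
        have d1: "drop (a - length u1) r @ drop 1 (take (a + 1 - length u1) r) = u"
        proof -
          have "drop (length u2) (w # u2) = [last (w # u2)]"
            by (metis append_butlast_last_id append_eq_conv_conj diff_Suc_1 length_Cons length_butlast
                list.distinct(1))
          then have "drop (length u2) ((w # u2) @ tl (u1 @ [w])) = [last (w # u2)] @ tl (u1 @ [w])"
            by (subst drop_append) simp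
          then have "drop (a - length u1) r = hd (u1 @ [w]) # tl (u1 @ [w])"
            using closed by (simp add: r_def a)
          moreover have "drop 1 (take (a + 1 - length u1) r) = u2"
            by (simp add: r_def a)
          ultimately show ?thesis by (simp add: u)
        qed
        have d2: "take (length v1) m @ drop (length v1 + a) m = v"
        proof -
          have "drop a r = [w]"
            using lr len by (metis add_diff_cancel_right' append_eq_conv_conj length_butlast)
          then show ?thesis using len by (simp add: m_def v)
        qed
        have "h ((length u1, length v1), m) = (u, v)"
          unfolding h_def Let_def prod.case tr d1 d2 ..
        moreover have "f z \<le> g ((length u1, length v1), m)"
          by (simp add: f_def g_def uv em)
        ultimately show "\<exists>y\<in>T. h y = z \<and> f z \<le> g y" using T uv by blast
      qed
    qed (use fin assms in \<open>auto simp: T_def g_def wt_nonneg\<close>)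
    also have "sum g T = (\<Sum>st\<in>{..a} \<times> {..b}. walk_sum c n (a + b))"
      unfolding T_def g_def walk_sum_def by (subst sum.cartesian_product[symmetric]) simp
    also have "\<dots> = real ((a + 1) * (b + 1)) * walk_sum c n (a + b)" by simp
    finally show ?thesis .
  qed
  ultimately show ?thesis by (simp add: pair_sum_def S_def f_def)
qed

section \<open>A recursion for the total weight of walks\<close>

lemma set_tl_subset: "set (tl u) \<subseteq> set u"
  by (cases u) auto

lemma sum_disj_le:
  fixes f :: "'a \<Rightarrow> real"
  assumes "finite W" "\<And>x. x \<in> W \<Longrightarrow> 0 \<le> f x"
  shows "sum f {x \<in> W. P x \<or> Q x} \<le> sum f {x \<in> W. P x} + sum f {x \<in> W. Q x}"
proof -
  have "{x \<in> W. P x \<or> Q x} = {x \<in> W. P x} \<union> {x \<in> W. Q x}" by blast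
  moreover have "0 \<le> sum f ({x \<in> W. P x} \<inter> {x \<in> W. Q x})"
    using assms by (intro sum_nonneg) auto
  ultimately show ?thesis
    using assms(1) sum.union_inter[of "{x \<in> W. P x}" "{x \<in> W. Q x}" f] by simp
qed

text \<open>
  Let \<open>e\<close> be the first edge of a walk of nonzero weight, and cut the walk at further traversals of
  \<open>e\<close>. If \<open>e\<close> has multiplicity 2, both traversals are removed at the cost of a factor \<open>c\<close>; if it
  has multiplicity at least 4, two of them can be removed without changing the weight; if it has
  multiplicity 3, all three have to go. The remaining pieces are reassembled, reversing some of
  them, into one walk or into a closed walk and a walk, depending on the directions in which
  \<open>e\<close> was traversed.
\<close>

definition step_pair :: "real \<Rightarrow> nat list \<Rightarrow> bool" where
  "step_pair c vs \<longleftrightarrow> (\<exists>u v. u \<noteq> [] \<and> v \<noteq> [] \<and> vs = hd v # u @ v \<and> hd u = last u \<and>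
     wt c (edges_of vs) \<le> c * wt c (edges_of u + edges_of v))"

text \<open>Here the second traversal has the direction of the first, so \<open>u\<close> leads from
  \<open>hd u\<close> back to the start and its reversal can be continued by \<open>v\<close>. The
  bound carries no factor \<open>c\<close> because multiplicity 2 and multiplicity at least 4 are
  treated together.\<close>

definition step_reverse :: "real \<Rightarrow> nat list \<Rightarrow> bool" where
  "step_reverse c vs \<longleftrightarrow> (\<exists>u v. u \<noteq> [] \<and> v \<noteq> [] \<and> vs = last u # u @ v \<and> hd v = hd u \<and>
     wt c (edges_of vs) \<le> wt c (edges_of u + edges_of v))"

text \<open>Multiplicity at least 4, with the second traversal opposite to the first. As the edge
  recurs in \<open>v\<close>, the base point of the closed walk \<open>u\<close> lies on
  \<open>v\<close>, so both can be merged into one walk.\<close>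

definition step_insert :: "real \<Rightarrow> nat list \<Rightarrow> bool" where
  "step_insert c vs \<longleftrightarrow> (\<exists>u v. u \<noteq> [] \<and> v \<noteq> [] \<and> vs = hd v # u @ v \<and> hd u = last u \<and> hd u \<in> set v \<and>
     wt c (edges_of vs) \<le> wt c (edges_of u + edges_of v))"

definition step_triple :: "(nat \<Rightarrow> nat list \<Rightarrow> nat list \<Rightarrow> nat list \<Rightarrow> bool) \<Rightarrow> real \<Rightarrow> nat list \<Rightarrow> bool" where
  "step_triple Q c vs \<longleftrightarrow> (\<exists>i u v w. u \<noteq> [] \<and> v \<noteq> [] \<and> w \<noteq> [] \<and> vs = i # u @ v @ w \<and> Q i u v w \<and>
     wt c (edges_of vs) \<le> c * wt c (edges_of u + edges_of v + edges_of w))"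

text \<open>The names give the directions of the second and third traversals relative to the first
  one, which goes from \<open>i\<close> to \<open>hd u\<close>.\<close>

abbreviation "steps_same_same \<equiv> \<lambda>i u v w. last u = i \<and> hd v = hd u \<and> last v = i \<and> hd w = hd u"
abbreviation "steps_same_opp \<equiv> \<lambda>i u v w. last u = i \<and> hd v = hd u \<and> last v = hd u \<and> hd w = i"
abbreviation "steps_opp_same \<equiv> \<lambda>i u v w. last u = hd u \<and> hd v = i \<and> last v = i \<and> hd w = hd u"
abbreviation "steps_opp_opp \<equiv> \<lambda>i u v w. last u = hd u \<and> hd v = i \<and> last v = hd u \<and> hd w = i"

lemma step_cases:
  assumes c: "0 \<le> c" "c \<le> 1" and len: "2 \<le> length vs" and nz: "wt c (edges_of vs) \<noteq> 0"
  shows "step_pair c vs \<or> step_reverse c vs \<or> step_insert c vs \<or>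
    step_triple steps_same_same c vs \<or> step_triple steps_same_opp c vs \<or>
    step_triple steps_opp_same c vs \<or> step_triple steps_opp_opp c vs"
proof -
  obtain i x r where vs: "vs = i # x # r"
    using len by (metis Suc_le_length_iff numeral_2_eq_2)
  define e where "e = {i, x}"
  have M: "edges_of vs = add_mset e (edges_of (x # r))" by (simp add: vs e_def)
  have "e \<in># edges_of (x # r)"
    using nz wt_eq_0[of "edges_of vs" e c] M by (metis One_nat_def count_add_mset not_in_iff)
  then obtain u v where uv: "x # r = u @ v" "u \<noteq> []" "v \<noteq> []" "{last u, hd v} = e"
    "e \<notin># edges_of u" "edges_of (x # r) = add_mset e (edges_of u + edges_of v)"
    by (rule edges_of_split_first)
  have hu: "hd u = x" using uv(1,2) by (metis hd_append2 list.sel(1))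
  have M2: "edges_of vs = (edges_of u + edges_of v) + {#e, e#}" using M uv(6) by simp
  have vs': "vs = i # u @ v" using vs uv(1) by simp
  have ends: "last u = x \<and> hd v = i \<or> last u = i \<and> hd v = x"
    using uv(4) by (auto simp: e_def doubleton_eq_iff)
  have nn: "0 \<le> wt c (edges_of u + edges_of v)" using c by (simp add: wt_nonneg)
  have le: "c * wt c (edges_of u + edges_of v) \<le> wt c (edges_of u + edges_of v)"
    using c nn by (simp add: mult_left_le_one_le)
  \<comment> \<open>The first edge and the cut between \<open>u\<close> and \<open>v\<close> account
    for two traversals, so these are total multiplicity 2, at least 4, and 3.\<close>
  consider "e \<notin># edges_of v" | "2 \<le> count (edges_of v) e" | "count (edges_of v) e = 1"
    by (metis One_nat_def Suc_1 Suc_leI le_neq_implies_less not_in_iff not_less_eq_eq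
        less_one linorder_not_less)
  then show ?thesis
  proof cases
    case 1
    have "wt c (edges_of vs) = c * wt c (edges_of u + edges_of v)"
      using wt_add_replicate[of e "edges_of u + edges_of v" 2 c] 1 uv(5)
      by (simp add: M2 numeral_2_eq_2 add.commute)
    moreover from this have "wt c (edges_of vs) \<le> wt c (edges_of u + edges_of v)" using le by simp
    ultimately have "last u = x \<and> hd v = i \<Longrightarrow> step_pair c vs" "last u = i \<and> hd v = x \<Longrightarrow> step_reverse c vs"
      unfolding step_pair_def step_reverse_def
      by (intro exI[of _ u] exI[of _ v]; simp add: uv(2,3) vs' hu)+
    then show ?thesis using ends by blast
  next
    case 2
    have w: "wt c (edges_of vs) = wt c (edges_of u + edges_of v)"
      unfolding M2 by (rule wt_add_twice) (use 2 in simp)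
    have "e \<in># edges_of v" using 2 by (intro count_inI) simp
    then have "x \<in> set v" using edges_of_subset[of e v] by (auto simp: e_def)
    with w have "last u = x \<and> hd v = i \<Longrightarrow> step_insert c vs" "last u = i \<and> hd v = x \<Longrightarrow> step_reverse c vs"
      unfolding step_insert_def step_reverse_def
      by (intro exI[of _ u] exI[of _ v]; simp add: uv(2,3) vs' hu)+
    then show ?thesis using ends by blast
  next
    case 3
    then have "e \<in># edges_of v" by (intro count_inI) simp
    then obtain v1 v2 where v12: "v = v1 @ v2" "v1 \<noteq> []" "v2 \<noteq> []" "{last v1, hd v2} = e"
      "e \<notin># edges_of v1" "edges_of v = add_mset e (edges_of v1 + edges_of v2)"
      by (rule edges_of_split_first)
    have "e \<notin># edges_of v2" using 3 v12(5,6) by (simp add: not_in_iff)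
    then have w: "wt c (edges_of vs) \<le> c * wt c (edges_of u + edges_of v1 + edges_of v2)"
      using wt_add_replicate[of e "edges_of u + edges_of v1 + edges_of v2" 3 c] v12(5,6) uv(5)
      by (simp add: M2 numeral_3_eq_3 add_ac)
    have hv: "hd v = hd v1" using v12 by simp
    have ends2: "last v1 = x \<and> hd v2 = i \<or> last v1 = i \<and> hd v2 = x"
      using v12(4) by (auto simp: e_def doubleton_eq_iff)
    have vs'': "vs = i # u @ v1 @ v2" using vs' v12 by simp
    have *: "step_triple Q c vs" if "Q i u v1 v2" for Q
      unfolding step_triple_def
      by (intro exI[of _ i] exI[of _ u] exI[of _ v1] exI[of _ v2] conjI) (fact uv(2) v12(2,3) vs'' that w)+
    show ?thesis using ends ends2 *[of steps_same_same] *[of steps_same_opp] *[of steps_opp_same]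
        *[of steps_opp_opp] hu hv by auto
  qed
qed

definition step_sum :: "real \<Rightarrow> nat \<Rightarrow> nat \<Rightarrow> (nat list \<Rightarrow> bool) \<Rightarrow> real" where
  "step_sum c n N P = (\<Sum>vs | vs \<in> walks n N \<and> P vs. wt c (edges_of vs))"

lemma step_sum_disj:
  "0 \<le> c \<Longrightarrow> step_sum c n N (\<lambda>vs. P vs \<or> Q vs) \<le> step_sum c n N P + step_sum c n N Q"
  unfolding step_sum_def using sum_disj_le[of "walks n N" "\<lambda>vs. wt c (edges_of vs)" P Q]
  by (simp add: wt_nonneg)

text \<open>A decoder \<open>h\<close> takes the place of an injectivity proof: walks with different
  images under decoding have different codes \<open>t\<close>, so no code is charged twice.\<close>

lemma step_sum_le:
  assumes "finite T" "\<And>t. t \<in> T \<Longrightarrow> 0 \<le> g t"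
    "\<And>vs. vs \<in> walks n N \<Longrightarrow> P vs \<Longrightarrow> \<exists>t\<in>T. h t = vs \<and> wt c (edges_of vs) \<le> g t"
  shows "step_sum c n N P \<le> sum g T"
  unfolding step_sum_def by (rule sum_le_included[where i = h]) (use assms in auto)

text \<open>This is the leading, Catalan term of the recursion; the remaining bounds below are error
  terms.\<close>

lemma step_pair_sum:
  assumes c: "0 \<le> c" and N: "2 \<le> N"
  shows "step_sum c n N (step_pair c) \<le> c * (\<Sum>a<N - 1. pair_sum c n a (N - 2 - a))"
proof -
  define T where "T = (SIGMA a:{..<N - 1}. {u \<in> walks n a. hd u = last u} \<times> walks n (N - 2 - a))"
  have "step_sum c n N (step_pair c) \<le> (\<Sum>(a, u, v)\<in>T. c * wt c (edges_of u + edges_of v))"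
  proof (rule step_sum_le[where h = "\<lambda>(a, u, v). hd v # u @ v"])
    fix vs assume "vs \<in> walks n N" "step_pair c vs"
    then obtain u v where uv: "u \<noteq> []" "v \<noteq> []" "vs = hd v # u @ v" "hd u = last u"
      "wt c (edges_of vs) \<le> c * wt c (edges_of u + edges_of v)" "vs \<in> walks n N"
      by (auto simp: step_pair_def)
    have len: "length u + length v = N" "0 < length u" "0 < length v"
      and set: "set u \<subseteq> {..<n}" "set v \<subseteq> {..<n}"
      using uv by (auto simp: walks_def dest: arg_cong[of _ _ length] arg_cong[of _ _ set])
    have "length u - 1 < N - 1" "length v = Suc (N - 2 - (length u - 1))" "length u = Suc (length u - 1)"
      using len by linarith+
    then have "(length u - 1, u, v) \<in> T" using uv(4) set by (simp add: T_def walks_def)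
    then show "\<exists>t\<in>T. (\<lambda>(a, u, v). hd v # u @ v) t = vs \<and>
        wt c (edges_of vs) \<le> (\<lambda>(a, u, v). c * wt c (edges_of u + edges_of v)) t"
      using uv by (intro bexI[of _ "(length u - 1, u, v)"]) auto
  qed (use c in \<open>auto simp: T_def wt_nonneg\<close>)
  also have "\<dots> = c * (\<Sum>a<N - 1. pair_sum c n a (N - 2 - a))"
    unfolding T_def pair_sum_def
    by (subst sum.Sigma[symmetric]) (auto simp: sum_distrib_left case_prod_unfold)
  finally show ?thesis .
qed

lemma sum_walks_const: "finite I \<Longrightarrow> (\<Sum>(s, m)\<in>I \<times> walks n k. c' * wt c (edges_of m))
   = real (card I) * (c' * walk_sum c n k)"
  by (subst sum.cartesian_product[symmetric]) (simp add: walk_sum_def sum_distrib_left)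

text \<open>After gluing \<open>rev u\<close> to \<open>v\<close>, only the length of
  \<open>u\<close> has to be remembered, hence the factor \<open>N\<close>.\<close>

lemma step_reverse_sum:
  assumes c: "0 \<le> c" and N: "2 \<le> N"
  shows "step_sum c n N (step_reverse c) \<le> real N * walk_sum c n (N - 2)"
proof -
  define T where "T = {1..N} \<times> walks n (N - 2)"
  define h where "h = (\<lambda>(s, m :: nat list). let u = rev (take s m) in last u # u @ hd u # drop s m)"
  have "step_sum c n N (step_reverse c) \<le> (\<Sum>(s, m)\<in>T. 1 * wt c (edges_of m))"
  proof (rule step_sum_le[where h = h])
    fix vs assume "vs \<in> walks n N" "step_reverse c vs"
    then obtain u v where uv: "u \<noteq> []" "v \<noteq> []" "vs = last u # u @ v" "hd v = hd u"
      "wt c (edges_of vs) \<le> wt c (edges_of u + edges_of v)" "vs \<in> walks n N"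
      by (auto simp: step_reverse_def)
    have len: "length u + length v = N" "0 < length u" "0 < length v"
      "set u \<subseteq> {..<n}" "set v \<subseteq> {..<n}"
      using uv by (auto simp: walks_def dest: arg_cong[of _ _ length] arg_cong[of _ _ set])
    define m where "m = rev u @ tl v"
    have "edges_of m = edges_of u + edges_of v"
      unfolding m_def using uv edges_of_glue[of "rev u" v] by (simp add: last_rev edges_of_rev)
    moreover have "length m = Suc (N - 2)" "length u \<in> {1..N}"
      using len(1-3) by (auto simp: m_def simp del: length_greater_0_conv)
    then have "(length u, m) \<in> T"
      using len(4,5) set_tl_subset[of v] by (auto simp: T_def walks_def m_def)
    moreover have "h (length u, m) = vs"
      using uv by (simp add: h_def m_def Let_def flip: uv(4))
    ultimately show "\<exists>t\<in>T. h t = vs \<and>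
        wt c (edges_of vs) \<le> (\<lambda>(s, m). 1 * wt c (edges_of m)) t"
      using uv by (intro bexI[of _ "(length u, m)"]) auto
  qed (use c in \<open>auto simp: T_def wt_nonneg\<close>)
  also have "\<dots> = real N * walk_sum c n (N - 2)"
    unfolding T_def by (subst sum_walks_const) auto
  finally show ?thesis .
qed

text \<open>Two numbers have to be remembered, the length of \<open>u\<close> and its position in
  \<open>v\<close>, hence \<open>N\<^sup>2\<close>.\<close>

lemma step_insert_sum:
  assumes c: "0 \<le> c" and N: "2 \<le> N"
  shows "step_sum c n N (step_insert c) \<le> real (N\<^sup>2) * walk_sum c n (N - 2)"
proof -
  define T where "T = ({1..N} \<times> {..<N}) \<times> walks n (N - 2)"
  define h where "h = (\<lambda>((s, t), m :: nat list). let u = take s (drop t m); v = take t m @ hd u # drop (t + s) m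
      in hd v # u @ v)"
  have "step_sum c n N (step_insert c) \<le> (\<Sum>(s, m)\<in>T. 1 * wt c (edges_of m))"
  proof (rule step_sum_le[where h = h])
    fix vs assume "vs \<in> walks n N" "step_insert c vs"
    then obtain u v where uv: "u \<noteq> []" "v \<noteq> []" "vs = hd v # u @ v" "hd u = last u" "hd u \<in> set v"
      "wt c (edges_of vs) \<le> wt c (edges_of u + edges_of v)" "vs \<in> walks n N"
      by (auto simp: step_insert_def)
    have len: "length u + length v = N" "0 < length u" "0 < length v"
      "set u \<subseteq> {..<n}" "set v \<subseteq> {..<n}"
      using uv by (auto simp: walks_def dest: arg_cong[of _ _ length] arg_cong[of _ _ set])
    obtain y z where v: "v = y @ hd u # z" using uv(5) by (meson split_list)
    define m where "m = y @ u @ z"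
    have "edges_of m = edges_of u + edges_of v"
    proof -
      have "m = (y @ [hd u]) @ tl (u @ z)"
        unfolding m_def using uv(1) by (cases u) simp_all
      also have "edges_of \<dots> = edges_of (y @ [hd u]) + edges_of (u @ z)"
        by (rule edges_of_glue) (use uv(1) in simp_all)
      also have "u @ z = u @ tl (hd u # z)" by simp
      also have "edges_of \<dots> = edges_of u + edges_of (hd u # z)"
        by (rule edges_of_glue) (simp_all add: uv(1) uv(4)[symmetric])
      finally have "edges_of m = edges_of u + (edges_of (y @ [hd u]) + edges_of (hd u # z))"
        by (simp only: add_ac)
      also have "edges_of (y @ [hd u]) + edges_of (hd u # z) = edges_of v"
        unfolding v by (rule edges_of_glue_Cons[symmetric])
      finally show ?thesis .
    qed
    moreover have "length v = length y + length z + 1" "set y \<subseteq> set v" "set z \<subseteq> set v"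
      using arg_cong[OF v, of length] arg_cong[OF v, of set] by auto
    then have "((length u, length y), m) \<in> T"
      using len by (auto simp: T_def walks_def m_def Suc_le_eq)
    moreover have "h ((length u, length y), m) = hd v # u @ v"
      unfolding h_def m_def Let_def by (simp flip: v)
    ultimately show "\<exists>t\<in>T. h t = vs \<and>
        wt c (edges_of vs) \<le> (\<lambda>(s, m). 1 * wt c (edges_of m)) t"
      using uv(3,6) by (intro bexI[of _ "((length u, length y), m)"]) auto
  qed (use c in \<open>auto simp: T_def wt_nonneg\<close>)
  also have "\<dots> = real (N\<^sup>2) * walk_sum c n (N - 2)"
    unfolding T_def by (subst sum_walks_const) (auto simp: power2_eq_square)
  finally show ?thesis .
qed

text \<open>In three of the four direction patterns the pieces can be chained into a single walk
  with \<open>N - 3\<close> edges, from which they are recovered by two lengths. The case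
  distinction \<open>3 \<le> N\<close> guards against truncated subtraction.\<close>

lemma step_triple_connected_sum:
  assumes c: "0 \<le> c" and N: "2 \<le> N"
    and glue: "\<And>i u v w. Q i u v w \<Longrightarrow> u \<noteq> [] \<Longrightarrow> v \<noteq> [] \<Longrightarrow> w \<noteq> [] \<Longrightarrow>
      \<exists>s\<in>{1..length u + length v}. \<exists>t\<in>{..<length u + length v}. h ((s, t), m u v w) = i # u @ v @ w \<and>
      edges_of (m u v w) = edges_of u + edges_of v + edges_of w \<and>
      set (m u v w) \<subseteq> set (u @ v @ w) \<and> length (m u v w) + 2 = length (u @ v @ w)"
  shows "step_sum c n N (step_triple Q c) \<le> real (N\<^sup>2) * (c * (if 3 \<le> N then walk_sum c n (N - 3) else 0))"
proof -
  define T where "T = (if 3 \<le> N then {1..N} \<times> {..<N} else {}) \<times> walks n (N - 3)"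
  have "step_sum c n N (step_triple Q c) \<le> (\<Sum>(s, m)\<in>T. c * wt c (edges_of m))"
  proof (rule step_sum_le[where h = h])
    fix vs assume "vs \<in> walks n N" "step_triple Q c vs"
    then obtain i u v w where uv: "u \<noteq> []" "v \<noteq> []" "w \<noteq> []" "vs = i # u @ v @ w" "Q i u v w"
      "wt c (edges_of vs) \<le> c * wt c (edges_of u + edges_of v + edges_of w)" "vs \<in> walks n N"
      by (auto simp: step_triple_def)
    obtain s t where st: "s \<in> {1..length u + length v}" "t \<in> {..<length u + length v}"
      "h ((s, t), m u v w) = vs"
      "edges_of (m u v w) = edges_of u + edges_of v + edges_of w"
      "set (m u v w) \<subseteq> set (u @ v @ w)" "length (m u v w) + 2 = length (u @ v @ w)"
      using glue[OF uv(5,1-3)] uv(4) by metis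
    have len: "length u + length v + length w = N" "0 < length u" "0 < length v" "0 < length w"
      "set (u @ v @ w) \<subseteq> {..<n}"
      using uv by (auto simp: walks_def)
    have "length (m u v w) = Suc (N - 3)" "3 \<le> N" using st(6) len(1-4) unfolding length_append by linarith+
    then have "((s, t), m u v w) \<in> T" using st len by (auto simp: T_def walks_def)
    then show "\<exists>t\<in>T. h t = vs \<and> wt c (edges_of vs) \<le> (\<lambda>(s, m). c * wt c (edges_of m)) t"
      using uv st by (intro bexI[of _ "((s, t), m u v w)"]) auto
  qed (use c in \<open>auto simp: T_def wt_nonneg\<close>)
  also have "\<dots> = real (N\<^sup>2) * (c * (if 3 \<le> N then walk_sum c n (N - 3) else 0))"
    unfolding T_def by (subst sum_walks_const) (auto simp: power2_eq_square)
  finally show ?thesis by simp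
qed

lemma edges_of_glue3:
  assumes "u \<noteq> []" "v \<noteq> []" "w \<noteq> []" "last u = hd v" "last v = hd w"
  shows "edges_of (u @ tl v @ tl w) = edges_of u + edges_of v + edges_of w"
proof -
  have "last (u @ tl v) = last v"
    using assms(1,2,4) by (cases v) auto
  then have "edges_of ((u @ tl v) @ tl w) = edges_of (u @ tl v) + edges_of w"
    by (intro edges_of_glue) (simp_all add: assms)
  moreover have "edges_of (u @ tl v) = edges_of u + edges_of v"
    by (rule edges_of_glue) (fact assms)+
  ultimately show ?thesis by simp
qed

text \<open>Both \<open>u\<close> and \<open>v\<close> run from \<open>hd u\<close> to
  \<open>i\<close>, and \<open>w\<close> starts at \<open>hd u\<close>, so reversing
  \<open>v\<close> makes the three pieces consecutive.\<close>

lemma step_same_same_sum: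
  assumes "0 \<le> c" "2 \<le> N"
  shows "step_sum c n N (step_triple steps_same_same c) \<le> real (N\<^sup>2) * (c * (if 3 \<le> N then walk_sum c n (N - 3) else 0))"
proof (rule step_triple_connected_sum[OF assms, where m = "\<lambda>u v w. u @ tl (rev v) @ tl w"
      and h = "\<lambda>((s, t), m). let u = take s m in
        last u # u @ rev (last u # take t (drop s m)) @ hd u # drop (s + t) m"])
  fix i :: nat and u v w :: "nat list"
  assume q: "last u = i \<and> hd v = hd u \<and> last v = i \<and> hd w = hd u" and ne: "u \<noteq> []" "v \<noteq> []" "w \<noteq> []"
  obtain v' where v: "v = v' @ [i]" using q ne by (metis append_butlast_last_id)
  obtain w' where w: "w = hd u # w'" using q ne by (metis list.collapse)
  show "\<exists>s\<in>{1..length u + length v}. \<exists>t\<in>{..<length u + length v}.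
      (\<lambda>((s, t), m). let u = take s m in
        last u # u @ rev (last u # take t (drop s m)) @ hd u # drop (s + t) m)
        ((s, t), u @ tl (rev v) @ tl w) = i # u @ v @ w \<and>
      edges_of (u @ tl (rev v) @ tl w) = edges_of u + edges_of v + edges_of w \<and>
      set (u @ tl (rev v) @ tl w) \<subseteq> set (u @ v @ w) \<and>
      length (u @ tl (rev v) @ tl w) + 2 = length (u @ v @ w)"
  proof (rule bexI[of _ "length u"], rule bexI[of _ "length v'"], intro conjI)
    show "edges_of (u @ tl (rev v) @ tl w) = edges_of u + edges_of v + edges_of w"
      by (subst edges_of_glue3) (use q ne in \<open>simp_all add: hd_rev last_rev edges_of_rev\<close>)
  next
    have "last u = i" using q by blast
    then show "(\<lambda>((s, t), m). let u = take s m in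
        last u # u @ rev (last u # take t (drop s m)) @ hd u # drop (s + t) m)
        ((length u, length v'), u @ tl (rev v) @ tl w) = i # u @ v @ w"
      by (simp add: v w Let_def)
  qed (simp_all add: v w ne(1) Suc_le_eq, auto)
qed

lemma step_opp_opp_sum:
  assumes "0 \<le> c" "2 \<le> N"
  shows "step_sum c n N (step_triple steps_opp_opp c) \<le> real (N\<^sup>2) * (c * (if 3 \<le> N then walk_sum c n (N - 3) else 0))"
proof (rule step_triple_connected_sum[OF assms, where m = "\<lambda>u v w. u @ tl (rev v) @ tl w"
      and h = "\<lambda>((s, t), m). let u = take s m; v = rev (hd u # take t (drop s m)) in
        hd v # u @ v @ hd v # drop (s + t) m"])
  fix i :: nat and u v w :: "nat list"
  assume q: "last u = hd u \<and> hd v = i \<and> last v = hd u \<and> hd w = i" and ne: "u \<noteq> []" "v \<noteq> []" "w \<noteq> []"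
  obtain v' where v: "v = v' @ [hd u]" using q ne by (metis append_butlast_last_id)
  obtain w' where w: "w = i # w'" using q ne by (metis list.collapse)
  show "\<exists>s\<in>{1..length u + length v}. \<exists>t\<in>{..<length u + length v}.
      (\<lambda>((s, t), m). let u = take s m; v = rev (hd u # take t (drop s m)) in
        hd v # u @ v @ hd v # drop (s + t) m)
        ((s, t), u @ tl (rev v) @ tl w) = i # u @ v @ w \<and>
      edges_of (u @ tl (rev v) @ tl w) = edges_of u + edges_of v + edges_of w \<and>
      set (u @ tl (rev v) @ tl w) \<subseteq> set (u @ v @ w) \<and>
      length (u @ tl (rev v) @ tl w) + 2 = length (u @ v @ w)"
  proof (rule bexI[of _ "length u"], rule bexI[of _ "length v'"], intro conjI)
    show "edges_of (u @ tl (rev v) @ tl w) = edges_of u + edges_of v + edges_of w"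
      by (subst edges_of_glue3) (use q ne in \<open>simp_all add: hd_rev last_rev edges_of_rev\<close>)
  next
    have "(hd v # u @ v @ hd v # w') = i # u @ v @ w" using q by (simp add: w)
    moreover have "rev (hd u # rev v') = v" by (simp add: v)
    ultimately show "(\<lambda>((s, t), m). let u = take s m; v = rev (hd u # take t (drop s m)) in
        hd v # u @ v @ hd v # drop (s + t) m)
        ((length u, length v'), u @ tl (rev v) @ tl w) = i # u @ v @ w"
      by (simp add: w Let_def v)
  qed (simp_all add: v w ne(1) Suc_le_eq, auto)
qed

text \<open>Here \<open>v\<close> is closed at \<open>hd u\<close>, so it is moved in front of
  \<open>u\<close>; then \<open>w\<close> continues from \<open>i\<close> where \<open>u\<close>
  ends.\<close>

lemma step_same_opp_sum:
  assumes "0 \<le> c" "2 \<le> N"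
  shows "step_sum c n N (step_triple steps_same_opp c) \<le> real (N\<^sup>2) * (c * (if 3 \<le> N then walk_sum c n (N - 3) else 0))"
proof (rule step_triple_connected_sum[OF assms, where m = "\<lambda>u v w. v @ tl u @ tl w"
      and h = "\<lambda>((t, s), m). let v = take t m; u = hd v # take s (drop t m) in
        last u # u @ v @ last u # drop (s + t) m"])
  fix i :: nat and u v w :: "nat list"
  assume q: "last u = i \<and> hd v = hd u \<and> last v = hd u \<and> hd w = i" and ne: "u \<noteq> []" "v \<noteq> []" "w \<noteq> []"
  obtain u' where u: "u = hd v # u'" using q ne by (metis list.collapse)
  have tlu: "tl u = u'" by (subst u) simp
  obtain w' where w: "w = i # w'" using q ne by (metis list.collapse)
  show "\<exists>s\<in>{1..length u + length v}. \<exists>t\<in>{..<length u + length v}.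
      (\<lambda>((t, s), m). let v = take t m; u = hd v # take s (drop t m) in
        last u # u @ v @ last u # drop (s + t) m)
        ((s, t), v @ tl u @ tl w) = i # u @ v @ w \<and>
      edges_of (v @ tl u @ tl w) = edges_of u + edges_of v + edges_of w \<and>
      set (v @ tl u @ tl w) \<subseteq> set (u @ v @ w) \<and>
      length (v @ tl u @ tl w) + 2 = length (u @ v @ w)"
  proof (rule bexI[of _ "length v"], rule bexI[of _ "length u'"], intro conjI)
    show "edges_of (v @ tl u @ tl w) = edges_of u + edges_of v + edges_of w"
      by (subst edges_of_glue3) (use q ne in simp_all)
  next
    have "last u = i" using q by blast
    moreover have "hd v # u' = u" by (rule u[symmetric])
    moreover from calculation have "u' = [] \<Longrightarrow> hd v = i" "u' \<noteq> [] \<Longrightarrow> last u' = i"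
      by (metis last.simps)+
    ultimately show "(\<lambda>((t, s), m). let v = take t m; u = hd v # take s (drop t m) in
        last u # u @ v @ last u # drop (s + t) m)
        ((length v, length u'), v @ tl u @ tl w) = i # u @ v @ w"
      using tlu by (simp add: w add.commute Let_def)
  qed (insert tlu arg_cong[OF u, of length] arg_cong[OF u, of set] ne(2),
      simp_all add: w Suc_le_eq, auto)
qed

text \<open>The one pattern whose pieces need not connect: \<open>v\<close> is closed at
  \<open>i\<close>, while \<open>u\<close> and \<open>w\<close> meet at the other end of the edge.
  It leaves a pair of walks, and the factor \<open>N\<close> records where \<open>u\<close> and
  \<open>w\<close> were glued.\<close>

lemma step_opp_same_sum:
  assumes c: "0 \<le> c" and N: "2 \<le> N"
  shows "step_sum c n N (step_triple steps_opp_same c)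
    \<le> real N * (c * (\<Sum>a<N - 2. pair_sum c n a (N - 3 - a)))"
proof -
  define P where "P = (SIGMA a:{..<N - 2}. {u \<in> walks n a. hd u = last u} \<times> walks n (N - 3 - a))"
  define T where "T = {1..N} \<times> P"
  define h where "h = (\<lambda>(s, a :: nat, v, m :: nat list). hd v # take s m @ v @ hd m # drop s m)"
  define g where "g = (\<lambda>(s :: nat, a :: nat, v :: nat list, m :: nat list). c * wt c (edges_of v + edges_of m))"
  have "step_sum c n N (step_triple steps_opp_same c) \<le> sum g T"
  proof (rule step_sum_le[where h = h])
    fix vs assume "vs \<in> walks n N" "step_triple steps_opp_same c vs"
    then obtain i u v w where uv: "u \<noteq> []" "v \<noteq> []" "w \<noteq> []" "vs = i # u @ v @ w" "vs \<in> walks n N"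
      "last u = hd u" "hd v = i" "last v = i" "hd w = hd u"
      "wt c (edges_of vs) \<le> c * wt c (edges_of u + edges_of v + edges_of w)"
      by (auto simp: step_triple_def)
    have len: "length u + length v + length w = N" "0 < length u" "0 < length v" "0 < length w"
      "set (u @ v @ w) \<subseteq> {..<n}"
      using uv by (auto simp: walks_def)
    define m where "m = u @ tl w"
    have em: "edges_of m = edges_of u + edges_of w"
      unfolding m_def using uv by (intro edges_of_glue) auto
    have "length v - 1 < N - 2" "length m = Suc (N - 3 - (length v - 1))"
      "length v = Suc (length v - 1)" "length u \<in> {1..N}"
      using len(1-4) by (auto simp: m_def simp del: length_greater_0_conv)
    moreover have "set m \<subseteq> {..<n}" "set v \<subseteq> {..<n}"
      using len(5) set_tl_subset[of w] by (auto simp: m_def)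
    ultimately have "(length u, length v - 1, v, m) \<in> T"
      using uv(7,8) by (simp add: T_def P_def walks_def)
    moreover have "h (length u, length v - 1, v, m) = vs"
    proof -
      have "take (length u) m = u" "drop (length u) m = tl w" by (simp_all add: m_def)
      moreover have "hd m = hd w" using uv(1,9) by (simp add: m_def)
      ultimately show ?thesis using uv(3) by (simp add: h_def uv(4,7))
    qed
    ultimately show "\<exists>t\<in>T. h t = vs \<and> wt c (edges_of vs) \<le> g t"
      using uv(10) by (intro bexI[of _ "(length u, length v - 1, v, m)"]) (simp_all add: em g_def add_ac)
  qed (use c in \<open>auto simp: T_def P_def g_def wt_nonneg\<close>)
  also have "\<dots> = (\<Sum>s\<in>{1..N}. \<Sum>(a, v, m)\<in>P. c * wt c (edges_of v + edges_of m))"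
    unfolding T_def g_def by (subst sum.cartesian_product[symmetric]) (simp add: case_prod_unfold)
  also have "(\<Sum>(a, v, m)\<in>P. c * wt c (edges_of v + edges_of m))
      = c * (\<Sum>a<N - 2. pair_sum c n a (N - 3 - a))"
    unfolding P_def pair_sum_def
    by (subst sum.Sigma[symmetric]) (auto simp: sum_distrib_left case_prod_unfold)
  finally show ?thesis by simp
qed

lemma walk_sum_rec:
  assumes c: "0 \<le> c" "c \<le> 1" and N: "2 \<le> N"
  shows "walk_sum c n N \<le> c * (\<Sum>a<N - 1. pair_sum c n a (N - 2 - a))
    + real (N\<^sup>2 + N) * walk_sum c n (N - 2) + 3 * real (N\<^sup>2) * (c * (if 3 \<le> N then walk_sum c n (N - 3) else 0))
    + real N * (c * (\<Sum>a<N - 2. pair_sum c n a (N - 3 - a)))"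
proof -
  define f where "f = (\<lambda>vs :: nat list. wt c (edges_of vs))"
  have "walk_sum c n N = sum f {vs \<in> walks n N. f vs \<noteq> 0}"
    unfolding walk_sum_def f_def by (intro sum.mono_neutral_right) auto
  also have "\<dots> \<le> step_sum c n N (\<lambda>vs. step_pair c vs \<or> step_reverse c vs \<or> step_insert c vs \<or>
    step_triple steps_same_same c vs \<or> step_triple steps_same_opp c vs \<or>
    step_triple steps_opp_same c vs \<or> step_triple steps_opp_opp c vs)"
    unfolding step_sum_def f_def
  proof (rule sum_mono2)
    show "{vs \<in> walks n N. wt c (edges_of vs) \<noteq> 0} \<subseteq> {vs \<in> walks n N. step_pair c vs \<or> step_reverse c vs \<or>
      step_insert c vs \<or> step_triple steps_same_same c vs \<or> step_triple steps_same_opp c vs \<or>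
      step_triple steps_opp_same c vs \<or> step_triple steps_opp_opp c vs}"
      using step_cases[OF c] N by (force simp: walks_def)
  qed (use c in \<open>auto simp: wt_nonneg\<close>)
  also have "\<dots> \<le> step_sum c n N (step_pair c) + (step_sum c n N (step_reverse c)
     + (step_sum c n N (step_insert c) + (step_sum c n N (step_triple steps_same_same c)
     + (step_sum c n N (step_triple steps_same_opp c) + (step_sum c n N (step_triple steps_opp_same c)
     + step_sum c n N (step_triple steps_opp_opp c))))))"
    by (rule order_trans[OF step_sum_disj[OF c(1)]], rule add_left_mono)+ simp
  finally show ?thesis
    using step_pair_sum[OF c(1) N, of n] step_reverse_sum[OF c(1) N, of n]
      step_insert_sum[OF c(1) N, of n] step_same_same_sum[OF c(1) N, of n]
      step_same_opp_sum[OF c(1) N, of n] step_opp_same_sum[OF c(1) N, of n]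
      step_opp_opp_sum[OF c(1) N, of n]
    unfolding of_nat_add distrib_right by linarith
qed

section \<open>Solving the recursion by partial sums of a generating function\<close>

lemma sum_shift_le:
  fixes f :: "nat \<Rightarrow> real"
  assumes "0 < d" "\<And>k. 0 \<le> f k"
  shows "(\<Sum>N\<in>{2..Suc J}. if d \<le> N then f (N - d) else 0) \<le> (\<Sum>k\<le>J. f k)"
proof -
  have "(\<Sum>N\<in>{2..Suc J}. if d \<le> N then f (N - d) else 0) = (\<Sum>N | N \<in> {2..Suc J} \<and> d \<le> N. f (N - d))"
    by (rule sum.inter_filter[symmetric]) simp
  also have "\<dots> \<le> (\<Sum>k\<le>J. f k)"
    by (rule sum_le_included[where i = "\<lambda>k. k + d"])
       (use assms in \<open>auto intro!: bexI[of _ "_ - d"]\<close>)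
  finally show ?thesis .
qed

lemma sum_convolution_le:
  fixes f :: "nat \<Rightarrow> real"
  assumes "\<And>k. 0 \<le> f k"
  shows "(\<Sum>k\<le>J. \<Sum>a\<le>k. f a * f (k - a)) \<le> (\<Sum>k\<le>J. f k)\<^sup>2"
proof -
  have "(\<Sum>k\<le>J. \<Sum>a\<le>k. f a * f (k - a)) = (\<Sum>(a, b)\<in>{(a, b). a + b \<le> J}. f a * f b)"
    by (rule sum.triangle_reindex_eq[symmetric])
  also have "\<dots> \<le> (\<Sum>(a, b)\<in>{..J} \<times> {..J}. f a * f b)"
    using assms by (intro sum_mono2) auto
  also have "\<dots> = (\<Sum>k\<le>J. f k)\<^sup>2"
    by (simp add: power2_eq_square sum_product sum.cartesian_product)
  finally show ?thesis .
qed

lemma walk_sum_0: "walk_sum c n 0 = real n"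
proof -
  have "walks n 0 = (\<lambda>v. [v]) ` {..<n}" by (auto simp: walks_def length_Suc_conv)
  then have "walk_sum c n 0 = (\<Sum>v<n. wt c (edges_of [v]))"
    unfolding walk_sum_def by (simp add: sum.reindex inj_on_def)
  then show ?thesis by simp
qed

lemma walk_sum_1: "walk_sum c n 1 = 0"
  unfolding walk_sum_def
proof (rule sum.neutral, rule ballI)
  fix vs assume "vs \<in> walks n 1"
  then obtain a b where "vs = [a, b]" by (auto simp: walks_def length_Suc_conv)
  then show "wt c (edges_of vs) = 0" by (intro wt_eq_0[of _ "{a, b}"]) simp
qed

text \<open>
  With \<open>y N = walk_sum c n N / (n * \<rho> ^ N)\<close> the recursion says that the partial sums \<open>S\<close> of
  \<open>y\<close> satisfy \<open>S \<le> 1 + (c * n / \<rho>\<^sup>2) * S\<^sup>2\<close> up to small errors, so they stay below 2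
  as soon as \<open>\<rho>\<^sup>2\<close> slightly exceeds \<open>4 * c * n\<close>.
\<close>
lemma walk_sum_bound:
  fixes c \<rho> :: real and n K :: nat
  assumes c: "0 \<le> c" "c \<le> 1" and n: "0 < n" and \<rho>: "0 < \<rho>"
    and small: "4 * (c * n / \<rho>\<^sup>2) + 2 * ((c * K ^ 3 + K\<^sup>2 + K) / \<rho>\<^sup>2)
      + 2 * ((3 * c * K\<^sup>2 + c * K ^ 4) / \<rho> ^ 3) + 4 * (c * K * n / \<rho> ^ 3) \<le> 1"
    and N: "N \<le> K"
  shows "walk_sum c n N \<le> 2 * n * \<rho> ^ N"
proof -
  define U where "U = walk_sum c n"
  define y where "y = (\<lambda>N. U N / (n * \<rho> ^ N))"
  define S where "S = (\<lambda>J. \<Sum>N\<le>J. y N)"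
  define C where "C = (\<lambda>N. \<Sum>a\<le>N. y a * y (N - a))"
  define q where "q = c * n / \<rho>\<^sup>2"
  define e1 where "e1 = (c * K ^ 3 + K\<^sup>2 + K) / \<rho>\<^sup>2"
  define e2 where "e2 = (3 * c * K\<^sup>2 + c * K ^ 4) / \<rho> ^ 3"
  define e3 where "e3 = c * K * n / \<rho> ^ 3"
  have U0: "0 \<le> U N" for N using c by (simp add: U_def walk_sum_nonneg)
  have Uy: "U N = y N * (n * \<rho> ^ N)" for N using n \<rho> by (simp add: y_def)
  have y0: "0 \<le> y N" for N using U0 \<rho> by (simp add: y_def)
  have C0: "0 \<le> C N" for N using y0 by (auto simp: C_def intro!: sum_nonneg)
  have nonneg: "0 \<le> q" "0 \<le> e1" "0 \<le> e2" "0 \<le> e3"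
    using c \<rho> by (simp_all add: q_def e1_def e2_def e3_def)
  \<comment> \<open>Each splicing costs at most \<open>K\<^sup>2\<close> pairs of positions, and
    there are at most \<open>K\<close> ways to distribute the length, whence
    \<open>K ^ 3\<close>.\<close>
  have pair: "(\<Sum>a\<le>M. pair_sum c n a (M - a)) \<le> (n * n * \<rho> ^ M) * C M + real K ^ 3 * U M"
    if "M + 2 \<le> K" for M
  proof -
    have "(\<Sum>a\<le>M. pair_sum c n a (M - a)) \<le> (\<Sum>a\<le>M. (n * n * \<rho> ^ M) * (y a * y (M - a)) + real K ^ 2 * U M)"
    proof (rule sum_mono)
      fix a assume a: "a \<in> {..M}"
      have "U a * U (M - a) = (n * n * (\<rho> ^ a * \<rho> ^ (M - a))) * (y a * y (M - a))"
        by (simp add: Uy)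
      also have "\<rho> ^ a * \<rho> ^ (M - a) = \<rho> ^ M" using a by (simp flip: power_add)
      finally have 1: "U a * U (M - a) = (n * n * \<rho> ^ M) * (y a * y (M - a))" .
      have "(a + 1) * (M - a + 1) \<le> K * K" using a that by (intro mult_le_mono) auto
      then have "real ((a + 1) * (M - a + 1)) \<le> real K ^ 2"
        unfolding power2_eq_square of_nat_mult[symmetric] by (rule of_nat_mono)
      then have "real ((a + 1) * (M - a + 1)) * U M \<le> real K ^ 2 * U M"
        using U0 by (rule mult_right_mono)
      then show "pair_sum c n a (M - a) \<le> (n * n * \<rho> ^ M) * (y a * y (M - a)) + real K ^ 2 * U M"
        using pair_sum_le[OF c(1), of n a "M - a"] a 1 by (simp add: U_def)
    qed
    also have "\<dots> = (n * n * \<rho> ^ M) * C M + real (M + 1) * (real K ^ 2 * U M)"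
      by (simp add: sum.distrib C_def sum_distrib_left)
    also have "real (M + 1) * (real K ^ 2 * U M) \<le> real K * (real K ^ 2 * U M)"
      using that U0 by (intro mult_right_mono) auto
    finally show ?thesis by (simp add: power3_eq_cube power2_eq_square mult.assoc)
  qed
  have step: "y N \<le> q * C (N - 2) + e1 * y (N - 2)
      + (e2 * (if 3 \<le> N then y (N - 3) else 0) + e3 * (if 3 \<le> N then C (N - 3) else 0))"
    if N: "2 \<le> N" "N \<le> K" for N
  proof -
    have 2: "c * (\<Sum>a<N - 1. pair_sum c n a (N - 2 - a))
        \<le> c * ((n * n * \<rho> ^ (N - 2)) * C (N - 2) + real K ^ 3 * U (N - 2))"
    proof -
      have "{..<N - 1} = {..N - 2}" using N by auto
      then show ?thesis using pair[of "N - 2"] N c by (intro mult_left_mono) auto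
    qed
    have 22: "real (N\<^sup>2 + N) * U (N - 2) \<le> (real K ^ 2 + K) * U (N - 2)"
    proof -
      have "N\<^sup>2 + N \<le> K\<^sup>2 + K" using N by (intro add_mono power_mono) auto
      then have "real (N\<^sup>2 + N) \<le> real (K\<^sup>2 + K)" by (rule of_nat_mono)
      then show ?thesis using U0 by (intro mult_right_mono) auto
    qed
    have D2: "n * \<rho> ^ N = (n * \<rho> ^ (N - 2)) * \<rho>\<^sup>2"
      using N by (metis le_add_diff_inverse2 mult.assoc power_add)
    have part2: "c * ((n * n * \<rho> ^ (N - 2)) * C (N - 2) + real K ^ 3 * U (N - 2))
        + (real K ^ 2 + K) * U (N - 2) = (n * \<rho> ^ N) * (q * C (N - 2) + e1 * y (N - 2))"
      unfolding D2 Uy[of "N - 2"] q_def e1_def using \<rho> n by (simp add: field_simps)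
    have part3: "3 * real (N\<^sup>2) * (c * (if 3 \<le> N then U (N - 3) else 0))
        + real N * (c * (\<Sum>a<N - 2. pair_sum c n a (N - 3 - a)))
      \<le> (n * \<rho> ^ N) * (e2 * (if 3 \<le> N then y (N - 3) else 0) + e3 * (if 3 \<le> N then C (N - 3) else 0))"
    proof (cases "3 \<le> N")
      case True
      have "{..<N - 2} = {..N - 3}" using True by auto
      then have "c * (\<Sum>a<N - 2. pair_sum c n a (N - 3 - a))
          \<le> c * ((n * n * \<rho> ^ (N - 3)) * C (N - 3) + real K ^ 3 * U (N - 3))"
        using pair[of "N - 3"] N True c by (intro mult_left_mono) auto
      then have "real N * (c * (\<Sum>a<N - 2. pair_sum c n a (N - 3 - a)))
          \<le> real K * (c * ((n * n * \<rho> ^ (N - 3)) * C (N - 3) + real K ^ 3 * U (N - 3)))"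
        by (rule mult_mono[rotated])
          (use N c(1) pair_sum_nonneg[OF c(1)] in \<open>auto intro!: mult_nonneg_nonneg sum_nonneg\<close>)
      moreover have "3 * real (N\<^sup>2) * (c * U (N - 3)) \<le> 3 * real K ^ 2 * (c * U (N - 3))"
        using N c U0 by (intro mult_right_mono mult_nonneg_nonneg) (auto intro: power_mono)
      moreover have "n * \<rho> ^ N = (n * \<rho> ^ (N - 3)) * \<rho> ^ 3"
        using True by (metis le_add_diff_inverse2 mult.assoc power_add)
      then have "3 * real K ^ 2 * (c * U (N - 3))
          + real K * (c * ((n * n * \<rho> ^ (N - 3)) * C (N - 3) + real K ^ 3 * U (N - 3)))
          = (n * \<rho> ^ N) * (e2 * y (N - 3) + e3 * C (N - 3))"
        unfolding Uy[of "N - 3"] e2_def e3_def using \<rho> n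
        by (simp add: field_simps power4_eq_xxxx power3_eq_cube power2_eq_square)
      ultimately show ?thesis using True by simp
    next
      case False
      then have "N - 2 = 0" by simp
      then show ?thesis using False by simp
    qed
    have "U N \<le> (n * \<rho> ^ N) * (q * C (N - 2) + e1 * y (N - 2)
      + (e2 * (if 3 \<le> N then y (N - 3) else 0) + e3 * (if 3 \<le> N then C (N - 3) else 0)))"
      unfolding distrib_left[of "n * \<rho> ^ N" "q * C (N - 2) + e1 * y (N - 2)"]
      using walk_sum_rec[OF c N(1), of n] part2 part3 2 22 unfolding U_def[symmetric] by linarith
    moreover have "U N = (n * \<rho> ^ N) * y N" unfolding Uy[of N] by (rule mult.commute)
    ultimately have "(n * \<rho> ^ N) * y N \<le> (n * \<rho> ^ N) * (q * C (N - 2) + e1 * y (N - 2)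
      + (e2 * (if 3 \<le> N then y (N - 3) else 0) + e3 * (if 3 \<le> N then C (N - 3) else 0)))"
      by (simp only:)
    then show ?thesis by (rule mult_left_le_imp_le) (use n \<rho> in simp)
  qed
  have sums: "(\<Sum>N\<in>{2..Suc J}. f (N - 2)) \<le> (\<Sum>k\<le>J. f k)" if "\<And>k. 0 \<le> f k" for f :: "nat \<Rightarrow> real" and J
    using sum_shift_le[of 2 f J] that by simp
  have small': "4 * q + 2 * e1 + 2 * e2 + 4 * e3 \<le> 1"
    using small by (simp only: q_def e1_def e2_def e3_def)
  \<comment> \<open>The value 2 is the double root of \<open>S = 1 + S\<^sup>2 / 4\<close>, the
    critical case of the Catalan equation. It reproduces itself: a partial sum up to 2 yields at
    most \<open>1 + 4 q + 2 e1 + 2 e2 + 4 e3\<close> for the next one.\<close>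
  have S2: "J \<le> K \<Longrightarrow> S J \<le> 2" for J
  proof (induction J)
    case 0
    then show ?case using n by (simp add: S_def y_def U_def walk_sum_0)
  next
    case (Suc J)
    have S: "0 \<le> S J" "S J \<le> 2" using Suc y0 by (auto simp: S_def intro: sum_nonneg)
    then have SS: "(S J)\<^sup>2 \<le> 4" using power_mono[of "S J" 2 2] by simp
    have CS: "(\<Sum>k\<le>J. C k) \<le> 4"
      using sum_convolution_le[of y J, OF y0] SS unfolding C_def S_def by linarith
    have split: "{..Suc J} = {0, 1} \<union> {2..Suc J}" by auto
    have "S (Suc J) = y 0 + y 1 + (\<Sum>N\<in>{2..Suc J}. y N)"
      unfolding S_def split by (subst sum.union_disjoint) auto
    also have "y 0 = 1" using n by (simp add: y_def U_def walk_sum_0)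
    also have "y 1 = 0" by (simp add: y_def U_def walk_sum_1[simplified])
    also have "(\<Sum>N\<in>{2..Suc J}. y N) \<le> (\<Sum>N\<in>{2..Suc J}. q * C (N - 2) + e1 * y (N - 2)
      + (e2 * (if 3 \<le> N then y (N - 3) else 0) + e3 * (if 3 \<le> N then C (N - 3) else 0)))"
      using Suc by (intro sum_mono step) auto
    also have "\<dots> = q * (\<Sum>N\<in>{2..Suc J}. C (N - 2)) + e1 * (\<Sum>N\<in>{2..Suc J}. y (N - 2))
        + (e2 * (\<Sum>N\<in>{2..Suc J}. if 3 \<le> N then y (N - 3) else 0)
         + e3 * (\<Sum>N\<in>{2..Suc J}. if 3 \<le> N then C (N - 3) else 0))"
      by (simp only: sum.distrib sum_distrib_left)
    also have "\<dots> \<le> q * 4 + e1 * 2 + (e2 * 2 + e3 * 4)"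
    proof (intro add_mono mult_left_mono nonneg)
      show "(\<Sum>N\<in>{2..Suc J}. C (N - 2)) \<le> 4" using sums[of C J, OF C0] CS by linarith
      show "(\<Sum>N\<in>{2..Suc J}. y (N - 2)) \<le> 2" using sums[of y J, OF y0] S by (simp add: S_def)
      show "(\<Sum>N\<in>{2..Suc J}. if 3 \<le> N then y (N - 3) else 0) \<le> 2"
        using sum_shift_le[of 3 y J, OF _ y0] S by (simp add: S_def)
      show "(\<Sum>N\<in>{2..Suc J}. if 3 \<le> N then C (N - 3) else 0) \<le> 4"
        using sum_shift_le[of 3 C J, OF _ C0] CS by simp
    qed
    finally show ?case using small' by linarith
  qed
  have "y N \<le> S N" unfolding S_def by (rule member_le_sum) (auto simp: y0)
  then have "y N \<le> 2" using S2[OF N] by simp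
  then have "y N * (n * \<rho> ^ N) \<le> 2 * (n * \<rho> ^ N)" using \<rho> by (intro mult_right_mono) auto
  then show ?thesis using Uy[of N] by (simp add: U_def)
qed

section \<open>Moments of the centred adjacency matrix\<close>

fun walk_prod :: "('a \<Rightarrow> 'a \<Rightarrow> real) \<Rightarrow> 'a list \<Rightarrow> real" where
  "walk_prod x (a # b # vs) = x a b * walk_prod x (b # vs)"
| "walk_prod x _ = 1"

fun mpow :: "nat \<Rightarrow> (nat \<Rightarrow> nat \<Rightarrow> real) \<Rightarrow> nat \<Rightarrow> nat \<Rightarrow> nat \<Rightarrow> real" where
  "mpow n x 0 i j = of_bool (i = j)"
| "mpow n x (Suc k) i j = (\<Sum>l<n. x i l * mpow n x k l j)"

lemma mpow_add:
  assumes "i < n"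
  shows "mpow n x (k + m) i j = (\<Sum>l<n. mpow n x k i l * mpow n x m l j)"
  using assms
proof (induction k arbitrary: i)
  case 0
  then show ?case by (simp add: if_distrib[of "\<lambda>c. c * _"] of_bool_def cong: if_cong)
next
  case (Suc k)
  have "mpow n x (Suc k + m) i j = (\<Sum>h<n. x i h * (\<Sum>l<n. mpow n x k h l * mpow n x m l j))"
    using Suc.IH by simp
  also have "\<dots> = (\<Sum>h<n. \<Sum>l<n. x i h * mpow n x k h l * mpow n x m l j)"
    by (simp add: sum_distrib_left mult.assoc)
  also have "\<dots> = (\<Sum>l<n. \<Sum>h<n. x i h * mpow n x k h l * mpow n x m l j)"
    by (rule sum.swap)
  also have "\<dots> = (\<Sum>l<n. mpow n x (Suc k) i l * mpow n x m l j)"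
    by (simp add: sum_distrib_right)
  finally show ?case .
qed

lemma mpow_1: "j < n \<Longrightarrow> mpow n x (Suc 0) i j = x i j"
  by (simp add: of_bool_def if_distrib cong: if_cong)

lemma mpow_sym:
  assumes "\<And>i j. x i j = x j i" "i < n" "j < n"
  shows "mpow n x k i j = mpow n x k j i"
  using assms(2,3)
proof (induction k arbitrary: i j)
  case (Suc k)
  have "mpow n x (Suc k) i j = mpow n x (k + 1) i j" by simp
  also have "\<dots> = (\<Sum>l<n. mpow n x k i l * mpow n x (Suc 0) l j)"
    using Suc.prems by (subst mpow_add) simp_all
  also have "\<dots> = (\<Sum>l<n. x j l * mpow n x k l i)"
    using Suc.prems Suc.IH assms(1) by (intro sum.cong refl) (simp add: mpow_1 del: mpow.simps)
  finally show ?case by simp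
qed auto

lemma mpow_eigen:
  assumes "\<And>i. i < n \<Longrightarrow> (\<Sum>j<n. x i j * u j) = l * u i" "i < n"
  shows "(\<Sum>j<n. mpow n x k i j * u j) = l ^ k * u i"
  using assms(2)
proof (induction k arbitrary: i)
  case 0
  then show ?case by (simp add: if_distrib[of "\<lambda>c. c * _"] of_bool_def cong: if_cong)
next
  case (Suc k)
  have "(\<Sum>j<n. mpow n x (Suc k) i j * u j) = (\<Sum>j<n. \<Sum>h<n. x i h * mpow n x k h j * u j)"
    by (simp add: sum_distrib_right)
  also have "\<dots> = (\<Sum>h<n. \<Sum>j<n. x i h * mpow n x k h j * u j)" by (rule sum.swap)
  also have "\<dots> = (\<Sum>h<n. x i h * (l ^ k * u h))"
    using Suc.IH by (intro sum.cong refl) (simp add: mult.assoc flip: sum_distrib_left)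
  also have "\<dots> = l ^ k * (\<Sum>h<n. x i h * u h)" by (simp add: sum_distrib_left mult_ac)
  finally show ?case using assms(1) Suc.prems by simp
qed

text \<open>By Cauchy-Schwarz the norm of the \<open>k\<close>-th power applied to \<open>u\<close>
  is at most its Frobenius norm times the norm of \<open>u\<close>, and by symmetry the squared
  Frobenius norm is the trace of the \<open>2 k\<close>-th power. No diagonalisation is
  involved.\<close>

lemma eigenvalue_power_le_trace:
  assumes sym: "\<And>i j. x i j = x j i"
    and eig: "\<And>i. i < n \<Longrightarrow> (\<Sum>j<n. x i j * u j) = l * u i" and "i < n" "u i \<noteq> 0"
  shows "l ^ (2 * k) \<le> (\<Sum>i<n. mpow n x (2 * k) i i)"
proof -
  define s where "s = (\<Sum>j<n. (u j)\<^sup>2)"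
  have "0 < (u i)\<^sup>2" using assms by simp
  also have "\<dots> \<le> s" unfolding s_def using assms by (intro member_le_sum) auto
  finally have s: "0 < s" .
  have "l ^ (2 * k) * s = (\<Sum>i<n. (l ^ k * u i)\<^sup>2)"
    by (simp add: s_def sum_distrib_left power_mult_distrib power_mult[symmetric] mult.commute)
  also have "\<dots> = (\<Sum>i<n. (\<Sum>j<n. mpow n x k i j * u j)\<^sup>2)"
    using mpow_eigen[OF eig] by simp
  also have "\<dots> \<le> (\<Sum>i<n. (\<Sum>j<n. (mpow n x k i j)\<^sup>2) * s)"
    unfolding s_def by (intro sum_mono Cauchy_Schwarz_ineq_sum)
  also have "\<dots> = (\<Sum>i<n. \<Sum>j<n. (mpow n x k i j)\<^sup>2) * s" by (simp add: sum_distrib_right)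
  also have "(\<Sum>i<n. \<Sum>j<n. (mpow n x k i j)\<^sup>2) = (\<Sum>i<n. \<Sum>j<n. mpow n x k i j * mpow n x k j i)"
    using mpow_sym[OF sym] by (intro sum.cong refl) (simp add: power2_eq_square)
  also have "\<dots> = (\<Sum>i<n. mpow n x (k + k) i i)"
    by (intro sum.cong refl) (simp add: mpow_add)
  finally show ?thesis using s by (simp add: mult_2)
qed

lemma walks_Suc: "walks n (Suc k) = (\<lambda>(i, vs). i # vs) ` ({..<n} \<times> walks n k)"
proof (intro equalityI subsetI)
  fix vs assume "vs \<in> walks n (Suc k)"
  then obtain i ws where "vs = i # ws" "i < n" "ws \<in> walks n k"
    by (cases vs) (auto simp: walks_def)
  then show "vs \<in> (\<lambda>(i, vs). i # vs) ` ({..<n} \<times> walks n k)" by auto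
qed (auto simp: walks_def)

lemma mpow_eq_walks:
  assumes "i < n" "j < n"
  shows "mpow n x k i j = (\<Sum>vs | vs \<in> walks n k \<and> hd vs = i \<and> last vs = j. walk_prod x vs)"
  using assms
proof (induction k arbitrary: i)
  case 0
  have "{vs \<in> walks n 0. hd vs = i \<and> last vs = j} = (if i = j then {[i]} else {})"
    using 0 by (auto simp: walks_def length_Suc_conv)
  then show ?case by simp
next
  case (Suc k)
  let ?W = "{vs \<in> walks n k. last vs = j}"
  have hd: "hd vs < n" "vs \<noteq> []" if "vs \<in> walks n k" for vs
    using that by (cases vs; auto simp: walks_def)+
  have "{vs \<in> walks n (Suc k). hd vs = i \<and> last vs = j} = (\<lambda>vs. i # vs) ` ?W"
    using Suc.prems hd by (auto simp: walks_Suc)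
  then have "(\<Sum>vs | vs \<in> walks n (Suc k) \<and> hd vs = i \<and> last vs = j. walk_prod x vs)
      = (\<Sum>vs\<in>?W. walk_prod x (i # vs))"
    by (simp add: sum.reindex inj_on_def)
  also have "\<dots> = (\<Sum>vs\<in>?W. x i (hd vs) * walk_prod x vs)"
  proof (rule sum.cong[OF refl])
    fix vs assume "vs \<in> ?W"
    then show "walk_prod x (i # vs) = x i (hd vs) * walk_prod x vs"
      using hd(2)[of vs] by (cases vs) auto
  qed
  also have "\<dots> = (\<Sum>l<n. \<Sum>vs | vs \<in> ?W \<and> hd vs = l. x i (hd vs) * walk_prod x vs)"
    using hd by (intro sum.group[symmetric]) auto
  also have "\<dots> = (\<Sum>l<n. x i l * mpow n x k l j)"
  proof (rule sum.cong[OF refl])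
    fix l assume "l \<in> {..<n}"
    then show "(\<Sum>vs | vs \<in> ?W \<and> hd vs = l. x i (hd vs) * walk_prod x vs) = x i l * mpow n x k l j"
      using Suc.IH[of l] Suc.prems
      by (simp add: sum_distrib_left) (rule sum.cong, auto)
  qed
  finally show ?case by simp
qed

lemma trace_mpow_eq_walks:
  "(\<Sum>i<n. mpow n x k i i) = (\<Sum>vs | vs \<in> walks n k \<and> hd vs = last vs. walk_prod x vs)"
proof -
  have hd: "hd vs < n" if "vs \<in> walks n k" for vs
    using that by (cases vs) (auto simp: walks_def)
  have "(\<Sum>vs | vs \<in> walks n k \<and> hd vs = last vs. walk_prod x vs)
      = (\<Sum>i<n. \<Sum>vs | vs \<in> {vs \<in> walks n k. hd vs = last vs} \<and> hd vs = i. walk_prod x vs)"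
    by (intro sum.group[symmetric]) (auto dest: hd)
  also have "\<dots> = (\<Sum>i<n. mpow n x k i i)"
    by (intro sum.cong refl) (auto simp: mpow_eq_walks intro!: sum.cong)
  finally show ?thesis ..
qed

text \<open>Passes from edges as two-element sets, natural for walks traversed in both directions,
  to ordered pairs, which index the independent variables.\<close>

lemma prod_over_vertex_pairs:
  fixes F :: "nat set \<Rightarrow> real"
  assumes "\<And>e. e \<in> S \<Longrightarrow> \<exists>i j. i < j \<and> j < n \<and> e = {i, j}"
  shows "(\<Prod>e\<in>S. F e) = (\<Prod>(i, j)\<in>vertex_pairs n. if {i, j} \<in> S then F {i, j} else 1)"
proof -
  let ?T = "{t \<in> vertex_pairs n. {fst t, snd t} \<in> S}"
  have S: "S = (\<lambda>t. {fst t, snd t}) ` ?T"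
  proof (intro equalityI subsetI)
    fix e assume e: "e \<in> S"
    then obtain i j where "i < j" "j < n" "e = {i, j}" using assms by blast
    then show "e \<in> (\<lambda>t. {fst t, snd t}) ` ?T"
      using e by (intro image_eqI[of _ _ "(i, j)"]) (auto simp: vertex_pairs_def)
  qed auto
  have "inj_on (\<lambda>t. {fst t, snd t}) ?T"
    by (auto simp: inj_on_def vertex_pairs_def doubleton_eq_iff)
  then have "(\<Prod>e\<in>S. F e) = (\<Prod>t\<in>?T. F {fst t, snd t})"
    by (subst S) (simp add: prod.reindex)
  also have "\<dots> = (\<Prod>t\<in>vertex_pairs n. if {fst t, snd t} \<in> S then F {fst t, snd t} else 1)"
    by (rule prod.inter_filter) simp
  finally show ?thesis by (simp add: case_prod_unfold)
qed

text \<open>The diagonal is kept 0, so that \<open>A\<close> differs from this matrix by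
  \<open>p (J - I)\<close> with \<open>J\<close> all ones, and walks with loops contribute
  nothing.\<close>

definition centred :: "real \<Rightarrow> edge_config \<Rightarrow> nat \<Rightarrow> nat \<Rightarrow> real" where
  "centred p E i j = (if i = j then 0 else of_bool (E (min i j, max i j)) - p)"

lemma centred_sym: "centred p E i j = centred p E j i"
  by (simp add: centred_def min.commute max.commute)

lemma finite_set_pmf_gnp [simp]: "finite (set_pmf (gnp n p))"
  unfolding gnp_def by (rule finite_subset[OF set_Pi_pmf_subset']) (auto intro!: finite_PiE_dflt)

lemma integrable_gnp [simp]: "integrable (measure_pmf (gnp n p)) (f :: edge_config \<Rightarrow> real)"
  by (rule integrable_measure_pmf_finite) simp

lemma expectation_gnp_prod:
  fixes f :: "nat \<times> nat \<Rightarrow> bool \<Rightarrow> real"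
  assumes "0 \<le> p" "p \<le> 1"
  shows "measure_pmf.expectation (gnp n p) (\<lambda>E. \<Prod>t\<in>vertex_pairs n. f t (E t))
    = (\<Prod>t\<in>vertex_pairs n. p * f t True + (1 - p) * f t False)"
proof -
  have int: "integrable (measure_pmf (gnp n p)) (\<lambda>E. f t (E t))" for t by simp
  have "prob_space.indep_vars (measure_pmf (gnp n p)) (\<lambda>_. count_space UNIV) (\<lambda>t E. E t) (vertex_pairs n)"
    unfolding gnp_def by (rule indep_vars_Pi_pmf) simp
  then have "prob_space.indep_vars (measure_pmf (gnp n p)) (\<lambda>_. borel) (\<lambda>t E. f t (E t)) (vertex_pairs n)"
    by (rule prob_space.indep_vars_compose2[OF prob_space_measure_pmf]) auto
  then have "measure_pmf.expectation (gnp n p) (\<lambda>E. \<Prod>t\<in>vertex_pairs n. f t (E t))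
    = (\<Prod>t\<in>vertex_pairs n. measure_pmf.expectation (gnp n p) (\<lambda>E. f t (E t)))"
    using int by (intro prob_space.indep_vars_lebesgue_integral[OF prob_space_measure_pmf]) auto
  also have "\<dots> = (\<Prod>t\<in>vertex_pairs n. p * f t True + (1 - p) * f t False)"
  proof (rule prod.cong[OF refl])
    fix t assume t: "t \<in> vertex_pairs n"
    have "measure_pmf.expectation (gnp n p) (\<lambda>E. f t (E t))
        = measure_pmf.expectation (map_pmf (\<lambda>E. E t) (gnp n p)) (f t)" by simp
    also have "map_pmf (\<lambda>E. E t) (gnp n p) = bernoulli_pmf p"
      using t by (simp add: gnp_def Pi_pmf_component)
    finally show "measure_pmf.expectation (gnp n p) (\<lambda>E. f t (E t)) = p * f t True + (1 - p) * f t False"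
      using assms by simp
  qed
  finally show ?thesis .
qed

lemma walk_prod_eq_edges:
  assumes "\<And>i j. x i j = g {i, j}"
  shows "walk_prod x vs = (\<Prod>e\<in>set_mset (edges_of vs). g e ^ count (edges_of vs) e)"
proof -
  have "walk_prod x vs = prod_mset (image_mset g (edges_of vs))"
    by (induction vs rule: edges_of.induct) (auto simp: assms)
  then show ?thesis by (simp add: image_prod_mset_multiplicity)
qed

lemma bernoulli_central_moment_le:
  fixes p :: real
  assumes "0 \<le> p" "p \<le> 1" "2 \<le> k"
  shows "\<bar>p * (1 - p) ^ k + (1 - p) * (- p) ^ k\<bar> \<le> p * (1 - p)"
proof -
  have 1: "q ^ k \<le> q\<^sup>2" if "0 \<le> q" "q \<le> 1" for q :: real
    using that assms by (intro power_decreasing) auto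
  have "\<bar>p * (1 - p) ^ k + (1 - p) * (- p) ^ k\<bar> \<le> p * (1 - p) ^ k + (1 - p) * p ^ k"
    using assms by (intro order_trans[OF abs_triangle_ineq]) (simp add: abs_mult power_abs)
  also have "\<dots> \<le> p * (1 - p)\<^sup>2 + (1 - p) * p\<^sup>2"
    using assms by (intro add_mono mult_left_mono 1) auto
  also have "\<dots> = p * (1 - p)" by (simp add: power2_eq_square algebra_simps)
  finally show ?thesis .
qed

lemma expectation_walk_prod_le:
  assumes p: "0 \<le> p" "p \<le> 1" and vs: "set vs \<subseteq> {..<n}"
  shows "measure_pmf.expectation (gnp n p) (\<lambda>E. walk_prod (centred p E) vs)
    \<le> wt (p * (1 - p)) (edges_of vs)"
proof -
  define M where "M = edges_of vs"
  \<comment> \<open>An entry as a function of the unordered edge; \<open>Min e = Max e\<close>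
    detects loops.\<close>
  define g where "g = (\<lambda>E e. if Min e = Max e then 0 else of_bool (E (Min e, Max e :: nat)) - p)"
  have cg: "centred p E i j = g E {i, j}" for E i j by (simp add: centred_def g_def min_def max_def)
  have wp: "walk_prod (centred p E) vs = (\<Prod>e\<in>set_mset M. g E e ^ count M e)" for E
    unfolding M_def by (rule walk_prod_eq_edges) (rule cg)
  have wt0: "0 \<le> wt (p * (1 - p)) M" using p by (simp add: wt_nonneg)
  have pair: "\<exists>i j. i < n \<and> j < n \<and> e = {i, j}" if "e \<in># M" for e
    using that vs unfolding M_def by (induction vs rule: edges_of.induct) auto
  show ?thesis
  proof (cases "\<exists>i. {i} \<in># M")
    case True
    then obtain i where i: "{i} \<in># M" by blast
    have "walk_prod (centred p E) vs = 0" for E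
      unfolding wp using i by (intro prod_zero) (auto simp: g_def intro!: bexI[of _ "{i}"] simp flip: count_greater_zero_iff)
    then show ?thesis using wt0 by (simp add: M_def)
  next
    case False
    have pair': "\<exists>i j. i < j \<and> j < n \<and> e = {i, j}" if e: "e \<in> set_mset M" for e
    proof -
      obtain i j where ij: "i < n" "j < n" "e = {i, j}" using pair[OF e] by blast
      then have "i \<noteq> j" using False e by auto
      then show ?thesis using ij by (metis insert_commute nat_neq_iff)
    qed
    define f where "f = (\<lambda>(i, j) b. (of_bool b - p) ^ count M {i, j})"
    have "walk_prod (centred p E) vs = (\<Prod>t\<in>vertex_pairs n. f t (E t))" for E
      unfolding wp by (subst prod_over_vertex_pairs[where n = n], erule pair', intro prod.cong) (auto simp: f_def g_def vertex_pairs_def not_in_iff split: prod.split)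
    then have "measure_pmf.expectation (gnp n p) (\<lambda>E. walk_prod (centred p E) vs)
      = (\<Prod>t\<in>vertex_pairs n. p * f t True + (1 - p) * f t False)"
      using expectation_gnp_prod[OF p, of n f] by simp
    also have "\<dots> \<le> (\<Prod>t\<in>vertex_pairs n. \<bar>p * f t True + (1 - p) * f t False\<bar>)"
      by (simp flip: abs_prod)
    also have "\<dots> \<le> (\<Prod>(i, j)\<in>vertex_pairs n. if {i, j} \<in> set_mset M
          then if count M {i, j} = 1 then 0 else p * (1 - p) else 1)"
    proof (rule prod_mono, clarify)
      fix i j
      consider "count M {i, j} = 0" | "count M {i, j} = 1" | "2 \<le> count M {i, j}" by linarith
      then show "0 \<le> \<bar>p * f (i, j) True + (1 - p) * f (i, j) False\<bar> \<and>
        \<bar>p * f (i, j) True + (1 - p) * f (i, j) False\<bar> \<le> (if {i, j} \<in> set_mset M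
          then if count M {i, j} = 1 then 0 else p * (1 - p) else 1)"
      proof cases
        case 1
        then have "{i, j} \<notin># M" by (simp add: not_in_iff)
        then show ?thesis using 1 by (simp add: f_def)
      next
        case 2
        \<comment> \<open>A simple edge contributes the mean
          \<open>p (1 - p) + (1 - p) (- p) = 0\<close>.\<close>
        then show ?thesis by (simp add: f_def algebra_simps)
      next
        case 3
        then have "{i, j} \<in># M" by (intro count_inI) simp
        then show ?thesis using 3 bernoulli_central_moment_le[OF p 3] by (simp add: f_def)
      qed
    qed
    also have "\<dots> = wt (p * (1 - p)) M"
      unfolding wt_def by (rule prod_over_vertex_pairs[OF pair', symmetric])
    finally show ?thesis by (simp add: M_def)
  qed
qed

lemma expectation_trace_le:
  assumes p: "0 \<le> p" "p \<le> 1"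
  shows "measure_pmf.expectation (gnp n p) (\<lambda>E. \<Sum>i<n. mpow n (centred p E) k i i)
    \<le> walk_sum (p * (1 - p)) n k"
proof -
  have "measure_pmf.expectation (gnp n p) (\<lambda>E. \<Sum>i<n. mpow n (centred p E) k i i)
      = (\<Sum>vs | vs \<in> walks n k \<and> hd vs = last vs.
          measure_pmf.expectation (gnp n p) (\<lambda>E. walk_prod (centred p E) vs))"
    unfolding trace_mpow_eq_walks by (rule Bochner_Integration.integral_sum) simp
  also have "\<dots> \<le> (\<Sum>vs | vs \<in> walks n k \<and> hd vs = last vs. wt (p * (1 - p)) (edges_of vs))"
    by (intro sum_mono expectation_walk_prod_le p) (auto simp: walks_def)
  also have "\<dots> \<le> walk_sum (p * (1 - p)) n k"
    unfolding walk_sum_def using p by (intro sum_mono2) (auto simp: wt_nonneg)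
  finally show ?thesis .
qed

lemma trace_tail_bound:
  assumes p: "0 \<le> p" "p \<le> 1" and "0 < a"
  shows "measure_pmf.prob (gnp n p) {E. a \<le> (\<Sum>i<n. mpow n (centred p E) (2 * k) i i)}
    \<le> walk_sum (p * (1 - p)) n (2 * k) / a"
proof -
  \<comment> \<open>Markov's inequality needs nonnegativity; each diagonal entry of an even power is
    a sum of squares by symmetry.\<close>
  have nn: "0 \<le> (\<Sum>i<n. mpow n (centred p E) (2 * k) i i)" for E
  proof (rule sum_nonneg)
    fix i assume i: "i \<in> {..<n}"
    have "mpow n (centred p E) (2 * k) i i = (\<Sum>l<n. mpow n (centred p E) k i l * mpow n (centred p E) k l i)"
      using i by (simp add: mult_2 mpow_add)
    also have "\<dots> = (\<Sum>l<n. (mpow n (centred p E) k i l)\<^sup>2)"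
      using i mpow_sym[of "centred p E", OF centred_sym]
      by (intro sum.cong refl) (simp add: power2_eq_square)
    finally show "0 \<le> mpow n (centred p E) (2 * k) i i" by (simp add: sum_nonneg)
  qed
  have "measure_pmf.prob (gnp n p) {E. a \<le> (\<Sum>i<n. mpow n (centred p E) (2 * k) i i)}
      \<le> measure_pmf.expectation (gnp n p) (\<lambda>E. \<Sum>i<n. mpow n (centred p E) (2 * k) i i) / a"
    using integral_Markov_inequality_measure[of "measure_pmf (gnp n p)"
        "\<lambda>E. \<Sum>i<n. mpow n (centred p E) (2 * k) i i" "{}" a] nn assms(3) by simp
  also have "\<dots> \<le> walk_sum (p * (1 - p)) n (2 * k) / a"
    using expectation_trace_le[OF p] assms(3) by (intro divide_right_mono) auto
  finally show ?thesis .
qed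

section \<open>Spectral decomposition of real symmetric matrices\<close>

definition mvmult :: "nat \<Rightarrow> (nat \<Rightarrow> nat \<Rightarrow> real) \<Rightarrow> (nat \<Rightarrow> complex) \<Rightarrow> nat \<Rightarrow> complex" where
  "mvmult n a v i = (\<Sum>j<n. of_real (a i j) * v j)"

lemma mvmult_diff: "mvmult n a (\<lambda>i. v i - w i) i = mvmult n a v i - mvmult n a w i"
  by (simp add: mvmult_def algebra_simps sum_subtractf)

lemma mvmult_scale: "mvmult n a (\<lambda>i. c * v i) i = c * mvmult n a v i"
  by (simp add: mvmult_def algebra_simps sum_distrib_left)

lemma mvmult_sum: "mvmult n a (\<lambda>i. \<Sum>s\<in>S. f s i) i = (\<Sum>s\<in>S. mvmult n a (f s) i)"
  unfolding mvmult_def sum_distrib_left by (rule sum.swap)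

lemma mvmult_cong: "(\<And>j. j < n \<Longrightarrow> v j = w j) \<Longrightarrow> mvmult n a v i = mvmult n a w i"
  by (simp add: mvmult_def)

lemma mvmult_adjoint:
  assumes "\<And>i j. a i j = a j i"
  shows "(\<Sum>i<n. mvmult n a v i * cnj (w i)) = (\<Sum>i<n. v i * cnj (mvmult n a w i))"
proof -
  have "(\<Sum>i<n. mvmult n a v i * cnj (w i)) = (\<Sum>i<n. \<Sum>j<n. of_real (a i j) * v j * cnj (w i))"
    by (simp add: mvmult_def sum_distrib_right)
  also have "\<dots> = (\<Sum>j<n. \<Sum>i<n. of_real (a i j) * v j * cnj (w i))" by (rule sum.swap)
  also have "\<dots> = (\<Sum>j<n. v j * cnj (mvmult n a w j))"
    using assms by (simp add: mvmult_def sum_distrib_left mult_ac)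
  finally show ?thesis .
qed

lemma sum_cnj_eq_0:
  fixes v :: "nat \<Rightarrow> complex"
  assumes "(\<Sum>i<n. v i * cnj (v i)) = 0" "i < n"
  shows "v i = 0"
proof -
  have "of_real (\<Sum>i<n. (cmod (v i))\<^sup>2) = (\<Sum>i<n. v i * cnj (v i))"
    by (simp only: of_real_sum complex_norm_square)
  then have "(\<Sum>i<n. (cmod (v i))\<^sup>2) = 0" using assms by (metis of_real_eq_0_iff)
  moreover have "(cmod (v i))\<^sup>2 \<le> (\<Sum>i<n. (cmod (v i))\<^sup>2)"
    using assms(2) by (intro member_le_sum) auto
  ultimately show ?thesis by simp
qed

text \<open>Components are indexed by distinct real eigenvalues rather than by an orthonormal basis,
  so no multiplicities or bases of eigenspaces are needed. A component may be zero, so a member of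
  \<open>S\<close> is known to be an eigenvalue only if its component is not.\<close>

definition spectral_sum :: "nat \<Rightarrow> (nat \<Rightarrow> nat \<Rightarrow> real) \<Rightarrow> (nat \<Rightarrow> complex) \<Rightarrow> real set \<Rightarrow> (real \<Rightarrow> nat \<Rightarrow> complex) \<Rightarrow> bool"
  where "spectral_sum n a v S f \<longleftrightarrow> finite S \<and> (\<forall>i<n. v i = (\<Sum>l\<in>S. f l i)) \<and>
    (\<forall>l\<in>S. \<forall>i<n. mvmult n a (f l) i = of_real l * f l i)"

lemma symmetric_eigenvalue_real:
  assumes sym: "\<And>i j. a i j = a j i"
    and eig: "\<And>i. i < n \<Longrightarrow> mvmult n a v i = \<mu> * v i" and "i < n" "v i \<noteq> 0"
  shows "\<mu> \<in> \<real>"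
proof -
  have "\<mu> * (\<Sum>i<n. v i * cnj (v i)) = cnj \<mu> * (\<Sum>i<n. v i * cnj (v i))"
    using mvmult_adjoint[of a n v v, OF sym] eig
    by (simp add: sum_distrib_left mult_ac)
  moreover have "(\<Sum>i<n. v i * cnj (v i)) \<noteq> 0" using sum_cnj_eq_0[of v n i] assms(3,4) by blast
  ultimately show ?thesis by (simp add: Reals_cnj_iff)
qed

text \<open>There are no Jordan blocks: with \<open>B = a - l\<close>, the vector
  \<open>w = B v\<close> satisfies \<open><w, w> = <B v, w> = <v, B w> = 0\<close>.\<close>

lemma symmetric_kernel_square:
  assumes sym: "\<And>i j. a i j = a j i"
    and w: "\<And>i. i < n \<Longrightarrow> w i = mvmult n a v i - of_real l * v i"
    and eig: "\<And>i. i < n \<Longrightarrow> mvmult n a w i = of_real l * w i" and "i < n"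
  shows "w i = 0"
proof -
  have "(\<Sum>i<n. w i * cnj (w i))
      = (\<Sum>i<n. mvmult n a v i * cnj (w i) - of_real l * (v i * cnj (w i)))"
  proof (rule sum.cong[OF refl])
    fix i assume "i \<in> {..<n}"
    then show "w i * cnj (w i) = mvmult n a v i * cnj (w i) - of_real l * (v i * cnj (w i))"
      using arg_cong[OF w[of i], of "\<lambda>t. t * cnj (w i)"] by (simp add: algebra_simps)
  qed
  also have "\<dots> = (\<Sum>i<n. mvmult n a v i * cnj (w i)) - of_real l * (\<Sum>i<n. v i * cnj (w i))"
    by (simp add: sum_subtractf sum_distrib_left)
  also have "(\<Sum>i<n. mvmult n a v i * cnj (w i)) = of_real l * (\<Sum>i<n. v i * cnj (w i))"
    unfolding mvmult_adjoint[OF sym] using eig by (simp add: sum_distrib_left mult_ac)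
  finally have "(\<Sum>i<n. w i * cnj (w i)) = 0" by simp
  then show ?thesis by (rule sum_cnj_eq_0) (fact assms(4))
qed

text \<open>Dividing the components of \<open>w\<close> by \<open>l - \<mu>\<close> inverts
  \<open>a - \<mu>\<close> off the eigenvalue \<open>\<mu>\<close>. The remainder \<open>r\<close>
  is sent by \<open>a - \<mu>\<close> to the component of \<open>w\<close> at \<open>\<mu>\<close>,
  which vanishes because there are no Jordan blocks. So \<open>r\<close> is zero or an eigenvector,
  and in the second case \<open>\<mu>\<close> is real.\<close>

lemma spectral_sum_lift:
  assumes sym: "\<And>i j. a i j = a j i"
    and w: "\<And>i. i < n \<Longrightarrow> w i = mvmult n a v i - \<mu> * v i" and S: "spectral_sum n a w S f"
  shows "\<exists>S f. spectral_sum n a v S f"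
proof -
  define S' where "S' = {l \<in> S. of_real l \<noteq> \<mu>}"
  define g where "g = (\<lambda>l i. f l i / (of_real l - \<mu>))"
  define r where "r = (\<lambda>i. v i - (\<Sum>l\<in>S'. g l i))"
  have fin: "finite S" "finite S'" using S by (auto simp: spectral_sum_def S'_def)
  have geig: "mvmult n a (g l) i = of_real l * g l i" if "l \<in> S'" "i < n" for l i
  proof -
    have "mvmult n a (g l) i = mvmult n a (f l) i / (of_real l - \<mu>)"
      using mvmult_scale[of n a "1 / (of_real l - \<mu>)" "f l" i] by (simp add: g_def)
    then show ?thesis using S that by (simp add: spectral_sum_def S'_def g_def)
  qed
  have r1: "mvmult n a r i - \<mu> * r i = (\<Sum>l\<in>S - S'. f l i)" if "i < n" for i
  proof -
    have "mvmult n a r i - \<mu> * r i = w i - (\<Sum>l\<in>S'. of_real l * g l i - \<mu> * g l i)"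
      using that geig w by (simp add: r_def mvmult_diff mvmult_sum algebra_simps sum_subtractf sum_distrib_left)
    also have "(\<Sum>l\<in>S'. of_real l * g l i - \<mu> * g l i) = (\<Sum>l\<in>S'. f l i)"
    proof (rule sum.cong[OF refl])
      fix l assume "l \<in> S'"
      then have "of_real l - \<mu> \<noteq> 0" by (simp add: S'_def)
      then show "of_real l * g l i - \<mu> * g l i = f l i"
        by (simp only: g_def left_diff_distrib[symmetric]) simp
    qed
    also have "w i = (\<Sum>l\<in>S. f l i)" using S that by (simp add: spectral_sum_def)
    finally show ?thesis using fin by (simp add: sum_diff S'_def)
  qed
  have r2: "mvmult n a r i = \<mu> * r i" if "i < n" for i
  proof (cases "S - S' = {}")
    case True
    show ?thesis using r1[OF that] unfolding True by simp
  next
    case False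
    then obtain l where l: "l \<in> S" "of_real l = \<mu>" by (auto simp: S'_def)
    then have "S - S' = {l}" by (auto simp: S'_def)
    then have fr: "f l i = mvmult n a r i - of_real l * r i" if "i < n" for i using r1[OF that] l by simp
    have "mvmult n a (f l) i = of_real l * f l i" if "i < n" for i
      using S l that by (simp add: spectral_sum_def)
    then have "f l i = 0" using symmetric_kernel_square[OF sym fr] that by blast
    then show ?thesis using fr[OF that] l by simp
  qed
  show ?thesis
  proof (cases "\<exists>i<n. r i \<noteq> 0")
    case False
    then have "spectral_sum n a v S' g"
      using fin geig by (auto simp: spectral_sum_def r_def)
    then show ?thesis by blast
  next
    case True
    then have "\<mu> \<in> \<real>" using symmetric_eigenvalue_real[OF sym r2] by blast
    then obtain m where m: "\<mu> = of_real m" by (auto elim: Reals_cases)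
    then have "m \<notin> S'" by (auto simp: S'_def)
    then have "spectral_sum n a v (insert m S') (g(m := r))"
      using fin geig r2 m
      by (auto simp: spectral_sum_def r_def sum.insert_if intro!: sum.cong)
    then show ?thesis by blast
  qed
qed

text \<open>Schur triangularisation over the complex numbers gives a flag of invariant subspaces.
  Subtracting the \<open>k\<close>-th diagonal entry maps each subspace of the flag into the
  preceding one, and \<open>spectral_sum_lift\<close> climbs back up; symmetry enters only
  there.\<close>

lemma spectral_decomposition:
  fixes a :: "nat \<Rightarrow> nat \<Rightarrow> real" and v :: "nat \<Rightarrow> complex"
  assumes sym: "\<And>i j. a i j = a j i"
  obtains S f where "spectral_sum n a v S f"
proof -
  define A where "A = Matrix.mat n n (\<lambda>(i, j). complex_of_real (a i j))"
  have A: "A \<in> carrier_mat n n" by (simp add: A_def)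
  obtain es where "char_poly A = (\<Prod>e\<leftarrow>es. [:- e, 1:])" using char_poly_factorized[OF A] by blast
  then obtain B where B: "B \<in> carrier_mat n n" "upper_triangular B" "similar_mat A B"
    using schur_decomposition_exists[OF A] by blast
  then obtain P Q where sim: "similar_mat_wit A B P Q" by (auto simp: similar_mat_def)
  note PQ = similar_mat_witD2[OF A sim]
  have AP: "A * P = P * B"
  proof -
    have "A * P = P * B * (Q * P)" using PQ by (simp add: assoc_mult_mat[of _ n n _ n _ n])
    then show ?thesis using PQ by simp
  qed
  define y0 where "y0 = (\<lambda>m. \<Sum>j<n. Q $$ (m, j) * v j)"
  have claim: "k \<le> n \<Longrightarrow> (\<And>m. k \<le> m \<Longrightarrow> y m = 0) \<Longrightarrow>
      \<exists>S f. spectral_sum n a (\<lambda>i. \<Sum>m<n. P $$ (i, m) * y m) S f" for k y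
  proof (induction k arbitrary: y)
    case 0
    then have "spectral_sum n a (\<lambda>i. \<Sum>m<n. P $$ (i, m) * y m) {} (\<lambda>_ _. 0)"
      by (simp add: spectral_sum_def)
    then show ?case by blast
  next
    case (Suc k)
    \<comment> \<open>Coordinates after applying \<open>B - B $$ (k, k)\<close>; triangularity makes
      the coordinate \<open>k\<close> vanish, too. Beyond \<open>n\<close> they are set to 0 to
      match the induction hypothesis.\<close>
    define y' where "y' = (\<lambda>m. if m < n then (\<Sum>l<n. B $$ (m, l) * y l) - B $$ (k, k) * y m else 0)"
    have "y' m = 0" if "k \<le> m" for m
    proof (cases "m < n")
      case True
      have "(\<Sum>l<n. B $$ (m, l) * y l) = (\<Sum>l<n. if l = k then B $$ (k, k) * y m else 0)"
      proof (rule sum.cong[OF refl])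
        fix l assume l: "l \<in> {..<n}"
        consider "l < m" | "l = k" "m = k" | "k < l" using \<open>k \<le> m\<close> by linarith
        then show "B $$ (m, l) * y l = (if l = k then B $$ (k, k) * y m else 0)"
        proof cases
          case 1
          then have "B $$ (m, l) = 0" using B True by (auto dest: upper_triangularD)
          then show ?thesis using 1 Suc.prems \<open>k \<le> m\<close> by auto
        qed (use Suc.prems in auto)
      qed
      then show ?thesis using Suc.prems by (simp add: y'_def)
    qed (simp add: y'_def)
    then have IH: "\<exists>S f. spectral_sum n a (\<lambda>i. \<Sum>m<n. P $$ (i, m) * y' m) S f"
      using Suc by simp
    have key: "(\<Sum>m<n. P $$ (i, m) * y' m) = mvmult n a (\<lambda>i. \<Sum>m<n. P $$ (i, m) * y m) i
        - B $$ (k, k) * (\<Sum>m<n. P $$ (i, m) * y m)" if i: "i < n" for i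
    proof -
      have AP': "(\<Sum>j<n. of_real (a i j) * P $$ (j, l)) = (\<Sum>m<n. P $$ (i, m) * B $$ (m, l))"
        if l: "l < n" for l
      proof -
        have "(A * P) $$ (i, l) = (\<Sum>j<n. of_real (a i j) * P $$ (j, l))"
          using i l PQ(6) A by (simp add: scalar_prod_def A_def atLeast0LessThan)
        moreover have "(P * B) $$ (i, l) = (\<Sum>m<n. P $$ (i, m) * B $$ (m, l))"
          using i l PQ(6) B(1) by (simp add: scalar_prod_def atLeast0LessThan)
        ultimately show ?thesis using AP by simp
      qed
      have "mvmult n a (\<lambda>i. \<Sum>m<n. P $$ (i, m) * y m) i
          = (\<Sum>l<n. (\<Sum>j<n. of_real (a i j) * P $$ (j, l)) * y l)"
        unfolding mvmult_def sum_distrib_left sum_distrib_right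
        by (subst sum.swap) (simp add: mult.assoc)
      also have "\<dots> = (\<Sum>l<n. (\<Sum>m<n. P $$ (i, m) * B $$ (m, l)) * y l)"
        using AP' by (intro sum.cong) auto
      also have "\<dots> = (\<Sum>m<n. P $$ (i, m) * (\<Sum>l<n. B $$ (m, l) * y l))"
        unfolding sum_distrib_left sum_distrib_right
        by (subst sum.swap) (simp add: mult.assoc)
      finally show ?thesis
        by (simp add: y'_def sum_distrib_left algebra_simps flip: sum_subtractf)
    qed
    obtain S f where Sf: "spectral_sum n a (\<lambda>i. \<Sum>m<n. P $$ (i, m) * y' m) S f" using IH by blast
    show ?case by (rule spectral_sum_lift[where a = a, OF sym _ Sf]) (rule key)
  qed
  define y where "y = (\<lambda>m. if m < n then y0 m else 0)"
  obtain S f where S: "spectral_sum n a (\<lambda>i. \<Sum>m<n. P $$ (i, m) * y m) S f"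
    using claim[of n y] by (auto simp: y_def)
  have "(\<Sum>m<n. P $$ (i, m) * y m) = v i" if i: "i < n" for i
  proof -
    have PQ1: "(\<Sum>m<n. P $$ (i, m) * Q $$ (m, j)) = (if i = j then 1 else 0)" if j: "j < n" for j
    proof -
      have "(P * Q) $$ (i, j) = (\<Sum>m<n. P $$ (i, m) * Q $$ (m, j))"
        using i j PQ(6,7) by (simp add: scalar_prod_def atLeast0LessThan)
      then show ?thesis unfolding PQ(1) using i j by simp
    qed
    have "(\<Sum>m<n. P $$ (i, m) * y m) = (\<Sum>j<n. (\<Sum>m<n. P $$ (i, m) * Q $$ (m, j)) * v j)"
      unfolding y_def y0_def sum_distrib_left sum_distrib_right
      by (subst sum.swap) (simp add: sum_distrib_left mult.assoc)
    also have "\<dots> = (\<Sum>j<n. if i = j then v j else 0)"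
      using PQ1 by (intro sum.cong) auto
    finally show ?thesis using i by simp
  qed
  then have "spectral_sum n a v S f" using S by (simp add: spectral_sum_def)
  then show ?thesis by (rule that)
qed

lemma spectral_inner:
  assumes sym: "\<And>i j. a i j = a j i" and S: "spectral_sum n a v S f"
  shows "(\<Sum>i<n. (\<Sum>l\<in>S. b l * f l i) * cnj (\<Sum>l\<in>S. c l * f l i))
    = (\<Sum>l\<in>S. b l * cnj (c l) * of_real (\<Sum>i<n. (cmod (f l i))\<^sup>2))"
proof -
  have fin: "finite S" using S by (simp add: spectral_sum_def)
  have orth: "(\<Sum>i<n. f l i * cnj (f m i)) = 0" if lm: "l \<in> S" "m \<in> S" "l \<noteq> m" for l m
  proof -
    have "of_real l * (\<Sum>i<n. f l i * cnj (f m i)) = of_real m * (\<Sum>i<n. f l i * cnj (f m i))"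
      using mvmult_adjoint[of a n "f l" "f m", OF sym] S lm
      by (simp add: spectral_sum_def sum_distrib_left mult_ac)
    then show ?thesis using lm by simp
  qed
  have "(\<Sum>i<n. (\<Sum>l\<in>S. b l * f l i) * cnj (\<Sum>l\<in>S. c l * f l i))
      = (\<Sum>i<n. \<Sum>l\<in>S. \<Sum>m\<in>S. b l * cnj (c m) * (f l i * cnj (f m i)))"
    by (simp add: sum_product mult_ac)
  also have "\<dots> = (\<Sum>l\<in>S. \<Sum>m\<in>S. b l * cnj (c m) * (\<Sum>i<n. f l i * cnj (f m i)))"
    unfolding sum_distrib_left by (subst sum.swap, intro sum.cong refl, subst sum.swap) (rule refl)
  also have "\<dots> = (\<Sum>l\<in>S. \<Sum>m\<in>S. if m = l then b l * cnj (c l) * (\<Sum>i<n. f l i * cnj (f l i)) else 0)"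
    using orth by (intro sum.cong refl) auto
  also have "\<dots> = (\<Sum>l\<in>S. b l * cnj (c l) * (\<Sum>i<n. f l i * cnj (f l i)))"
    using fin by simp
  finally show ?thesis by (simp only: of_real_sum complex_norm_square)
qed

text \<open>As \<open>a\<close> and \<open>l\<close> are real, the real and imaginary parts solve
  the eigenvalue equation separately, and one of them is nonzero.\<close>

lemma spectral_real_eigenvector:
  assumes S: "spectral_sum n a v S f" and l: "l \<in> S" "0 < (\<Sum>i<n. (cmod (f l i))\<^sup>2)"
  obtains u :: "nat \<Rightarrow> real" and i where "\<And>i. i < n \<Longrightarrow> (\<Sum>j<n. a i j * u j) = l * u i" "i < n" "u i \<noteq> 0"
proof -
  have "\<exists>i<n. f l i \<noteq> 0"
  proof (rule ccontr)
    assume "\<not> ?thesis"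
    then have "(\<Sum>i<n. (cmod (f l i))\<^sup>2) = 0" by (intro sum.neutral) auto
    then show False using l(2) by simp
  qed
  then obtain i where i: "i < n" "f l i \<noteq> 0" by blast
  have eig: "mvmult n a (f l) j = of_real l * f l j" if "j < n" for j
    using S l that by (simp add: spectral_sum_def)
  have "(\<Sum>k<n. a j k * Re (f l k)) = l * Re (f l j)" "(\<Sum>k<n. a j k * Im (f l k)) = l * Im (f l j)"
    if "j < n" for j
    using arg_cong[OF eig[OF that], of Re] arg_cong[OF eig[OF that], of Im]
    by (simp_all add: mvmult_def)
  moreover have "Re (f l i) \<noteq> 0 \<or> Im (f l i) \<noteq> 0" using i(2) by (simp add: complex_eq_iff)
  ultimately show ?thesis
    using i(1) that[of "\<lambda>k. Re (f l k)" i] that[of "\<lambda>k. Im (f l k)" i] by blast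
qed

text \<open>Trace moments only bound eigenvalues. Expanding \<open>w\<close> orthogonally extends
  the bound to arbitrary test vectors, which the isolation of the outlier requires.\<close>

lemma symmetric_quadratic_form_le:
  fixes w :: "nat \<Rightarrow> real"
  assumes sym: "\<And>i j. a i j = a j i"
    and bound: "\<And>l u i. (\<And>i. i < n \<Longrightarrow> (\<Sum>j<n. a i j * u j) = l * u i) \<Longrightarrow> i < n \<Longrightarrow> u i \<noteq> 0 \<Longrightarrow> \<bar>l\<bar> \<le> \<theta>"
  shows "\<bar>\<Sum>i<n. \<Sum>j<n. w i * a i j * w j\<bar> \<le> \<theta> * (\<Sum>i<n. (w i)\<^sup>2)"
proof -
  obtain S f where S: "spectral_sum n a (\<lambda>i. of_real (w i)) S f" by (rule spectral_decomposition[where a = a, OF sym])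
  define N where "N = (\<lambda>l. \<Sum>i<n. (cmod (f l i))\<^sup>2)"
  have w: "of_real (w i) = (\<Sum>l\<in>S. f l i)" if "i < n" for i using S that by (simp add: spectral_sum_def)
  have aw: "of_real (\<Sum>j<n. a i j * w j) = (\<Sum>l\<in>S. of_real l * f l i)" if "i < n" for i
  proof -
    have "of_real (\<Sum>j<n. a i j * w j) = mvmult n a (\<lambda>i. \<Sum>l\<in>S. f l i) i"
      by (simp add: mvmult_def w)
    then show ?thesis using S that by (simp add: mvmult_sum spectral_sum_def)
  qed
  have "complex_of_real (\<Sum>i<n. (w i)\<^sup>2) = (\<Sum>i<n. (\<Sum>l\<in>S. 1 * f l i) * cnj (\<Sum>l\<in>S. 1 * f l i))"
    unfolding of_real_sum by (intro sum.cong refl) (simp add: w[symmetric] power2_eq_square del: cnj_sum)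
  also have "\<dots> = of_real (\<Sum>l\<in>S. N l)"
    by (subst spectral_inner[where a = a, OF sym S]) (simp add: N_def)
  finally have 1: "(\<Sum>i<n. (w i)\<^sup>2) = (\<Sum>l\<in>S. N l)" by (simp only: of_real_eq_iff)
  have "complex_of_real (\<Sum>i<n. \<Sum>j<n. w i * a i j * w j)
      = (\<Sum>i<n. of_real (\<Sum>j<n. a i j * w j) * cnj (of_real (w i)))"
    by (simp add: sum_distrib_left mult_ac)
  also have "\<dots> = (\<Sum>i<n. (\<Sum>l\<in>S. of_real l * f l i) * cnj (\<Sum>l\<in>S. 1 * f l i))"
    by (intro sum.cong refl) (simp only: aw w lessThan_iff mult_1)
  also have "\<dots> = of_real (\<Sum>l\<in>S. l * N l)"
    by (subst spectral_inner[where a = a, OF sym S]) (simp add: N_def)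
  finally have 2: "(\<Sum>i<n. \<Sum>j<n. w i * a i j * w j) = (\<Sum>l\<in>S. l * N l)" by (simp only: of_real_eq_iff)
  have "\<bar>\<Sum>l\<in>S. l * N l\<bar> \<le> (\<Sum>l\<in>S. \<bar>l * N l\<bar>)" by (rule sum_abs)
  also have "\<dots> \<le> (\<Sum>l\<in>S. \<theta> * N l)"
  proof (rule sum_mono)
    fix l assume l: "l \<in> S"
    have N0: "0 \<le> N l" by (simp add: N_def sum_nonneg)
    show "\<bar>l * N l\<bar> \<le> \<theta> * N l"
    proof (cases "N l = 0")
      case False
      then have "0 < N l" using N0 by simp
      then have "\<bar>l\<bar> \<le> \<theta>" unfolding N_def
        using spectral_real_eigenvector[OF S l] bound by metis
      then show ?thesis using N0 by (simp add: abs_mult mult_right_mono)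
    qed simp
  qed
  finally show ?thesis unfolding 1 2 by (simp add: sum_distrib_left)
qed

text \<open>Self-adjointness makes \<open>c - z A\<close> a normal matrix, so an approximate null vector of it
  comes from an approximate zero of \<open>c - z \<lambda>\<close> on the spectrum of \<open>A\<close>.\<close>
lemma eigenvalue_near_pencil:
  fixes c z :: complex and v :: "nat \<Rightarrow> complex"
  assumes sym: "\<And>i j. a i j = a j i" and d: "0 \<le> d"
    and v: "i0 < n" "v i0 \<noteq> 0"
    and small: "\<And>i. i < n \<Longrightarrow> cmod (c * v i - z * mvmult n a v i) \<le> d * cmod (v i)"
  obtains l u i where "\<And>i. i < n \<Longrightarrow> (\<Sum>j<n. a i j * u j) = l * u i" "i < n" "u i \<noteq> 0"
    "cmod (c - z * of_real l) \<le> d"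
proof -
  obtain S f where S: "spectral_sum n a v S f" by (rule spectral_decomposition[where a = a, OF sym])
  define N where "N = (\<lambda>l. \<Sum>i<n. (cmod (f l i))\<^sup>2)"
  have N0: "0 \<le> N l" for l by (simp add: N_def sum_nonneg)
  have vs: "v i = (\<Sum>l\<in>S. f l i)" if "i < n" for i using S that by (simp add: spectral_sum_def)
  have avs: "c * v i - z * mvmult n a v i = (\<Sum>l\<in>S. (c - z * of_real l) * f l i)" if "i < n" for i
  proof -
    have "mvmult n a v i = mvmult n a (\<lambda>i. \<Sum>l\<in>S. f l i) i" by (rule mvmult_cong) (rule vs)
    also have "\<dots> = (\<Sum>l\<in>S. of_real l * f l i)" using S that by (simp add: mvmult_sum spectral_sum_def)
    finally show ?thesis using vs[OF that]
      by (simp add: sum_distrib_left algebra_simps flip: sum_subtractf)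
  qed
  have "complex_of_real (\<Sum>i<n. (cmod (v i))\<^sup>2) = (\<Sum>i<n. (\<Sum>l\<in>S. 1 * f l i) * cnj (\<Sum>l\<in>S. 1 * f l i))"
    unfolding of_real_sum by (intro sum.cong refl) (simp only: mult_1 vs[symmetric] lessThan_iff complex_norm_square)
  also have "\<dots> = of_real (\<Sum>l\<in>S. N l)"
    by (subst spectral_inner[where a = a, OF sym S]) (simp add: N_def)
  finally have 1: "(\<Sum>i<n. (cmod (v i))\<^sup>2) = (\<Sum>l\<in>S. N l)" by (simp only: of_real_eq_iff)
  have "complex_of_real (\<Sum>i<n. (cmod (c * v i - z * mvmult n a v i))\<^sup>2)
      = (\<Sum>i<n. (\<Sum>l\<in>S. (c - z * of_real l) * f l i) * cnj (\<Sum>l\<in>S. (c - z * of_real l) * f l i))"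
    unfolding of_real_sum by (intro sum.cong refl) (simp only: avs lessThan_iff complex_norm_square)
  also have "\<dots> = of_real (\<Sum>l\<in>S. (cmod (c - z * of_real l))\<^sup>2 * N l)"
    by (subst spectral_inner[where a = a, OF sym S]) (simp only: N_def of_real_sum of_real_mult complex_norm_square)
  finally have 2: "(\<Sum>i<n. (cmod (c * v i - z * mvmult n a v i))\<^sup>2)
      = (\<Sum>l\<in>S. (cmod (c - z * of_real l))\<^sup>2 * N l)" by (simp only: of_real_eq_iff)
  \<comment> \<open>Otherwise every nonzero component would be stretched by more than
    \<open>d\<close>, and by orthogonality \<open>v\<close> as well.\<close>
  have "\<exists>l\<in>S. 0 < N l \<and> cmod (c - z * of_real l) \<le> d"
  proof (rule ccontr)
    assume *: "\<not> ?thesis"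
    have "0 < (cmod (v i0))\<^sup>2" using v by simp
    also have "\<dots> \<le> (\<Sum>i<n. (cmod (v i))\<^sup>2)" using v by (intro member_le_sum) auto
    finally have pos: "0 < (\<Sum>l\<in>S. N l)" unfolding 1 .
    then obtain m where m: "m \<in> S" "0 < N m" using N0 by (metis less_le not_le sum_nonpos)
    have "(\<Sum>l\<in>S. d\<^sup>2 * N l) < (\<Sum>l\<in>S. (cmod (c - z * of_real l))\<^sup>2 * N l)"
    proof (rule sum_strict_mono_ex1)
      show "finite S" using S by (simp add: spectral_sum_def)
      have le: "d\<^sup>2 * N l < (cmod (c - z * of_real l))\<^sup>2 * N l" if "l \<in> S" "0 < N l" for l
      proof -
        have "d < cmod (c - z * of_real l)" using * that by force
        then show ?thesis using that d by (intro mult_strict_right_mono power_strict_mono) auto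
      qed
      show "\<forall>l\<in>S. d\<^sup>2 * N l \<le> (cmod (c - z * of_real l))\<^sup>2 * N l"
      proof
        fix l assume "l \<in> S"
        then show "d\<^sup>2 * N l \<le> (cmod (c - z * of_real l))\<^sup>2 * N l"
          using le[of l] N0[of l] by (cases "N l = 0") auto
      qed
      show "\<exists>l\<in>S. d\<^sup>2 * N l < (cmod (c - z * of_real l))\<^sup>2 * N l" using le m by blast
    qed
    also have "\<dots> \<le> (\<Sum>i<n. (d * cmod (v i))\<^sup>2)"
      unfolding 2[symmetric] using small by (intro sum_mono power_mono) auto
    also have "\<dots> = (\<Sum>l\<in>S. d\<^sup>2 * N l)"
      by (simp add: power_mult_distrib flip: sum_distrib_left 1)
    finally show False by simp
  qed
  then obtain l where l: "l \<in> S" "0 < N l" "cmod (c - z * of_real l) \<le> d" by blast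
  from spectral_real_eigenvector[OF S l(1) l(2)[unfolded N_def]] show ?thesis
    using that l(3) by metis
qed

section \<open>Perturbation of the non-backtracking spectrum\<close>

lemma quadratic_form_offdiag:
  fixes w :: "nat \<Rightarrow> real"
  assumes a: "\<And>i j. a i j = x i j + (if i = j then 0 else p)"
  shows "(\<Sum>i<n. \<Sum>j<n. w i * a i j * w j)
    = (\<Sum>i<n. \<Sum>j<n. w i * x i j * w j) + p * (\<Sum>i<n. w i)\<^sup>2 - p * (\<Sum>i<n. (w i)\<^sup>2)"
proof -
  have "(\<Sum>i<n. \<Sum>j<n. w i * a i j * w j)
      = (\<Sum>i<n. \<Sum>j<n. w i * x i j * w j + p * (w i * w j) - (if j = i then p * (w i)\<^sup>2 else 0))"
    by (intro sum.cong refl) (auto simp: a algebra_simps power2_eq_square)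
  also have "\<dots> = (\<Sum>i<n. \<Sum>j<n. w i * x i j * w j) + (\<Sum>i<n. \<Sum>j<n. p * (w i * w j))
      - (\<Sum>i<n. p * (w i)\<^sup>2)"
    by (simp add: sum.distrib sum_subtractf)
  also have "(\<Sum>i<n. \<Sum>j<n. p * (w i * w j)) = p * (\<Sum>i<n. w i)\<^sup>2"
  proof -
    have "(\<Sum>i<n. \<Sum>j<n. p * (w i * w j)) = p * (\<Sum>i<n. \<Sum>j<n. w i * w j)"
      by (simp only: sum_distrib_left)
    then show ?thesis by (simp only: power2_eq_square sum_product)
  qed
  finally show ?thesis by (simp add: sum_distrib_left)
qed

text \<open>
  If \<open>u\<close> is an eigenvector with a too large eigenvalue below \<open>L\<close>, then the quadratic form of
  \<open>x\<close> exceeds the bound at the combination of \<open>u\<close> and the all-ones vector which has sum zero.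
\<close>
lemma bulk_or_outlier:
  fixes x a :: "nat \<Rightarrow> nat \<Rightarrow> real" and u :: "nat \<Rightarrow> real"
  assumes a: "\<And>i j. a i j = x i j + (if i = j then 0 else p)" and sym: "\<And>i j. a i j = a j i"
    and p: "0 \<le> p"
    and quad: "\<And>w. \<bar>\<Sum>i<n. \<Sum>j<n. w i * x i j * w j\<bar> \<le> \<theta> * (\<Sum>i<n. (w i)\<^sup>2)"
    and eig: "\<And>i. i < n \<Longrightarrow> (\<Sum>j<n. a i j * u j) = l * u i" and i0: "i0 < n" "u i0 \<noteq> 0"
    and L: "L * n \<le> (\<Sum>i<n. \<Sum>j<n. a i j)"
  shows "\<bar>l\<bar> \<le> \<theta> + p \<or> L \<le> l"
proof (rule ccontr)
  assume "\<not> ?thesis"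
  then have l: "l < - (\<theta> + p) \<or> \<theta> + p < l" "l < L" by auto
  define N where "N = (\<Sum>i<n. (u i)\<^sup>2)"
  define s where "s = (\<Sum>i<n. u i)"
  define R where "R = (\<Sum>i<n. \<Sum>j<n. a i j)"
  have n: "0 < n" using i0 by simp
  have "0 < (u i0)\<^sup>2" using i0 by simp
  also have "\<dots> \<le> N" unfolding N_def using i0 by (intro member_le_sum) auto
  finally have N: "0 < N" .
  have qu: "(\<Sum>i<n. \<Sum>j<n. u i * a i j * u j) = l * N"
  proof -
    have "(\<Sum>i<n. \<Sum>j<n. u i * a i j * u j) = (\<Sum>i<n. u i * (\<Sum>j<n. a i j * u j))"
      by (simp add: sum_distrib_left mult.assoc)
    also have "\<dots> = (\<Sum>i<n. l * (u i)\<^sup>2)"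
      by (intro sum.cong refl) (simp add: eig power2_eq_square)
    finally show ?thesis by (simp add: N_def sum_distrib_left)
  qed
  from l(1) show False
  proof
    \<comment> \<open>The rank-one part is positive semidefinite, so for negative \<open>l\<close>
      the vector \<open>u\<close> itself is a test vector: the term with \<open>s\<^sup>2\<close>
      has a favourable sign.\<close>
    assume neg: "l < - (\<theta> + p)"
    have "(\<Sum>i<n. \<Sum>j<n. u i * x i j * u j) = l * N - p * s\<^sup>2 + p * N"
      using quadratic_form_offdiag[where a = a and x = x and p = p and n = n and w = u, OF a] unfolding qu s_def N_def by simp
    also have "\<dots> \<le> (l + p) * N" using p by (simp add: algebra_simps)
    also have "\<dots> < - \<theta> * N" using neg N by (intro mult_strict_right_mono) auto
    finally show False using quad[of u] unfolding N_def by linarith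
  next
    assume pos: "\<theta> + p < l"
    \<comment> \<open>This is \<open>n\<close> times the projection of \<open>u\<close> orthogonal
      to the all-ones vector; the rank-one part vanishes on it.\<close>
    define w where "w = (\<lambda>i. real n * u i - s)"
    define r where "r = (\<lambda>i. \<Sum>j<n. a i j)"
    have sw: "(\<Sum>i<n. w i) = 0"
      by (simp add: w_def sum_subtractf s_def flip: sum_distrib_left)
    have W: "(\<Sum>i<n. (w i)\<^sup>2) = real n * (real n * N - s\<^sup>2)"
    proof -
      have "(\<Sum>i<n. (w i)\<^sup>2) = (\<Sum>i<n. (real n)\<^sup>2 * (u i)\<^sup>2 - 2 * real n * s * u i + s\<^sup>2)"
        by (intro sum.cong refl) (simp add: w_def power2_eq_square algebra_simps)
      also have "\<dots> = (real n)\<^sup>2 * N - 2 * real n * s * s + real n * s\<^sup>2"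
        by (simp add: sum.distrib sum_subtractf N_def s_def flip: sum_distrib_left)
      finally show ?thesis by (simp add: power2_eq_square algebra_simps)
    qed
    have aw: "(\<Sum>j<n. a i j * w j) = real n * l * u i - s * r i" if "i < n" for i
    proof -
      have "(\<Sum>j<n. a i j * w j) = (\<Sum>j<n. real n * (a i j * u j) - s * a i j)"
        by (intro sum.cong refl) (simp add: w_def algebra_simps)
      then show ?thesis using eig[OF that] by (simp add: sum_subtractf r_def flip: sum_distrib_left)
    qed
    have ur: "(\<Sum>i<n. u i * r i) = l * s"
    proof -
      have "(\<Sum>i<n. u i * r i) = (\<Sum>i<n. \<Sum>j<n. a j i * u i)"
        unfolding r_def sum_distrib_left by (intro sum.cong refl) (metis sym mult.commute)
      also have "\<dots> = (\<Sum>j<n. \<Sum>i<n. a j i * u i)" by (rule sum.swap)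
      also have "\<dots> = l * s" using eig by (simp add: s_def sum_distrib_left)
      finally show ?thesis .
    qed
    have "(\<Sum>i<n. \<Sum>j<n. w i * a i j * w j) = (\<Sum>i<n. w i * (real n * l * u i - s * r i))"
      using aw by (simp add: mult.assoc flip: sum_distrib_left)
    also have "\<dots> = (\<Sum>i<n. (real n)\<^sup>2 * l * (u i)\<^sup>2 - real n * s * (u i * r i) - real n * s * l * u i + s\<^sup>2 * r i)"
      by (intro sum.cong refl) (simp add: w_def power2_eq_square algebra_simps)
    also have "\<dots> = (real n)\<^sup>2 * l * N - real n * s * (l * s) - real n * s * l * s + s\<^sup>2 * R"
      by (simp add: sum.distrib sum_subtractf N_def ur[symmetric] flip: sum_distrib_left)
         (simp add: s_def R_def r_def)
    finally have "(\<Sum>i<n. \<Sum>j<n. w i * x i j * w j)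
        = (real n)\<^sup>2 * l * N - real n * s * (l * s) - real n * s * l * s + s\<^sup>2 * R
          + p * (real n * (real n * N - s\<^sup>2))"
      using quadratic_form_offdiag[where a = a and x = x and p = p and n = n and w = w, OF a] unfolding sw W by simp
    also have "\<dots> = (l + p) * (real n * (real n * N - s\<^sup>2)) + s\<^sup>2 * (R - real n * l)"
      by (simp add: power2_eq_square algebra_simps)
    finally have "(l + p) * (real n * (real n * N - s\<^sup>2)) + s\<^sup>2 * (R - real n * l)
        \<le> \<theta> * (real n * (real n * N - s\<^sup>2))"
      using quad[of w] unfolding W by linarith
    \<comment> \<open>Both summands are nonnegative, the second because \<open>l < L\<close> lies
      below the average row sum. Hence \<open>s = 0\<close>, but then the first summand is strictly
      positive.\<close>
    then have le: "(l + p - \<theta>) * (real n * (real n * N - s\<^sup>2)) + s\<^sup>2 * (R - real n * l) \<le> 0"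
      by (simp add: algebra_simps)
    have W0: "0 \<le> real n * (real n * N - s\<^sup>2)" unfolding W[symmetric] by (simp add: sum_nonneg)
    have "real n * l < real n * L" using l(2) n by simp
    also have "\<dots> \<le> R" using L by (simp add: R_def mult.commute)
    finally have Rl: "0 < R - real n * l" by simp
    have 1: "0 \<le> (l + p - \<theta>) * (real n * (real n * N - s\<^sup>2))"
      by (rule mult_nonneg_nonneg[OF _ W0]) (use pos p in simp)
    have "s\<^sup>2 * (R - real n * l) \<le> 0" using le 1 by linarith
    then have "s\<^sup>2 \<le> 0" using Rl by (simp add: mult_le_0_iff)
    then have s0: "s = 0" by simp
    then have "(l + p - \<theta>) * (real n * (real n * N)) \<le> 0" using le by simp
    moreover have "0 < (l + p - \<theta>) * (real n * (real n * N))"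
      using pos p n N by (intro mult_pos_pos) auto
    ultimately show False by simp
  qed
qed

text \<open>The product of the distances from \<open>\<zeta>\<close> to the two roots is the modulus
  of the residual. The roots are at least \<open>sqrt p\<close> apart, so one of them is at distance
  at least \<open>sqrt p / 2\<close>, and the other one has to be close.\<close>

lemma quadratic_root_near:
  fixes \<zeta> :: complex and l p \<delta> :: real
  assumes small: "cmod (\<zeta>\<^sup>2 + 1 - \<zeta> * of_real l) \<le> \<delta>" and p: "0 < p" "p \<le> \<bar>l\<^sup>2 - 4\<bar>"
  obtains \<mu> where "\<mu>\<^sup>2 - of_real l * \<mu> + 1 = 0" "dist \<zeta> \<mu> \<le> 2 * \<delta> / sqrt p"
proof -
  define g where "g = csqrt (of_real (l\<^sup>2 - 4))"
  define m1 where "m1 = (of_real l + g) / 2"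
  define m2 where "m2 = (of_real l - g) / 2"
  define L where "L = complex_of_real l"
  have g2: "g\<^sup>2 = L\<^sup>2 - 4" by (simp add: g_def L_def)
  have Lg: "complex_of_real l = m1 + m2" "g = m1 - m2" by (simp_all add: m1_def m2_def field_simps)
  have "4 * (m1 * m2) = L\<^sup>2 - g\<^sup>2" unfolding L_def Lg by (simp add: power2_eq_square algebra_simps)
  then have m12: "m1 * m2 = 1" "m2 * m1 = 1" using g2 by (simp_all add: mult.commute)
  have roots: "m1\<^sup>2 - of_real l * m1 + 1 = 0" "m2\<^sup>2 - of_real l * m2 + 1 = 0"
    unfolding Lg(1) by (simp_all add: m12 power2_eq_square algebra_simps)
  have prod: "(\<zeta> - m1) * (\<zeta> - m2) = \<zeta>\<^sup>2 + 1 - \<zeta> * of_real l"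
    unfolding Lg(1) by (simp add: m12 power2_eq_square algebra_simps)
  have "cmod g = sqrt \<bar>l\<^sup>2 - 4\<bar>" unfolding g_def by (simp add: norm_csqrt flip: of_real_diff)
  then have g: "sqrt p \<le> cmod g" using p by simp
  have sp: "0 < sqrt p" using p by simp
  have "g = (\<zeta> - m2) - (\<zeta> - m1)" by (simp add: Lg(2))
  then have "cmod g \<le> cmod (\<zeta> - m2) + cmod (\<zeta> - m1)" by (metis norm_triangle_ineq4)
  then consider "sqrt p / 2 \<le> cmod (\<zeta> - m2)" | "sqrt p / 2 \<le> cmod (\<zeta> - m1)" using g by linarith
  then show ?thesis
  proof cases
    case 1
    have "sqrt p / 2 * cmod (\<zeta> - m1) \<le> cmod (\<zeta> - m2) * cmod (\<zeta> - m1)"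
      using 1 by (rule mult_right_mono) simp
    also have "\<dots> \<le> \<delta>" using small prod by (metis mult.commute norm_mult)
    finally show ?thesis using sp roots by (intro that[of m1]) (auto simp: dist_norm field_simps)
  next
    case 2
    have "sqrt p / 2 * cmod (\<zeta> - m2) \<le> cmod (\<zeta> - m1) * cmod (\<zeta> - m2)"
      using 2 by (rule mult_right_mono) simp
    also have "\<dots> \<le> \<delta>" using small prod by (metis norm_mult)
    finally show ?thesis using sp roots by (intro that[of m2]) (auto simp: dist_norm field_simps)
  qed
qed

section \<open>The block matrices as linearised quadratic eigenvalue problems\<close>

lemma sum_lessThan_add: "(\<Sum>j<n + m. f j) = (\<Sum>j<n. f j) + (\<Sum>j<m. f (n + j))"
  for f :: "nat \<Rightarrow> 'a :: comm_monoid_add"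
  by (induction m) (simp_all add: add.assoc)

lemma companion_mult_vec:
  fixes A C :: "real mat" and c :: real
  assumes A: "A \<in> carrier_mat n n" and C: "C \<in> carrier_mat n n" and w: "w \<in> carrier_vec (n + n)"
    and i: "i < n"
  defines "M \<equiv> map_mat complex_of_real (c \<cdot>\<^sub>m four_block_mat A C (1\<^sub>m n) (0\<^sub>m n n))"
  shows "(M *\<^sub>v w) $ i = of_real c * ((\<Sum>j<n. of_real (A $$ (i, j)) * w $ j)
      + (\<Sum>j<n. of_real (C $$ (i, j)) * w $ (n + j)))"
    and "(M *\<^sub>v w) $ (n + i) = of_real c * w $ i"
proof -
  have M: "M \<in> carrier_mat (n + n) (n + n)" using A C by (simp add: M_def)
  have row: "(M *\<^sub>v w) $ k = (\<Sum>j<n. M $$ (k, j) * w $ j) + (\<Sum>j<n. M $$ (k, n + j) * w $ (n + j))"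
    if "k < n + n" for k
    using that M w by (simp add: scalar_prod_def atLeast0LessThan sum_lessThan_add)
  have e: "M $$ (i, j) = of_real c * of_real (A $$ (i, j))" "M $$ (i, n + j) = of_real c * of_real (C $$ (i, j))"
    "M $$ (n + i, j) = (if i = j then of_real c else 0)" "M $$ (n + i, n + j) = 0" if "j < n" for j
    using that i A C by (auto simp: M_def)
  show "(M *\<^sub>v w) $ i = of_real c * ((\<Sum>j<n. of_real (A $$ (i, j)) * w $ j)
      + (\<Sum>j<n. of_real (C $$ (i, j)) * w $ (n + j)))"
    using row[of i] i e by (simp add: distrib_left sum_distrib_left mult.assoc)
  have "(M *\<^sub>v w) $ (n + i) = (\<Sum>j<n. if i = j then of_real c * w $ j else 0)"
    using row[of "n + i"] i e by (simp add: if_distrib[of "\<lambda>t. t * _"] cong: if_cong)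
  then show "(M *\<^sub>v w) $ (n + i) = of_real c * w $ i" using i by simp
qed

text \<open>The lower blocks force an eigenvector to have the form \<open>(c z v, v)\<close>; the
  upper ones then give a quadratic equation for \<open>v\<close>.\<close>

lemma companion_eigenvalue_iff:
  fixes A C :: "real mat" and c :: real and z :: complex
  assumes A: "A \<in> carrier_mat n n" and C: "C \<in> carrier_mat n n" and c: "0 < c"
  shows "eigenvalue (map_mat complex_of_real ((1 / c) \<cdot>\<^sub>m four_block_mat A C (1\<^sub>m n) (0\<^sub>m n n))) z \<longleftrightarrow>
    (\<exists>v. (\<exists>i<n. v i \<noteq> 0) \<and> (\<forall>i<n. (of_real c * z)\<^sup>2 * v i =
      of_real c * z * (\<Sum>j<n. of_real (A $$ (i, j)) * v j) + (\<Sum>j<n. of_real (C $$ (i, j)) * v j)))"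
    (is "eigenvalue ?M z \<longleftrightarrow> ?R")
proof
  have M: "dim_row ?M = n + n" using A C by simp
  let ?c = "complex_of_real c"
  {
    assume "eigenvalue ?M z"
    then obtain w where w: "w \<in> carrier_vec (n + n)" "w \<noteq> 0\<^sub>v (n + n)" "?M *\<^sub>v w = z \<cdot>\<^sub>v w"
      unfolding eigenvalue_def eigenvector_def M by blast
    define v where "v = (\<lambda>i. w $ (n + i))"
    have wi: "w $ i = ?c * z * v i" if "i < n" for i
    proof -
      have "of_real (1 / c) * w $ i = z * v i"
        using companion_mult_vec(2)[OF A C w(1) that, of "1 / c"] w that by (simp add: v_def)
      then show ?thesis using c by (simp add: field_simps)
    qed
    have "\<exists>i<n. v i \<noteq> 0"
    proof (rule ccontr)
      assume *: "\<not> ?thesis"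
      have "w = 0\<^sub>v (n + n)"
      proof (rule eq_vecI)
        fix k assume "k < dim_vec (0\<^sub>v (n + n) :: complex vec)"
        then have k: "k < n + n" by simp
        show "w $ k = 0\<^sub>v (n + n) $ k"
        proof (cases "k < n")
          case True
          then show ?thesis using wi * k by simp
        next
          case False
          then have "w $ k = v (k - n)" "k - n < n" using k by (simp_all add: v_def)
          then show ?thesis using * k by simp
        qed
      qed (use w in simp)
      then show False using w by simp
    qed
    moreover have "(?c * z)\<^sup>2 * v i = ?c * z * (\<Sum>j<n. of_real (A $$ (i, j)) * v j)
        + (\<Sum>j<n. of_real (C $$ (i, j)) * v j)" if i: "i < n" for i
    proof -
      have "(\<Sum>j<n. of_real (A $$ (i, j)) * w $ j) = ?c * z * (\<Sum>j<n. of_real (A $$ (i, j)) * v j)"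
        by (simp add: wi sum_distrib_left mult_ac)
      then have "of_real (1 / c) * (?c * z * (\<Sum>j<n. of_real (A $$ (i, j)) * v j)
          + (\<Sum>j<n. of_real (C $$ (i, j)) * v j)) = z * (?c * z * v i)"
        using companion_mult_vec(1)[OF A C w(1) i, of "1 / c"] w i wi[OF i] by (simp add: v_def)
      then show ?thesis using c by (simp add: field_simps power2_eq_square)
    qed
    ultimately show ?R by blast
  }
  {
    assume ?R
    then obtain v where v: "\<exists>i<n. v i \<noteq> 0" "\<And>i. i < n \<Longrightarrow> (?c * z)\<^sup>2 * v i =
      ?c * z * (\<Sum>j<n. of_real (A $$ (i, j)) * v j) + (\<Sum>j<n. of_real (C $$ (i, j)) * v j)" by blast
    define w where "w = Matrix.vec (n + n) (\<lambda>k. if k < n then ?c * z * v k else v (k - n))"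
    have w: "w \<in> carrier_vec (n + n)" by (simp add: w_def)
    have wi: "w $ i = ?c * z * v i" "w $ (n + i) = v i" if "i < n" for i using that by (simp_all add: w_def)
    have "w \<noteq> 0\<^sub>v (n + n)"
    proof
      assume w0: "w = 0\<^sub>v (n + n)"
      obtain i where "i < n" "v i \<noteq> 0" using v(1) by blast
      then show False using wi(2)[of i] unfolding w0 by simp
    qed
    moreover have "?M *\<^sub>v w = z \<cdot>\<^sub>v w"
    proof (rule eq_vecI)
      fix k assume "k < dim_vec (z \<cdot>\<^sub>v w)"
      then have k: "k < n + n" by (simp add: w_def)
      show "(?M *\<^sub>v w) $ k = (z \<cdot>\<^sub>v w) $ k"
      proof (cases "k < n")
        case True
        have "(\<Sum>j<n. of_real (A $$ (k, j)) * w $ j) = ?c * z * (\<Sum>j<n. of_real (A $$ (k, j)) * v j)"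
          by (simp add: wi sum_distrib_left mult_ac)
        then have "(?M *\<^sub>v w) $ k = of_real (1 / c) * ((?c * z)\<^sup>2 * v k)"
          using companion_mult_vec(1)[OF A C w True, of "1 / c"] v(2)[OF True] wi(2) by simp
        then show ?thesis using c k w wi(1)[OF True] by (simp add: field_simps power2_eq_square)
      next
        case False
        then obtain i where i: "k = n + i" "i < n" using k by (metis add_less_cancel_left le_Suc_ex not_less)
        then show ?thesis using companion_mult_vec(2)[OF A C w i(2), of "1 / c"] c w wi k by simp
      qed
    qed (use M w in simp)
    ultimately show "eigenvalue ?M z"
      unfolding eigenvalue_def eigenvector_def M using w by blast
  }
qed

text \<open>Symmetric for all indices, not only those below \<open>n\<close>, because the spectral
  lemmas assume symmetry without bounds.\<close>

definition adj :: "edge_config \<Rightarrow> nat \<Rightarrow> nat \<Rightarrow> real" where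
  "adj E i j = (if i = j then 0 else of_bool (E (min i j, max i j)))"

lemma adj_sym: "adj E i j = adj E j i"
  by (simp add: adj_def min.commute max.commute)

lemma adj_mat_index: "i < n \<Longrightarrow> j < n \<Longrightarrow> adj_mat n E $$ (i, j) = adj E i j"
  by (auto simp: adj_mat_def adj_def min_def max_def)

lemma adj_eq_centred: "adj E i j = centred p E i j + (if i = j then 0 else p)"
  by (simp add: adj_def centred_def)

lemma scaled_eigenvalue_nb_matD:
  assumes "0 < alpha n p" "scaled_eigenvalue n p (nb_mat n E) z"
  defines "Z \<equiv> of_real (sqrt (alpha n p)) * z"
  obtains v i0 where "i0 < n" "v i0 \<noteq> 0"
    "\<And>i. i < n \<Longrightarrow> Z\<^sup>2 * v i = Z * mvmult n (adj E) v i + of_real (1 - (\<Sum>k<n. adj E i k)) * v i"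
proof -
  have A: "adj_mat n E \<in> carrier_mat n n" by (simp add: adj_mat_def)
  have C: "1\<^sub>m n - deg_mat n E \<in> carrier_mat n n"
    by (intro minus_carrier_mat) (simp add: deg_mat_def)
  obtain v i0 where v: "i0 < n" "v i0 \<noteq> 0" "\<And>i. i < n \<Longrightarrow> Z\<^sup>2 * v i =
      Z * (\<Sum>j<n. of_real (adj_mat n E $$ (i, j)) * v j)
      + (\<Sum>j<n. of_real ((1\<^sub>m n - deg_mat n E) $$ (i, j)) * v j)"
    using assms(2) companion_eigenvalue_iff[OF A C, of "sqrt (alpha n p)" z] assms(1)
    unfolding scaled_eigenvalue_def nb_mat_def Z_def by auto
  have "Z\<^sup>2 * v i = Z * mvmult n (adj E) v i + of_real (1 - (\<Sum>k<n. adj E i k)) * v i" if i: "i < n" for i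
  proof -
    have "(\<Sum>j<n. of_real ((1\<^sub>m n - deg_mat n E) $$ (i, j)) * v j)
        = (\<Sum>j<n. if i = j then of_real (1 - (\<Sum>k<n. adj E i k)) * v j else 0)"
      using i by (intro sum.cong) (auto simp: deg_mat_def adj_mat_index)
    also have "\<dots> = of_real (1 - (\<Sum>k<n. adj E i k)) * v i" using i by simp
    finally show ?thesis using v(3)[OF i] i by (simp add: mvmult_def adj_mat_index)
  qed
  then show ?thesis using that v by blast
qed

text \<open>With the scalar constant term \<open>- alpha n p\<close> the quadratic problem decouples
  along eigenvectors of \<open>A\<close>, so every root of the scalar quadratic is attained.\<close>

lemma scaled_eigenvalue_nb_mat0I:
  assumes al: "0 < alpha n p" and p: "0 \<le> p" "p \<le> 1"
    and u: "\<And>i. i < n \<Longrightarrow> (\<Sum>j<n. adj E i j * u j) = l * u i" "i0 < n" "u i0 \<noteq> 0"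
    and \<mu>: "\<mu>\<^sup>2 - of_real (l / sqrt (alpha n p)) * \<mu> + 1 = 0"
  shows "scaled_eigenvalue n p (nb_mat0 n p E) \<mu>"
proof -
  let ?a = "alpha n p"
  let ?c = "complex_of_real (sqrt ?a)"
  have A: "adj_mat n E \<in> carrier_mat n n" by (simp add: adj_mat_def)
  have C: "(- ?a) \<cdot>\<^sub>m 1\<^sub>m n \<in> carrier_mat n n" by simp
  have c2: "?c\<^sup>2 = of_real ?a" using al by (simp flip: of_real_power)
  have "(?c * \<mu>)\<^sup>2 = ?c\<^sup>2 * \<mu>\<^sup>2" by (simp add: power_mult_distrib)
  also have "\<mu>\<^sup>2 = of_real (l / sqrt ?a) * \<mu> - 1" using \<mu> by (simp add: algebra_simps)
  also have "?c\<^sup>2 * \<dots> = ?c * \<mu> * of_real l - of_real ?a"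
    using al c2 by (simp add: field_simps power2_eq_square)
  finally have key: "(?c * \<mu>)\<^sup>2 = ?c * \<mu> * of_real l - of_real ?a" .
  have eq: "(?c * \<mu>)\<^sup>2 * of_real (u i) = ?c * \<mu> * (\<Sum>j<n. of_real (adj_mat n E $$ (i, j)) * of_real (u j))
      + (\<Sum>j<n. of_real (((- ?a) \<cdot>\<^sub>m 1\<^sub>m n) $$ (i, j)) * of_real (u j))" if i: "i < n" for i
  proof -
    have "(\<Sum>j<n. complex_of_real (((- ?a) \<cdot>\<^sub>m 1\<^sub>m n) $$ (i, j)) * of_real (u j))
        = (\<Sum>j<n. if i = j then - of_real ?a * of_real (u j) else 0)"
      using i by (intro sum.cong) auto
    also have "\<dots> = - of_real ?a * of_real (u i)" using i by simp
    finally have 1: "(\<Sum>j<n. complex_of_real (((- ?a) \<cdot>\<^sub>m 1\<^sub>m n) $$ (i, j)) * of_real (u j))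
        = - of_real ?a * of_real (u i)" .
    have "(\<Sum>j<n. complex_of_real (adj_mat n E $$ (i, j)) * of_real (u j))
        = of_real (\<Sum>j<n. adj E i j * u j)"
      using i by (simp add: adj_mat_index)
    also have "\<dots> = of_real l * of_real (u i)" using u(1)[OF i] by simp
    finally have 2: "(\<Sum>j<n. complex_of_real (adj_mat n E $$ (i, j)) * of_real (u j)) = of_real l * of_real (u i)" .
    show ?thesis unfolding 1 2 key by (simp add: algebra_simps)
  qed
  have "\<exists>v. (\<exists>i<n. v i \<noteq> 0) \<and> (\<forall>i<n. (?c * \<mu>)\<^sup>2 * v i =
      ?c * \<mu> * (\<Sum>j<n. of_real (adj_mat n E $$ (i, j)) * v j)
      + (\<Sum>j<n. of_real (((- ?a) \<cdot>\<^sub>m 1\<^sub>m n) $$ (i, j)) * v j))"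
    using eq u(2,3) by (intro exI[of _ "\<lambda>i. complex_of_real (u i)"]) auto
  then show ?thesis
    unfolding scaled_eigenvalue_def nb_mat0_eq[OF p]
    using companion_eigenvalue_iff[OF A C, of "sqrt ?a" \<mu>] al by simp
qed

text \<open>The deterministic core. The hypotheses on \<open>\<theta>\<close> and \<open>d\<close>
  say that after scaling the squared bulk eigenvalues are at most \<open>4 - p\<close> and the
  squared outlier is at least \<open>4 + p\<close>; the residual \<open>d / alpha n p\<close> is
  then divided by the square root of this gap.\<close>

lemma eigenvalue_perturbation:
  assumes al: "0 < alpha n p" and p: "0 < p" "p \<le> 1" and d: "0 \<le> d"
    and bulk: "\<And>l u i. (\<And>i. i < n \<Longrightarrow> (\<Sum>j<n. centred p E i j * u j) = l * u i) \<Longrightarrow> i < n \<Longrightarrow> u i \<noteq> 0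
      \<Longrightarrow> \<bar>l\<bar> \<le> \<theta>"
    and deg: "\<And>i. i < n \<Longrightarrow> \<bar>(\<Sum>k<n. adj E i k) - (real n - 1) * p\<bar> \<le> d"
    and gap: "(\<theta> + p)\<^sup>2 \<le> (4 - p) * alpha n p" "0 \<le> \<theta>"
    and outlier: "0 \<le> (real n - 1) * p - d" "(4 + p) * alpha n p \<le> ((real n - 1) * p - d)\<^sup>2"
    and z: "scaled_eigenvalue n p (nb_mat n E) z"
  shows "\<exists>w. scaled_eigenvalue n p (nb_mat0 n p E) w \<and> dist z w \<le> 2 * (d / alpha n p) / sqrt p"
proof -
  define a where "a = alpha n p"
  define Z where "Z = of_real (sqrt a) * z"
  define L where "L = (real n - 1) * p - d"
  have a: "0 < a" using al by (simp add: a_def)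
  obtain v i0 where v: "i0 < n" "v i0 \<noteq> 0"
    "\<And>i. i < n \<Longrightarrow> Z\<^sup>2 * v i = Z * mvmult n (adj E) v i + of_real (1 - (\<Sum>k<n. adj E i k)) * v i"
    using scaled_eigenvalue_nb_matD[OF al z] unfolding Z_def a_def by metis
  \<comment> \<open>Here \<open>a + 1\<close> is the expected degree, so the residual of
    \<open>v\<close> is just the degree deviation, coordinate by coordinate.\<close>
  have small: "cmod ((Z\<^sup>2 + of_real a) * v i - Z * mvmult n (adj E) v i) \<le> d * cmod (v i)" if i: "i < n" for i
  proof -
    have "(Z\<^sup>2 + of_real a) * v i - Z * mvmult n (adj E) v i
        = of_real (a + 1 - (\<Sum>k<n. adj E i k)) * v i"
      using v(3)[OF i] by (simp add: algebra_simps)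
    then have "cmod ((Z\<^sup>2 + of_real a) * v i - Z * mvmult n (adj E) v i)
        = \<bar>(\<Sum>k<n. adj E i k) - (real n - 1) * p\<bar> * cmod (v i)"
      by (simp add: norm_mult a_def alpha_def abs_minus_commute del: of_real_add of_real_diff of_real_sum)
    also have "\<dots> \<le> d * cmod (v i)" using deg[OF i] by (intro mult_right_mono) auto
    finally show ?thesis .
  qed
  obtain l u i where u: "\<And>i. i < n \<Longrightarrow> (\<Sum>j<n. adj E i j * u j) = l * u i" "i < n" "u i \<noteq> 0"
    "cmod (Z\<^sup>2 + of_real a - Z * of_real l) \<le> d"
  proof (rule eigenvalue_near_pencil[where a = "adj E", OF adj_sym d v(1,2) small])
    fix l u i
    assume "\<And>i. i < n \<Longrightarrow> (\<Sum>j<n. adj E i j * u j) = l * u i" "i < n" "u i \<noteq> 0"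
      "cmod (Z\<^sup>2 + of_real a - Z * of_real l) \<le> d"
    then show thesis by (rule that)
  qed
  have "\<bar>l\<bar> \<le> \<theta> + p \<or> L \<le> l"
  proof (rule bulk_or_outlier[where x = "centred p E" and a = "adj E"])
    show "\<bar>\<Sum>i<n. \<Sum>j<n. w i * centred p E i j * w j\<bar> \<le> \<theta> * (\<Sum>i<n. (w i)\<^sup>2)" for w
      by (rule symmetric_quadratic_form_le[where a = "centred p E", OF centred_sym bulk])
    have "L * n = (\<Sum>i<n. L)" by simp
    also have "\<dots> \<le> (\<Sum>i<n. \<Sum>j<n. adj E i j)"
      using deg by (intro sum_mono) (force simp: L_def abs_le_iff)
    finally show "L * n \<le> (\<Sum>i<n. \<Sum>j<n. adj E i j)" .
  qed (use p u adj_eq_centred adj_sym in auto)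
  then have lgap: "p \<le> \<bar>(l / sqrt a)\<^sup>2 - 4\<bar>"
  proof
    assume "\<bar>l\<bar> \<le> \<theta> + p"
    then have "l\<^sup>2 \<le> (\<theta> + p)\<^sup>2"
      using gap(2) p by (simp flip: abs_le_square_iff)
    then have "l\<^sup>2 \<le> (4 - p) * a" using gap by (simp add: a_def)
    then have "(l / sqrt a)\<^sup>2 \<le> 4 - p" using a by (simp add: power_divide field_simps)
    then show ?thesis by linarith
  next
    assume "L \<le> l"
    then have "L\<^sup>2 \<le> l\<^sup>2" using outlier by (intro power_mono) (auto simp: L_def)
    then have "(4 + p) * a \<le> l\<^sup>2" using outlier by (simp add: a_def L_def)
    then have "4 + p \<le> (l / sqrt a)\<^sup>2" using a by (simp add: power_divide field_simps)
    then show ?thesis by linarith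
  qed
  have "of_real a * (z\<^sup>2 + 1 - z * of_real (l / sqrt a)) = Z\<^sup>2 + of_real a - Z * of_real l"
  proof -
    have sa: "complex_of_real a = of_real (sqrt a) * of_real (sqrt a)"
      using a by (simp flip: of_real_mult)
    show ?thesis unfolding Z_def sa using a by (simp add: field_simps power2_eq_square)
  qed
  then have "a * cmod (z\<^sup>2 + 1 - z * of_real (l / sqrt a)) \<le> d"
    using u(4) a by (metis abs_of_pos norm_mult norm_of_real)
  then have "cmod (z\<^sup>2 + 1 - z * of_real (l / sqrt a)) \<le> d / a" using a by (simp add: field_simps)
  then obtain \<mu> where "\<mu>\<^sup>2 - of_real (l / sqrt a) * \<mu> + 1 = 0" "dist z \<mu> \<le> 2 * (d / a) / sqrt p"
    using quadratic_root_near[OF _ p(1) lgap] by metis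
  then show ?thesis
    using scaled_eigenvalue_nb_mat0I[OF al _ p(2) u(1-3)] p unfolding a_def by auto
qed

section \<open>Concentration of degrees\<close>

lemma exp_le_quadratic:
  fixes x :: real
  assumes "\<bar>x\<bar> \<le> 1"
  shows "exp x \<le> 1 + x + x\<^sup>2"
proof (cases "0 \<le> x")
  case True
  then show ?thesis using exp_bound assms by simp
next
  case False
  define y where "y = - x"
  have y: "0 < y" using False by (simp add: y_def)
  have "exp x = 1 / exp y" by (simp add: y_def exp_minus field_simps)
  also have "\<dots> \<le> 1 / (1 + y)" using y exp_ge_add_one_self[of y] by (intro divide_left_mono) auto
  \<comment> \<open>Exact for the product with \<open>1 + y\<close>, which is
    \<open>1 + y ^ 3\<close>.\<close>
  also have "\<dots> \<le> 1 - y + y\<^sup>2"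
  proof -
    have "(1 - y + y\<^sup>2) * (1 + y) = 1 + y ^ 3"
      by (simp add: power2_eq_square power3_eq_cube algebra_simps)
    then show ?thesis using y by (simp add: divide_le_eq)
  qed
  finally show ?thesis by (simp add: y_def)
qed

text \<open>The terms linear in \<open>t\<close> cancel by centring, and the quadratic ones add up
  to the variance.\<close>

lemma bernoulli_mgf_le:
  fixes p t :: real
  assumes p: "0 \<le> p" "p \<le> 1" and t: "\<bar>t\<bar> \<le> 1"
  shows "p * exp (t * (1 - p)) + (1 - p) * exp (- t * p) \<le> exp (p * t\<^sup>2)"
proof -
  have "\<bar>t\<bar> * (1 - p) \<le> 1 * 1" "\<bar>t\<bar> * p \<le> 1 * 1" using p t by (intro mult_mono; simp)+
  then have "exp (t * (1 - p)) \<le> 1 + t * (1 - p) + (t * (1 - p))\<^sup>2" "exp (- t * p) \<le> 1 + - t * p + (- t * p)\<^sup>2"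
    using p by (intro exp_le_quadratic; simp add: abs_mult)+
  then have "p * exp (t * (1 - p)) + (1 - p) * exp (- t * p)
      \<le> p * (1 + t * (1 - p) + (t * (1 - p))\<^sup>2) + (1 - p) * (1 + - t * p + (- t * p)\<^sup>2)"
    using p by (intro add_mono mult_left_mono) auto
  also have "\<dots> = 1 + p * t\<^sup>2 * (1 - p)" by (simp add: power2_eq_square algebra_simps)
  also have "\<dots> \<le> 1 + p * t\<^sup>2" using p by (simp add: mult_left_le)
  also have "\<dots> \<le> exp (p * t\<^sup>2)" by (rule exp_ge_add_one_self)
  finally show ?thesis .
qed

lemma expectation_exp_degree_le:
  assumes p: "0 \<le> p" "p \<le> 1" and t: "\<bar>t\<bar> \<le> 1" and i: "i < n"
  shows "measure_pmf.expectation (gnp n p) (\<lambda>E. exp (t * (\<Sum>k<n. centred p E i k))) \<le> exp (real n * (p * t\<^sup>2))"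
proof -
  define J where "J = (\<lambda>k. (min i k, max i k)) ` ({..<n} - {i})"
  \<comment> \<open>The value 1 at edges not incident to \<open>i\<close> lets the product run over
    all vertex pairs, as independence is stated for these.\<close>
  define f where "f = (\<lambda>e b. if e \<in> J then exp (t * (of_bool b - p)) else 1)"
  have inj: "inj_on (\<lambda>k. (min i k, max i k)) ({..<n} - {i})"
    by (auto simp: inj_on_def min_def max_def split: if_splits)
  have J: "J \<subseteq> vertex_pairs n"
    using i by (auto simp: J_def vertex_pairs_def min_def max_def)
  have cardJ: "card J \<le> n"
    unfolding J_def by (rule order_trans[OF card_image_le]) (auto intro: order_trans[OF card_Diff1_le])
  have "exp (t * (\<Sum>k<n. centred p E i k)) = (\<Prod>e\<in>vertex_pairs n. f e (E e))" for E
  proof -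
    have "(\<Sum>k<n. centred p E i k) = (\<Sum>k\<in>{..<n} - {i}. centred p E i k)"
      by (rule sum.mono_neutral_right) (auto simp: centred_def)
    also have "\<dots> = (\<Sum>k\<in>{..<n} - {i}. of_bool (E (min i k, max i k)) - p)"
      by (intro sum.cong) (auto simp: centred_def)
    also have "\<dots> = (\<Sum>e\<in>J. of_bool (E e) - p)"
      unfolding J_def by (simp add: sum.reindex[OF inj])
    finally have "exp (t * (\<Sum>k<n. centred p E i k)) = (\<Prod>e\<in>J. exp (t * (of_bool (E e) - p)))"
      by (simp add: sum_distrib_left exp_sum finite_subset[OF J])
    also have "\<dots> = (\<Prod>e\<in>vertex_pairs n. f e (E e))"
      by (rule prod.mono_neutral_cong_left) (use J in \<open>auto simp: f_def\<close>)
    finally show ?thesis .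
  qed
  then have "measure_pmf.expectation (gnp n p) (\<lambda>E. exp (t * (\<Sum>k<n. centred p E i k)))
      = (\<Prod>e\<in>vertex_pairs n. p * f e True + (1 - p) * f e False)"
    using expectation_gnp_prod[OF p, of n f] by simp
  also have "\<dots> \<le> (\<Prod>e\<in>vertex_pairs n. if e \<in> J then exp (p * t\<^sup>2) else 1)"
  proof (rule prod_mono)
    fix e
    show "0 \<le> p * f e True + (1 - p) * f e False \<and>
      p * f e True + (1 - p) * f e False \<le> (if e \<in> J then exp (p * t\<^sup>2) else 1)"
      using p bernoulli_mgf_le[OF p t] by (auto simp: f_def)
  qed
  also have "\<dots> = (\<Prod>e\<in>J. exp (p * t\<^sup>2))"
    by (rule prod.mono_neutral_cong_right) (use J in auto)
  also have "\<dots> = exp (real (card J) * (p * t\<^sup>2))" by (simp flip: exp_of_nat_mult)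
  also have "\<dots> \<le> exp (real n * (p * t\<^sup>2))" using cardJ p by (simp add: mult_right_mono)
  finally show ?thesis .
qed

lemma degree_tail_bound:
  assumes p: "0 \<le> p" "p \<le> 1" and t: "0 < t" "t \<le> 1" and i: "i < n"
  shows "measure_pmf.prob (gnp n p) {E. s < \<bar>\<Sum>k<n. centred p E i k\<bar>}
    \<le> 2 * exp (real n * (p * t\<^sup>2) - t * s)"
proof -
  let ?S = "\<lambda>E. \<Sum>k<n. centred p E i k"
  have tail: "measure_pmf.prob (gnp n p) {E. exp (t * s) \<le> exp (\<tau> * ?S E)}
      \<le> exp (real n * (p * t\<^sup>2) - t * s)" if "\<bar>\<tau>\<bar> = t" for \<tau>
  proof -
    have "measure_pmf.prob (gnp n p) {E. exp (t * s) \<le> exp (\<tau> * ?S E)}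
        \<le> measure_pmf.expectation (gnp n p) (\<lambda>E. exp (\<tau> * ?S E)) / exp (t * s)"
      using integral_Markov_inequality_measure[of "measure_pmf (gnp n p)"
          "\<lambda>E. exp (\<tau> * ?S E)" "{}" "exp (t * s)"] by simp
    also have "\<dots> \<le> exp (real n * (p * \<tau>\<^sup>2)) / exp (t * s)"
      using expectation_exp_degree_le[OF p _ i, of \<tau>] t that by (intro divide_right_mono) auto
    also have "\<tau>\<^sup>2 = t\<^sup>2" using that by (metis power2_abs)
    finally show ?thesis by (simp add: exp_diff)
  qed
  have "{E. s < \<bar>?S E\<bar>} \<subseteq> {E. exp (t * s) \<le> exp (t * ?S E)} \<union> {E. exp (t * s) \<le> exp (- t * ?S E)}"
  proof
    fix E assume "E \<in> {E. s < \<bar>?S E\<bar>}"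
    then have "s \<le> ?S E \<or> s \<le> - ?S E" by auto
    then have "t * s \<le> t * ?S E \<or> t * s \<le> t * - ?S E" using t by (metis less_imp_le mult_left_mono)
    then show "E \<in> {E. exp (t * s) \<le> exp (t * ?S E)} \<union> {E. exp (t * s) \<le> exp (- t * ?S E)}" by simp
  qed
  then have "measure_pmf.prob (gnp n p) {E. s < \<bar>?S E\<bar>}
      \<le> measure_pmf.prob (gnp n p) ({E. exp (t * s) \<le> exp (t * ?S E)} \<union> {E. exp (t * s) \<le> exp (- t * ?S E)})"
    by (intro measure_pmf.finite_measure_mono) auto
  also have "\<dots> \<le> measure_pmf.prob (gnp n p) {E. exp (t * s) \<le> exp (t * ?S E)}
      + measure_pmf.prob (gnp n p) {E. exp (t * s) \<le> exp (- t * ?S E)}"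
    by (intro measure_Un_le) auto
  finally show ?thesis using tail[of t] tail[of "- t"] t by simp
qed

lemma sum_centred_eq_degree:
  assumes "i < n"
  shows "(\<Sum>k<n. centred p E i k) = (\<Sum>k<n. adj E i k) - (real n - 1) * p"
proof -
  have "(\<Sum>k<n. adj E i k) = (\<Sum>k<n. centred p E i k + p - (if i = k then p else 0))"
    by (intro sum.cong) (auto simp: adj_eq_centred[of E i _ p])
  also have "\<dots> = (\<Sum>k<n. centred p E i k) + real n * p - p"
    using assms by (simp add: sum.distrib sum_subtractf)
  finally show ?thesis by (simp add: algebra_simps)
qed

text \<open>Two bad events: the trace moment reaches \<open>\<theta> ^ K\<close>, bounded by
  Markov's inequality with moments of size \<open>2 n \<rho> ^ K\<close>, or some degree is off by
  more than \<open>d\<close>, bounded by a union over \<open>n\<close> vertices. \<open>K\<close> is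
  even so that the trace controls eigenvalues of both signs.\<close>

lemma prob_eigenvalues_close:
  fixes n k K :: nat and p c \<rho> \<theta> d t R :: real
  defines "c \<equiv> p * (1 - p)" and "K \<equiv> 2 * k"
  assumes p: "0 < p" "p \<le> 1" and n: "0 < n" and al: "0 < alpha n p" and k: "0 < k"
    and \<rho>: "0 < \<rho>" and \<theta>: "0 < \<theta>"
    and small: "4 * (c * n / \<rho>\<^sup>2) + 2 * ((c * K ^ 3 + K\<^sup>2 + K) / \<rho>\<^sup>2)
      + 2 * ((3 * c * K\<^sup>2 + c * K ^ 4) / \<rho> ^ 3) + 4 * (c * K * n / \<rho> ^ 3) \<le> 1"
    and gap: "(\<theta> + p)\<^sup>2 \<le> (4 - p) * alpha n p"
    and d: "0 \<le> d" and t: "0 < t" "t \<le> 1"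
    and outlier: "0 \<le> (real n - 1) * p - d" "(4 + p) * alpha n p \<le> ((real n - 1) * p - d)\<^sup>2"
    and R: "2 * (d / alpha n p) / sqrt p \<le> R"
  shows "measure_pmf.prob (gnp n p)
      {E. \<forall>z. scaled_eigenvalue n p (nb_mat n E) z \<longrightarrow>
        (\<exists>w. scaled_eigenvalue n p (nb_mat0 n p E) w \<and> dist z w \<le> R)}
    \<ge> 1 - 2 * n * (\<rho> / \<theta>) ^ K - n * (2 * exp (real n * (p * t\<^sup>2) - t * d))"
proof -
  let ?P = "measure_pmf.prob (gnp n p)"
  define G where "G = {E. \<forall>z. scaled_eigenvalue n p (nb_mat n E) z \<longrightarrow>
        (\<exists>w. scaled_eigenvalue n p (nb_mat0 n p E) w \<and> dist z w \<le> R)}"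
  define B1 where "B1 = {E. \<theta> ^ K \<le> (\<Sum>i<n. mpow n (centred p E) (2 * k) i i)}"
  define B2 where "B2 = (\<lambda>i. {E. d < \<bar>\<Sum>k<n. centred p E i k\<bar>})"
  have cover: "- G \<subseteq> B1 \<union> (\<Union>i<n. B2 i)"
  proof
    fix E assume E: "E \<in> - G"
    show "E \<in> B1 \<union> (\<Union>i<n. B2 i)"
    proof (rule ccontr)
      assume "\<not> ?thesis"
      then have tr: "(\<Sum>i<n. mpow n (centred p E) (2 * k) i i) < \<theta> ^ K"
        and deg: "\<And>i. i < n \<Longrightarrow> \<bar>\<Sum>k<n. centred p E i k\<bar> \<le> d"
        by (auto simp: B1_def B2_def not_le not_less)
      have bulk: "\<bar>l\<bar> \<le> \<theta>"
        if "\<And>i. i < n \<Longrightarrow> (\<Sum>j<n. centred p E i j * u j) = l * u i" "i < n" "u i \<noteq> 0" for l u i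
      proof (rule ccontr)
        assume "\<not> ?thesis"
        then have "\<theta> ^ K \<le> \<bar>l\<bar> ^ K" using \<theta> by (intro power_mono) auto
        also have "\<bar>l\<bar> ^ K = l ^ (2 * k)" by (simp add: K_def power_even_abs)
        also have "\<dots> \<le> (\<Sum>i<n. mpow n (centred p E) (2 * k) i i)"
          by (rule eigenvalue_power_le_trace[OF centred_sym that])
        finally show False using tr by simp
      qed
      have "\<exists>w. scaled_eigenvalue n p (nb_mat0 n p E) w \<and> dist z w \<le> 2 * (d / alpha n p) / sqrt p"
        if "scaled_eigenvalue n p (nb_mat n E) z" for z
      proof (rule eigenvalue_perturbation[OF al p d bulk _ gap _ outlier that])
        show "\<bar>(\<Sum>k<n. adj E i k) - (real n - 1) * p\<bar> \<le> d" if "i < n" for i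
          using deg[OF that] sum_centred_eq_degree[OF that] by simp
      qed (use \<theta> in auto)
      then have "\<exists>w. scaled_eigenvalue n p (nb_mat0 n p E) w \<and> dist z w \<le> R"
        if "scaled_eigenvalue n p (nb_mat n E) z" for z
        using that R order_trans by blast
      then have "E \<in> G" by (simp add: G_def)
      then show False using E by simp
    qed
  qed
  have "?P B1 \<le> walk_sum c n (2 * k) / \<theta> ^ K"
    unfolding B1_def c_def using p \<theta> by (intro trace_tail_bound) auto
  also have "\<dots> \<le> 2 * n * \<rho> ^ K / \<theta> ^ K"
    using walk_sum_bound[of c n \<rho> K K] p n \<rho> \<theta> small
    by (intro divide_right_mono) (auto simp: K_def c_def mult_le_one)
  finally have 1: "?P B1 \<le> 2 * n * (\<rho> / \<theta>) ^ K" by (simp add: power_divide)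
  have "?P (\<Union>i<n. B2 i) \<le> (\<Sum>i<n. ?P (B2 i))"
    by (intro measure_UNION_le) auto
  also have "\<dots> \<le> (\<Sum>i<n. 2 * exp (real n * (p * t\<^sup>2) - t * d))"
    unfolding B2_def using p t by (intro sum_mono degree_tail_bound) auto
  finally have 2: "?P (\<Union>i<n. B2 i) \<le> n * (2 * exp (real n * (p * t\<^sup>2) - t * d))" by simp
  have "?P (- G) \<le> ?P (B1 \<union> (\<Union>i<n. B2 i))"
    using cover by (intro measure_pmf.finite_measure_mono) auto
  also have "\<dots> \<le> ?P B1 + ?P (\<Union>i<n. B2 i)"
    by (intro measure_Un_le) auto
  finally have "?P (- G) \<le> 2 * n * (\<rho> / \<theta>) ^ K + n * (2 * exp (real n * (p * t\<^sup>2) - t * d))"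
    using 1 2 by linarith
  moreover have "?P (- G) = 1 - ?P G"
    using measure_pmf.prob_compl[of G "gnp n p"] by (simp add: Compl_eq_Diff_UNIV)
  ultimately show ?thesis by (simp add: G_def)
qed

section \<open>Asymptotics\<close>

text \<open>The conditions at the smallest density: \<open>x powr (5/6)\<close> stands for
  \<open>n p\<close>, \<open>x powr (2/3)\<close> for \<open>n p\<^sup>2\<close>, and
  \<open>x powr (1/5)\<close> bounds the walk length. Its exponent must exceed 1/6 because of
  \<open>ln x / p\<close>, and be below 1/4 for the term from the disconnected triple, the most
  restrictive part of the last condition.\<close>

lemma eventually_conditions:
  fixes q :: real
  assumes "0 < q"
  shows "\<forall>\<^sub>F x in at_top.
    64 \<le> x powr (5/6) \<and> 144 * ln x \<le> x powr (5/6) \<and> 18 \<le> x powr (2/3) \<and> 1 \<le> ln x \<and>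
    24 * ln x * x powr (1/6) + 2 \<le> x powr (1/5) \<and>
    (x powr (1/5)) ^ 3 / (2 * x) + (x powr (1/5))\<^sup>2 / (q * x powr (5/6))
      + (x powr (1/5)) ^ 4 / (x * sqrt (q * x powr (5/6))) + x powr (1/5) / (2 * sqrt (q * x powr (5/6)))
      \<le> x powr (-1/6) / 5"
proof (intro eventually_conj)
  show "\<forall>\<^sub>F x in at_top. (64::real) \<le> x powr (5/6)" by real_asymp
  show "\<forall>\<^sub>F x in at_top. 144 * ln x \<le> (x::real) powr (5/6)" by real_asymp
  show "\<forall>\<^sub>F x in at_top. (18::real) \<le> x powr (2/3)" by real_asymp
  show "\<forall>\<^sub>F x in at_top. (1::real) \<le> ln x" by real_asymp
  show "\<forall>\<^sub>F x in at_top. 24 * ln x * x powr (1/6) + 2 \<le> (x::real) powr (1/5)" by real_asymp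
  show "\<forall>\<^sub>F x in at_top. (x powr (1/5)) ^ 3 / (2 * x) + (x powr (1/5))\<^sup>2 / (q * x powr (5/6))
      + (x powr (1/5)) ^ 4 / (x * sqrt (q * x powr (5/6))) + x powr (1/5) / (2 * sqrt (q * x powr (5/6)))
      \<le> x powr (-1/6) / 5"
    using assms by real_asymp
qed


lemma small_condition:
  fixes x p q c \<rho> :: real and K :: nat
  assumes x: "0 < x" and q: "0 < q" and p: "0 < p" "p \<le> 1" "x powr (-1/6) \<le> p"
    and c: "0 < c" "c \<le> 1" "q * x powr (5/6) \<le> x * c"
    and \<rho>: "\<rho> = sqrt (4 * (1 + p / 4) * (x * c))"
    and K: "1 \<le> K" "K \<le> x powr (1/5)"
    and small: "(x powr (1/5)) ^ 3 / (2 * x) + (x powr (1/5))\<^sup>2 / (q * x powr (5/6))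
      + (x powr (1/5)) ^ 4 / (x * sqrt (q * x powr (5/6))) + x powr (1/5) / (2 * sqrt (q * x powr (5/6)))
      \<le> x powr (-1/6) / 5"
  shows "4 * (c * x / \<rho>\<^sup>2) + 2 * ((c * K ^ 3 + K\<^sup>2 + K) / \<rho>\<^sup>2)
      + 2 * ((3 * c * K\<^sup>2 + c * K ^ 4) / \<rho> ^ 3) + 4 * (c * K * x / \<rho> ^ 3) \<le> 1"
proof -
  define w where "w = x powr (1/5)"
  define y where "y = q * x powr (5/6)"
  define k where "k = real K"
  have y: "0 < y" "y \<le> x * c" using x q c by (simp_all add: y_def)
  have k: "1 \<le> k" "k \<le> w" using K by (simp_all add: k_def w_def)
  have xc: "0 < x * c" using x c by simp
  have \<rho>2: "\<rho>\<^sup>2 = 4 * (1 + p / 4) * (x * c)" using p xc by (simp add: \<rho>)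
  have "4 * 1 * (x * c) \<le> 4 * (1 + p / 4) * (x * c)"
    using p xc by (intro mult_right_mono mult_left_mono) auto
  then have \<rho>2': "4 * (x * c) \<le> \<rho>\<^sup>2" and "sqrt (4 * (x * c)) \<le> \<rho>"
    unfolding \<rho>2 unfolding \<rho> by simp_all
  from this(2) have \<rho>1: "2 * sqrt (x * c) \<le> \<rho>" by (simp add: real_sqrt_mult)
  have sy: "0 < sqrt y" "sqrt y \<le> sqrt (x * c)" using y by simp_all
  have \<rho>3: "8 * (x * c) * sqrt y \<le> \<rho> ^ 3"
  proof -
    have "2 * sqrt y \<le> \<rho>" using \<rho>1 sy by linarith
    with \<rho>2' have "(4 * (x * c)) * (2 * sqrt y) \<le> \<rho>\<^sup>2 * \<rho>"
      by (rule mult_mono) (use sy in auto)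
    then show ?thesis by (simp add: power3_eq_cube power2_eq_square mult_ac)
  qed
  have kw: "k ^ m \<le> w ^ m" for m using k by (intro power_mono) auto
  have w0: "0 < w" using x by (simp add: w_def)
  \<comment> \<open>The slack \<open>1 + p / 4\<close> in \<open>\<rho>\<close> lowers the leading
    coefficient by at least \<open>p / 5\<close>, and this is what all the error terms together may
    use up.\<close>
  have 0: "4 * (c * x / \<rho>\<^sup>2) \<le> 1 - p / 5"
  proof -
    have "4 * (c * x / \<rho>\<^sup>2) = 1 / (1 + p / 4)"
    proof -
      have "4 * (c * x / (4 * u * (x * c))) = 1 / u" if "0 < u" for u
        using x c that by (simp add: field_simps)
      then show ?thesis unfolding \<rho>2 by this (use p in simp)
    qed
    also have "\<dots> \<le> 1 - p / 5"
    proof -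
      have "(1 - p / 5) * (1 + p / 4) = 1 + p * (1 - p) / 20" by (simp add: field_simps)
      moreover have "0 \<le> p * (1 - p)" using p by simp
      ultimately have "1 \<le> (1 - p / 5) * (1 + p / 4)" by linarith
      then show ?thesis using p by (simp add: divide_le_eq)
    qed
    finally show ?thesis .
  qed
  have 1: "2 * ((c * k ^ 3 + k\<^sup>2 + k) / \<rho>\<^sup>2) \<le> w ^ 3 / (2 * x) + w\<^sup>2 / y"
  proof -
    have "k \<le> k\<^sup>2" using k by (simp add: power2_eq_square)
    moreover have "c * k ^ 3 \<le> c * w ^ 3" using c kw[of 3] by (intro mult_left_mono) auto
    ultimately have "c * k ^ 3 + k\<^sup>2 + k \<le> c * w ^ 3 + 2 * w\<^sup>2" using kw[of 2] by linarith
    then have "(c * k ^ 3 + k\<^sup>2 + k) / \<rho>\<^sup>2 \<le> (c * w ^ 3 + 2 * w\<^sup>2) / (4 * (x * c))"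
      using \<rho>2' xc c w0 by (intro frac_le) auto
    then have "2 * ((c * k ^ 3 + k\<^sup>2 + k) / \<rho>\<^sup>2) \<le> 2 * ((c * w ^ 3 + 2 * w\<^sup>2) / (4 * (x * c)))" by linarith
    also have "\<dots> = w ^ 3 / (2 * x) + w\<^sup>2 / (x * c)" using x c by (simp add: field_simps)
    also have "\<dots> \<le> w ^ 3 / (2 * x) + w\<^sup>2 / y" using y by (intro add_left_mono divide_left_mono) auto
    finally show ?thesis .
  qed
  have 2: "2 * ((3 * c * k\<^sup>2 + c * k ^ 4) / \<rho> ^ 3) \<le> w ^ 4 / (x * sqrt y)"
  proof -
    have "k\<^sup>2 \<le> k ^ 4" using k by (intro power_increasing) auto
    then have "3 * k\<^sup>2 + k ^ 4 \<le> 4 * w ^ 4" using kw[of 4] by linarith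
    then have "c * (3 * k\<^sup>2 + k ^ 4) \<le> c * (4 * w ^ 4)" using c by (intro mult_left_mono) auto
    then have "3 * c * k\<^sup>2 + c * k ^ 4 \<le> 4 * c * w ^ 4" by (simp add: algebra_simps)
    then have "(3 * c * k\<^sup>2 + c * k ^ 4) / \<rho> ^ 3 \<le> (4 * c * w ^ 4) / (8 * (x * c) * sqrt y)"
      using \<rho>3 xc sy c w0 by (intro frac_le) auto
    then have "2 * ((3 * c * k\<^sup>2 + c * k ^ 4) / \<rho> ^ 3) \<le> 2 * ((4 * c * w ^ 4) / (8 * (x * c) * sqrt y))" by linarith
    also have "\<dots> = w ^ 4 / (x * sqrt y)" using x c sy by (simp add: field_simps)
    finally show ?thesis .
  qed
  have 3: "4 * (c * k * x / \<rho> ^ 3) \<le> w / (2 * sqrt y)"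
  proof -
    have "c * k * x / \<rho> ^ 3 \<le> c * w * x / (8 * (x * c) * sqrt y)"
      using \<rho>3 xc sy c w0 k x by (intro frac_le mult_right_mono mult_left_mono) auto
    then have "4 * (c * k * x / \<rho> ^ 3) \<le> 4 * (c * w * x / (8 * (x * c) * sqrt y))" by linarith
    also have "\<dots> = w / (2 * sqrt y)" using x c sy by (simp add: field_simps)
    finally show ?thesis .
  qed
  have "w ^ 3 / (2 * x) + w\<^sup>2 / y + w ^ 4 / (x * sqrt y) + w / (2 * sqrt y) \<le> p / 5"
    using small p unfolding w_def y_def by linarith
  then show ?thesis using 0 1 2 3 unfolding k_def of_nat_power by linarith
qed

text \<open>The variance factor makes \<open>\<theta>\<^sup>2\<close> at most
  \<open>4 m - 2 m p\<close>, while only \<open>m p\<close> is demanded by \<open>4 - p\<close>. Of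
  the surplus \<open>m p\<close>, one half covers the cross term \<open>2 \<theta> p\<close>, for
  which \<open>m \<ge> 64\<close> ensures \<open>\<theta> \<le> m / 4\<close>; the other half is at
  least 9 and covers the constants.\<close>

lemma gap_condition:
  fixes m p \<theta> a :: real
  assumes p: "0 < p" "p \<le> 1" and m: "64 \<le> m" "18 \<le> m * p" and a: "m - 2 \<le> a"
    and \<theta>: "\<theta> = sqrt (4 * m * ((1 - p) * (1 + p / 2)))"
  shows "(\<theta> + p)\<^sup>2 \<le> (4 - p) * a"
proof -
  have le: "(1 - p) * (1 + p / 2) \<le> 1 - p / 2" by (simp add: algebra_simps)
  have ge: "0 \<le> (1 - p) * (1 + p / 2)" using p by simp
  have "\<theta>\<^sup>2 = 4 * m * ((1 - p) * (1 + p / 2))" using m ge unfolding \<theta> by simp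
  also have "\<dots> \<le> 4 * m * (1 - p / 2)" using m le by (intro mult_left_mono) auto
  finally have \<theta>2: "\<theta>\<^sup>2 \<le> 4 * m - 2 * (m * p)" by (simp add: algebra_simps)
  have "\<theta> \<le> m / 4"
  proof (rule power2_le_imp_le)
    have "4 * m \<le> (m / 4)\<^sup>2" using m mult_right_mono[of 64 m m] by (simp add: power2_eq_square)
    moreover have "0 \<le> m * p" using m p by simp
    ultimately show "\<theta>\<^sup>2 \<le> (m / 4)\<^sup>2" using \<theta>2 by linarith
  qed (use m in simp)
  then have "2 * \<theta> * p \<le> m * p / 2" using p mult_right_mono[of \<theta> "m / 4" p] by simp
  moreover have "p\<^sup>2 \<le> 1" using p by (simp add: power_le_one)
  ultimately have "(\<theta> + p)\<^sup>2 \<le> 4 * m - 2 * (m * p) + m * p / 2 + 1"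
    using \<theta>2 by (simp add: power2_sum)
  also have "\<dots> \<le> (4 - p) * (m - 2)" using m p by (simp add: algebra_simps)
  also have "\<dots> \<le> (4 - p) * a" using a p by (intro mult_left_mono) auto
  finally show ?thesis .
qed

text \<open>The ratio of \<open>\<rho>\<^sup>2\<close> to \<open>\<theta>\<^sup>2\<close> is at most
  \<open>1 - p / 6\<close>. The factor 12 makes its \<open>k\<close>-th power at most
  \<open>n powr (-2)\<close> for \<open>L = ln n\<close>, which beats the dimension factor of the
  trace.\<close>

lemma ratio_power_le:
  fixes p L :: real and k :: nat
  assumes p: "0 < p" "p \<le> 1" and k: "12 * L / p \<le> k"
  shows "((1 + p / 4) / (1 + p / 2)) ^ k \<le> exp (- 2 * L)"
proof -
  have "(1 - p / 6) * (1 + p / 2) = 1 + p / 4 + p * (1 - p) / 12" by (simp add: field_simps)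
  moreover have "0 \<le> p * (1 - p)" using p by simp
  ultimately have "1 + p / 4 \<le> (1 - p / 6) * (1 + p / 2)" by linarith
  then have "(1 + p / 4) / (1 + p / 2) \<le> 1 - p / 6" using p by (simp add: divide_le_eq)
  also have "\<dots> \<le> exp (- (p / 6))" using exp_ge_add_one_self[of "- (p / 6)"] by simp
  finally have "((1 + p / 4) / (1 + p / 2)) ^ k \<le> exp (- (p / 6)) ^ k"
    using p by (intro power_mono) auto
  also have "\<dots> = exp (- (p * k / 6))" by (simp flip: exp_of_nat_mult)
  also have "\<dots> \<le> exp (- 2 * L)" using k p by (simp add: field_simps)
  finally show ?thesis .
qed

section \<open>Choice of the parameters\<close>

lemma prob_eigenvalues_close_explicit:
  fixes n :: nat and p q :: real
  defines "x \<equiv> real n"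
  assumes q: "0 < q" and p: "x powr (-1/6) \<le> p" "p \<le> 1 - q"
    and large: "64 \<le> x powr (5/6)" "144 * ln x \<le> x powr (5/6)" "18 \<le> x powr (2/3)"
      "1 \<le> ln x" "24 * ln x * x powr (1/6) + 2 \<le> x powr (1/5)"
      "(x powr (1/5)) ^ 3 / (2 * x) + (x powr (1/5))\<^sup>2 / (q * x powr (5/6))
      + (x powr (1/5)) ^ 4 / (x * sqrt (q * x powr (5/6))) + x powr (1/5) / (2 * sqrt (q * x powr (5/6)))
      \<le> x powr (-1/6) / 5"
  shows "1 - 2 / x - 2 * x * x powr (-9/4) \<le> measure_pmf.prob (gnp n p)
      {E. \<forall>z. scaled_eigenvalue n p (nb_mat n E) z \<longrightarrow>
        (\<exists>w. scaled_eigenvalue n p (nb_mat0 n p E) w \<and> dist z w \<le> 40 * sqrt (ln x / (x * p\<^sup>2)))}"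
proof -
  define L where "L = ln x"
  define m where "m = x * p"
  define a where "a = alpha n p"
  define c where "c = p * (1 - p)"
  define \<rho> where "\<rho> = sqrt (4 * (1 + p / 4) * (x * c))"
  define \<theta> where "\<theta> = sqrt (4 * m * ((1 - p) * (1 + p / 2)))"
  define d where "d = 3 * sqrt (m * L)"
  \<comment> \<open>The minimiser of \<open>m t\<^sup>2 - t d\<close>, with minimum
    \<open>- d\<^sup>2 / (4 m)\<close>. The constant 3 in \<open>d\<close> turns this into
    \<open>- 9/4 * L\<close>, more than the union over \<open>n\<close> vertices needs.\<close>
  define t where "t = d / (2 * m)"
  define k where "k = nat \<lceil>12 * L / p\<rceil>"
  have "x \<noteq> 0" using large(4) by auto
  then have x: "0 < x" and n: "0 < n" by (auto simp: x_def)
  have L: "1 \<le> L" "L > 0" using large(4) by (simp_all add: L_def)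
  have "0 < x powr (-1/6)" using x by simp
  then have p0: "0 < p" "p < 1" using p q by linarith+
  have m: "x powr (5/6) \<le> m"
  proof -
    have "x powr (5/6) = x * x powr (-1/6)" using x by (simp add: powr_mult_base)
    then show ?thesis using p x by (simp add: m_def)
  qed
  have m64: "64 \<le> m" "144 * L \<le> m" and m0: "0 < m" using m large by (simp_all add: L_def)
  have mp: "18 \<le> m * p"
  proof -
    have "x powr (2/3) = x powr (5/6) * x powr (-1/6)" by (simp flip: powr_add)
    also have "\<dots> \<le> m * p" using m p x m0 by (intro mult_mono) auto
    finally show ?thesis using large(3) by simp
  qed
  have aeq: "a = m - p - 1" by (simp add: a_def alpha_def m_def x_def algebra_simps)
  have a: "m - 2 \<le> a" "a \<le> m" "0 < a" "m / 2 \<le> a" using aeq p0 m64 by simp_all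
  have d2: "d\<^sup>2 = 9 * (m * L)" using m0 L by (simp add: d_def power_mult_distrib)
  have d0: "0 < d" using m0 L by (simp add: d_def)
  \<comment> \<open>The condition \<open>144 * L \<le> m\<close> is exactly
    \<open>d\<^sup>2 \<le> (m / 4)\<^sup>2\<close>.\<close>
  have dm: "d \<le> m / 4"
  proof (rule power2_le_imp_le)
    show "d\<^sup>2 \<le> (m / 4)\<^sup>2" using d2 mult_left_mono[OF m64(2), of m] m0 by (simp add: power2_eq_square)
  qed (use m0 in simp)
  have t: "0 < t" "t \<le> 1" using dm d0 m0 by (simp_all add: t_def field_simps)
  have c: "0 < c" "c \<le> 1" using p0 by (simp_all add: c_def mult_le_one)
  have xc: "q * x powr (5/6) \<le> x * c"
  proof -
    have "q * x powr (5/6) \<le> (1 - p) * m" using m m0 p q p0 by (intro mult_mono) auto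
    then show ?thesis by (simp add: m_def c_def mult_ac)
  qed
  have "0 < 12 * L / p" using L p0 by simp
  then have k: "0 < k" "12 * L / p \<le> k" "k \<le> 12 * L / p + 1" unfolding k_def by linarith+
  have K: "real (2 * k) \<le> x powr (1/5)"
  proof -
    have "1 / p \<le> 1 / x powr (-1/6)" using p x p0 by (intro divide_left_mono) auto
    also have "\<dots> = x powr (1/6)" by (simp add: powr_minus_divide)
    finally have "24 * L * (1 / p) \<le> 24 * L * x powr (1/6)" using L by (intro mult_left_mono) auto
    then show ?thesis using k(3) large(5) by (simp add: L_def)
  qed
  have theta2: "\<theta>\<^sup>2 = 4 * (1 + p / 2) * (x * c)" "0 < \<theta>"
  proof -
    have "0 < 4 * m * ((1 - p) * (1 + p / 2))" using m0 p0 by (intro mult_pos_pos) auto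
    then have "\<theta>\<^sup>2 = 4 * m * ((1 - p) * (1 + p / 2))" "0 < \<theta>"
      unfolding \<theta>_def using real_sqrt_pow2 real_sqrt_gt_zero by (metis less_imp_le)+
    then show "\<theta>\<^sup>2 = 4 * (1 + p / 2) * (x * c)" "0 < \<theta>" by (simp_all add: m_def c_def mult_ac)
  qed
  have rho2: "\<rho>\<^sup>2 = 4 * (1 + p / 4) * (x * c)" "0 < \<rho>"
    using x c p0 unfolding \<rho>_def by simp_all
  have ratio: "(\<rho> / \<theta>) ^ (2 * k) \<le> 1 / x\<^sup>2"
  proof -
    have "(\<rho> / \<theta>)\<^sup>2 = (1 + p / 4) / (1 + p / 2)"
    proof -
      have "4 * u * (x * c) / (4 * v * (x * c)) = u / v" for u v using x c by simp
      then show ?thesis unfolding power_divide theta2(1) rho2(1) .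
    qed
    then have "(\<rho> / \<theta>) ^ (2 * k) = ((1 + p / 4) / (1 + p / 2)) ^ k" by (simp add: power_mult)
    also have "\<dots> \<le> exp (- 2 * L)" using p0 k by (intro ratio_power_le) auto
    also have "\<dots> = 1 / x\<^sup>2"
    proof -
      have "exp (2 * L) = x\<^sup>2" using x by (simp add: L_def exp_double)
      then show ?thesis using exp_minus[of "2 * L"] by (simp add: field_simps)
    qed
    finally show ?thesis .
  qed
  have expo: "exp (real n * (p * t\<^sup>2) - t * d) = x powr (-9/4)"
  proof -
    have "real n * (p * t\<^sup>2) - t * d = - (d\<^sup>2 / (4 * m))"
      using m0 by (simp add: t_def x_def[symmetric] m_def power2_eq_square field_simps)
    also have "\<dots> = -9/4 * L" using m0 by (simp add: d2)
    finally show ?thesis using x by (simp add: powr_def L_def)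
  qed
  have nd: "(real n - 1) * p - d \<ge> m / 2"
    using dm p0 m64 by (simp add: m_def x_def algebra_simps)
  \<comment> \<open>With \<open>a \<ge> m / 2\<close> the constant comes out as 12.\<close>
  have R: "2 * (d / a) / sqrt p \<le> 40 * sqrt (L / (x * p\<^sup>2))"
  proof -
    have "d / sqrt p = 3 * sqrt (x * L)"
      using p0 by (simp add: d_def m_def real_sqrt_mult)
    moreover have "2 * (d / a) / sqrt p = 2 * (d / sqrt p) / a" by (simp add: mult.commute)
    ultimately have "2 * (d / a) / sqrt p = 6 * sqrt (x * L) / a" by simp
    also have "\<dots> \<le> 6 * sqrt (x * L) / (m / 2)"
      using a m0 x L by (intro divide_left_mono) auto
    also have "\<dots> = 12 * sqrt (L / (x * p\<^sup>2))"
      using x p0 by (simp add: m_def real_sqrt_mult real_sqrt_divide field_simps)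
    also have "\<dots> \<le> 40 * sqrt (L / (x * p\<^sup>2))" using x L by (intro mult_right_mono) auto
    finally show ?thesis .
  qed
  have "1 - 2 * n * (\<rho> / \<theta>) ^ (2 * k) - n * (2 * exp (real n * (p * t\<^sup>2) - t * d))
    \<le> measure_pmf.prob (gnp n p)
      {E. \<forall>z. scaled_eigenvalue n p (nb_mat n E) z \<longrightarrow>
        (\<exists>w. scaled_eigenvalue n p (nb_mat0 n p E) w \<and> dist z w \<le> 40 * sqrt (L / (x * p\<^sup>2)))}"
  proof (rule prob_eigenvalues_close[OF _ _ n _ k(1) rho2(2) theta2(2)])
    show "4 * (p * (1 - p) * real n / \<rho>\<^sup>2)
      + 2 * ((p * (1 - p) * (2 * k) ^ 3 + (2 * k)\<^sup>2 + (2 * k)) / \<rho>\<^sup>2)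
      + 2 * ((3 * (p * (1 - p)) * (2 * k)\<^sup>2 + p * (1 - p) * (2 * k) ^ 4) / \<rho> ^ 3)
      + 4 * (p * (1 - p) * (2 * k) * real n / \<rho> ^ 3) \<le> 1"
      unfolding c_def[symmetric] x_def[symmetric]
      by (rule small_condition[OF x q p0(1) _ p(1) c xc \<rho>_def _ K large(6)]) (use p0 k in auto)
    show "(\<theta> + p)\<^sup>2 \<le> (4 - p) * alpha n p"
      unfolding a_def[symmetric] using p0 m64 mp a by (intro gap_condition[OF _ _ _ _ _ \<theta>_def]) auto
    show "(4 + p) * alpha n p \<le> ((real n - 1) * p - d)\<^sup>2"
    proof -
      have "(4 + p) * alpha n p \<le> 5 * m"
        unfolding a_def[symmetric] using a p0 m0 by (intro mult_mono) auto
      also have "\<dots> \<le> (m / 2)\<^sup>2" using mult_right_mono[OF m64(1), of m] m0 by (simp add: power2_eq_square)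
      also have "\<dots> \<le> ((real n - 1) * p - d)\<^sup>2" using nd m0 by (intro power_mono) auto
      finally show ?thesis .
    qed
  qed (use p0 a d0 t nd m0 R in \<open>auto simp: a_def\<close>)
  moreover have "2 * n * (\<rho> / \<theta>) ^ (2 * k) \<le> 2 / x"
  proof -
    have "2 * x * (\<rho> / \<theta>) ^ (2 * k) \<le> 2 * x * (1 / x\<^sup>2)" using ratio x by (intro mult_left_mono) auto
    also have "\<dots> = 2 / x" using x by (simp add: power2_eq_square)
    finally show ?thesis by (simp add: x_def)
  qed
  ultimately show ?thesis unfolding expo by (simp add: x_def L_def)
qed

theorem theorem1p6:
  fixes p0 \<epsilon> :: real and p :: "nat \<Rightarrow> real"
  assumes "0 < p0" "p0 < 1" "0 < \<epsilon>"
    and "\<forall>\<^sub>F n in sequentially. 0 < p n \<and> p n \<le> p0"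
    and "\<forall>\<^sub>F n in sequentially.
           p n \<ge> ln (real n) powr (2 / 3 + \<epsilon>) / real n powr (1 / 6)"
  shows "(\<lambda>n. measure_pmf.prob (gnp n (p n))
            {E. \<forall>z. scaled_eigenvalue n (p n) (nb_mat n E) z \<longrightarrow>
                  (\<exists>w. scaled_eigenvalue n (p n) (nb_mat0 n (p n) E) w \<and>
                       dist z w \<le> 40 * sqrt (ln (real n) / (real n * (p n)\<^sup>2)))})
         \<longlonglongrightarrow> 1"
proof (rule tendsto_sandwich[where h = "\<lambda>_. 1"])
  \<comment> \<open>A lower bound for \<open>1 - p n\<close>, uniform in \<open>n\<close>, so that
    the variance of a row sum is at least of order \<open>n powr (5/6)\<close>.\<close>
  have q: "0 < 1 - p0" using assms by simp
  have "\<forall>\<^sub>F n in sequentially. 1 \<le> ln (real n)" by real_asymp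
  then have p_ge: "\<forall>\<^sub>F n in sequentially. real n powr (-1/6) \<le> p n"
    using assms(5)
  proof eventually_elim
    case (elim n)
    have "1 \<le> ln (real n) powr (2 / 3 + \<epsilon>)" using elim(1) assms(3) by (intro ge_one_powr_ge_zero) auto
    then have "1 / real n powr (1 / 6) \<le> ln (real n) powr (2 / 3 + \<epsilon>) / real n powr (1 / 6)"
      by (intro divide_right_mono) auto
    then show ?case using elim(2) by (simp add: powr_minus_divide)
  qed
  show "\<forall>\<^sub>F n in sequentially. 1 - 2 / real n - 2 * real n * real n powr (-9/4)
      \<le> measure_pmf.prob (gnp n (p n))
            {E. \<forall>z. scaled_eigenvalue n (p n) (nb_mat n E) z \<longrightarrow>
                  (\<exists>w. scaled_eigenvalue n (p n) (nb_mat0 n (p n) E) w \<and>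
                       dist z w \<le> 40 * sqrt (ln (real n) / (real n * (p n)\<^sup>2)))}"
    using p_ge assms(4) filterlim_real_sequentially[THEN filterlim_iff[THEN iffD1], rule_format, OF eventually_conditions[OF q]]
    by eventually_elim (rule prob_eigenvalues_close_explicit[OF q], auto)
  show "(\<lambda>n. 1 - 2 / real n - 2 * real n * real n powr (-9/4)) \<longlonglongrightarrow> 1" by real_asymp
qed (auto intro: always_eventually)

end
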